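(* There exist universal constants $C,\alpha>0$ such that for every integer $n\ge 2$ and any convex bodies $K_1,K_2\subseteq\mathbb{R}^n$, $$ d_{BM}(K_1,K_2)\le C\,n\,(\log n)^{\alpha}. $$
   Context: A convex body in $\mathbb{R}^n$ is a compact convex set with non-empty interior. For convex bodies $K_1,K_2\subseteq\mathbb{R}^n$ (not assumed symmetric), the Banach–Mazur distance $d_{BM}(K_1,K_2)$ is the infimum over all $\lambda\ge 1$ for which there exist an invertible linear map $T:\mathbb{R}^n\to\mathbb{R}^n$ and vectors $x,y\in\mathbb{R}^n$ with $$ y+K_2\subseteq T(x+K_1)\subseteq \lambda\,(y+K_2). $$ *)

theory Defs
  imports "HOL-Analysis.Analysis" "HOL-Library.Function_Algebras"
begin

text \<open>
  The constants in the theorem do not depend on the dimension, so the dimension must be a term: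
  \<open>\<real>\<^sup>n\<close> is the library's \<^const>\<open>Euclidean_space\<close> \<open>n\<close>, whose points are the sequences
  \<open>x :: nat \<Rightarrow> real\<close> with \<open>x i = 0\<close> for \<open>i \<ge> n\<close>. The pointwise vector space structure on functions
  makes \<^const>\<open>convex\<close> and \<^const>\<open>linear\<close> available there; the library provides only the additive
  part of it.
\<close>

instantiation "fun" :: (type, real_vector) real_vector
begin

definition scaleR_fun :: "real \<Rightarrow> ('a \<Rightarrow> 'b) \<Rightarrow> 'a \<Rightarrow> 'b"
  where "scaleR_fun c f = (\<lambda>i. c *\<^sub>R f i)"

instance
  by standard (simp_all add: scaleR_fun_def fun_eq_iff scaleR_add_right scaleR_add_left)

end

text \<open>
  \<^const>\<open>compactin\<close> includes \<open>K \<subseteq> topspace (Euclidean_space n)\<close>. The interior is taken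
  in \<open>\<real>\<^sup>n\<close>, not in the ambient sequence space.
\<close>

definition convex_body :: "nat \<Rightarrow> (nat \<Rightarrow> real) set \<Rightarrow> bool"
  where "convex_body n K \<longleftrightarrow>
    compactin (Euclidean_space n) K \<and> convex K \<and> Euclidean_space n interior_of K \<noteq> {}"

text \<open>
  Linearity is required on the ambient sequence space, which is no restriction: a linear
  bijection of \<open>\<real>\<^sup>n\<close> extends by precomposing it with the truncation to the first \<open>n\<close> coordinates,
  and only the values of \<open>T\<close> on \<open>\<real>\<^sup>n\<close> matter.
\<close>

definition invertible_linear_on :: "nat \<Rightarrow> ((nat \<Rightarrow> real) \<Rightarrow> nat \<Rightarrow> real) \<Rightarrow> bool"
  where "invertible_linear_on n T \<longleftrightarrow>
    linear T \<and> bij_betw T (topspace (Euclidean_space n)) (topspace (Euclidean_space n))"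

text \<open>
  The infimum is taken in \<^typ>\<open>ereal\<close>, where the infimum of the empty set is \<open>\<infinity>\<close> rather than an
  unspecified real number.
\<close>

definition banach_mazur_distance :: "nat \<Rightarrow> (nat \<Rightarrow> real) set \<Rightarrow> (nat \<Rightarrow> real) set \<Rightarrow> ereal"
  where "banach_mazur_distance n K\<^sub>1 K\<^sub>2 =
    (INF l \<in> {l::real. 1 \<le> l \<and>
        (\<exists>T. \<exists>x \<in> topspace (Euclidean_space n). \<exists>y \<in> topspace (Euclidean_space n).
          invertible_linear_on n T \<and>
          (\<lambda>z. y + z) ` K\<^sub>2 \<subseteq> T ` (\<lambda>z. x + z) ` K\<^sub>1 \<and>
          T ` (\<lambda>z. x + z) ` K\<^sub>1 \<subseteq> (\<lambda>z. l *\<^sub>R z) ` (\<lambda>z. y + z) ` K\<^sub>2)}. ereal l)"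

end

theory Submission
  imports Defs "Jordan_Normal_Form.Determinant"
begin

text \<open>
  Put \<open>K\<^sub>1\<close> and \<open>K\<^sub>2\<close> into Lewis' \<open>\<ell>\<close>-position (with a suitable centre), where the mean widths of
  the body and of its polar are at most \<open>C n (log n)\<^sup>2\<close> and \<open>C\<close>. An orthogonal map for
  which Chevet's inequality holds then gives \<open>U K\<^sub>1 \<subseteq> b K\<^sub>2\<close> and \<open>U\<^sup>T K\<^sub>2 \<subseteq> b K\<^sub>1\<close> with
  \<open>b \<le> C \<surd>n (log n)\<^sup>2\<close>, so the distance is at most \<open>b\<^sup>2\<close>.

  No measure theory is involved. The Gaussian vector is replaced by normalised sums of \<open>N\<close> random
  signs with \<open>N\<close> huge, and every maximum of linear functionals by a log-sum-exp over a finite net,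
  whose gradient and Hessian are the mean and the covariance of the softmax weights.
  The \<open>\<ell>\<close>-position minimises the mean log-sum-exp of the polar net minus a multiple of the
  logarithm of the determinant. The bound on the mean width of the body (the \<open>MM*\<close>-estimate without
  symmetry) compares the level-one Walsh coefficients of a polynomial in the noise parameter
  with its values on \<open>[0, 1/2]\<close>. Chevet's inequality follows from the second-order
  optimality of a minimiser over the orthogonal group along plane rotations, in place of
  Gaussian comparison.
\<close>

section \<open>Log-sum-exp and softmax averages\<close>

text \<open>A log-sum-exp exceeds the maximum by up to the logarithm of the size of the net, which
  no function of the dimension bounds. Functionals are therefore multiplied by a number at least as
  large as this logarithm before smoothing, and the result is divided by it: an error of at most 1
  remains. Discretisation errors depend on radii and on \<open>N\<close>. They are harmless because
  \<open>N\<close> is chosen last; the positions vary with \<open>N\<close>, but the sizes of the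
  nets do not. The logarithms of the theorem come from the degree at which the noise polynomial is
  truncated. It is logarithmic in the radii of the body and its polar, so these must be polynomial
  in the dimension. Without symmetry this depends on the origin. Hence a preliminary translation,
  obtained from the position theorem for the vertices of a cross-polytope, after which the body
  contains its own reflection shrunk by \<open>96 * n^3\<close>. The width bound carries the square
  of the truncation degree and the distance is quadratic in the width, whence the exponent
  4.\<close>

definition lse :: "'a set \<Rightarrow> ('a \<Rightarrow> real) \<Rightarrow> real"
  where "lse P e = ln (\<Sum>p\<in>P. exp (e p))"

definition sm :: "'a set \<Rightarrow> ('a \<Rightarrow> real) \<Rightarrow> ('a \<Rightarrow> real) \<Rightarrow> real"
  where "sm P e \<phi> = (\<Sum>p\<in>P. exp (e p) * \<phi> p) / (\<Sum>p\<in>P. exp (e p))"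

definition cv :: "'a set \<Rightarrow> ('a \<Rightarrow> real) \<Rightarrow> ('a \<Rightarrow> real) \<Rightarrow> ('a \<Rightarrow> real) \<Rightarrow> real"
  where "cv P e \<phi> \<psi> = sm P e (\<lambda>p. \<phi> p * \<psi> p) - sm P e \<phi> * sm P e \<psi>"

lemma sum_exp_pos:
  assumes "finite P" "P \<noteq> {}"
  shows "(\<Sum>p\<in>P. exp (e p :: real)) > 0"
  using assms by (intro sum_pos) auto

lemma sm_add: "sm P e (\<lambda>p. \<phi> p + \<psi> p) = sm P e \<phi> + sm P e \<psi>"
  by (simp add: sm_def distrib_left sum.distrib add_divide_distrib)

lemma sm_diff: "sm P e (\<lambda>p. \<phi> p - \<psi> p) = sm P e \<phi> - sm P e \<psi>"
  by (simp add: sm_def right_diff_distrib sum_subtractf diff_divide_distrib)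

lemma sm_cmult: "sm P e (\<lambda>p. c * \<phi> p) = c * sm P e \<phi>"
  by (simp add: sm_def sum_distrib_left ac_simps)

lemma sm_cmult_right: "sm P e (\<lambda>p. \<phi> p * c) = sm P e \<phi> * c"
  by (simp add: sm_def sum_distrib_right sum_distrib_left ac_simps flip: sum_divide_distrib)

lemma sm_sum: "sm P e (\<lambda>p. \<Sum>i\<in>I. \<phi> i p) = (\<Sum>i\<in>I. sm P e (\<phi> i))"
proof -
  have "(\<Sum>p\<in>P. exp (e p) * (\<Sum>i\<in>I. \<phi> i p)) = (\<Sum>i\<in>I. \<Sum>p\<in>P. exp (e p) * \<phi> i p)"
    by (subst sum.swap) (simp add: sum_distrib_left)
  then show ?thesis by (simp add: sm_def sum_divide_distrib)
qed

lemma sm_const: "finite P \<Longrightarrow> P \<noteq> {} \<Longrightarrow> sm P e (\<lambda>_. c) = c"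
  using sum_exp_pos[of P e] by (simp add: sm_def flip: sum_distrib_right)

lemma sm_mono:
  assumes "\<And>p. p \<in> P \<Longrightarrow> \<phi> p \<le> \<psi> p"
  shows "sm P e \<phi> \<le> sm P e \<psi>"
  unfolding sm_def by (intro divide_right_mono sum_mono mult_left_mono assms sum_nonneg) auto

lemma sm_le:
  assumes "finite P" "P \<noteq> {}" "\<And>p. p \<in> P \<Longrightarrow> \<phi> p \<le> c"
  shows "sm P e \<phi> \<le> c"
  using sm_mono[of P \<phi> "\<lambda>_. c" e] assms by (simp add: sm_const)

lemma sm_ge:
  assumes "finite P" "P \<noteq> {}" "\<And>p. p \<in> P \<Longrightarrow> c \<le> \<phi> p"
  shows "c \<le> sm P e \<phi>"
  using sm_mono[of P "\<lambda>_. c" \<phi> e] assms by (simp add: sm_const)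

lemma sm_abs_le:
  assumes "finite P" "P \<noteq> {}" "\<And>p. p \<in> P \<Longrightarrow> \<bar>\<phi> p\<bar> \<le> c"
  shows "\<bar>sm P e \<phi>\<bar> \<le> c"
proof -
  have "sm P e \<phi> \<le> c" by (rule sm_le[OF assms(1,2)]) (use assms(3) in fastforce)
  moreover have "-c \<le> sm P e \<phi>" by (rule sm_ge[OF assms(1,2)]) (use assms(3) in fastforce)
  ultimately show ?thesis by linarith
qed

lemma sm_cong:
  assumes "\<And>p. p \<in> P \<Longrightarrow> e p = e' p" "\<And>p. p \<in> P \<Longrightarrow> \<phi> p = \<phi>' p"
  shows "sm P e \<phi> = sm P e' \<phi>'"
proof -
  have "(\<Sum>p\<in>P. exp (e p) * \<phi> p) = (\<Sum>p\<in>P. exp (e' p) * \<phi>' p)"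
    "(\<Sum>p\<in>P. exp (e p)) = (\<Sum>p\<in>P. exp (e' p))"
    using assms by (auto intro!: sum.cong)
  then show ?thesis by (simp add: sm_def)
qed

text \<open>The covariance is expressed by increments of two independent copies. In this form
  positivity is evident, and variances can be compared through pointwise bounds on
  increments.\<close>

lemma cv_double:
  assumes "finite P" "P \<noteq> {}"
  shows "cv P e \<phi> \<psi> = sm P e (\<lambda>p. sm P e (\<lambda>q. (\<phi> p - \<phi> q) * (\<psi> p - \<psi> q))) / 2"
proof -
  have "sm P e (\<lambda>p. sm P e (\<lambda>q. (\<phi> p - \<phi> q) * (\<psi> p - \<psi> q)))
     = sm P e (\<lambda>p. sm P e (\<lambda>q. \<phi> p * \<psi> p - \<phi> p * \<psi> q - (\<psi> p * \<phi> q - \<phi> q * \<psi> q)))"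
    by (simp add: algebra_simps)
  also have "\<dots> = sm P e (\<lambda>p. \<phi> p * \<psi> p - \<phi> p * sm P e \<psi> - (\<psi> p * sm P e \<phi> - sm P e (\<lambda>q. \<phi> q * \<psi> q)))"
    by (simp only: sm_diff sm_cmult sm_const[OF assms])
  also have "\<dots> = 2 * cv P e \<phi> \<psi>"
    by (simp add: sm_diff sm_cmult_right sm_const[OF assms] cv_def)
  finally show ?thesis by simp
qed

lemma cv_self_nonneg:
  assumes "finite P" "P \<noteq> {}"
  shows "0 \<le> cv P e \<phi> \<phi>"
  unfolding cv_double[OF assms] by (intro divide_nonneg_nonneg sm_ge assms) auto

lemma cv_abs_le:
  assumes "finite P" "P \<noteq> {}" "\<And>p. p \<in> P \<Longrightarrow> \<bar>\<phi> p\<bar> \<le> a" "\<And>p. p \<in> P \<Longrightarrow> \<bar>\<psi> p\<bar> \<le> b"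
  shows "\<bar>cv P e \<phi> \<psi>\<bar> \<le> 2 * a * b"
proof -
  have "a \<ge> 0" using assms by fastforce
  have "\<bar>sm P e (\<lambda>p. \<phi> p * \<psi> p)\<bar> \<le> a * b"
    using assms \<open>a \<ge> 0\<close> by (intro sm_abs_le) (auto simp: abs_mult intro!: mult_mono)
  moreover have "\<bar>sm P e \<phi> * sm P e \<psi>\<bar> \<le> a * b"
    unfolding abs_mult using \<open>a \<ge> 0\<close> by (intro mult_mono sm_abs_le assms) auto
  ultimately show ?thesis unfolding cv_def by linarith
qed

lemma cv_cmult_left: "cv P e (\<lambda>p. c * \<phi> p) \<psi> = c * cv P e \<phi> \<psi>"
  by (simp add: cv_def sm_cmult mult.assoc right_diff_distrib)

lemma cv_commute: "cv P e \<phi> \<psi> = cv P e \<psi> \<phi>"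
  by (simp add: cv_def mult.commute)

lemma cv_cmult_right: "cv P e \<phi> (\<lambda>p. c * \<psi> p) = c * cv P e \<phi> \<psi>"
  using cv_cmult_left[of P e c \<psi> \<phi>] by (simp add: cv_commute)

lemma sm_shift: "sm P (\<lambda>p. e p + c) \<phi> = sm P e \<phi>"
proof -
  have "(\<Sum>p\<in>P. exp (e p + c) * \<phi> p) = (\<Sum>p\<in>P. exp (e p) * \<phi> p) * exp c"
    "(\<Sum>p\<in>P. exp (e p + c)) = (\<Sum>p\<in>P. exp (e p)) * exp c"
    by (auto simp: exp_add sum_distrib_right intro!: sum.cong)
  then show ?thesis by (simp add: sm_def)
qed

lemma lse_shift:
  assumes "finite P" "P \<noteq> {}"
  shows "lse P (\<lambda>p. e p + c) = lse P e + c"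
  using sum_exp_pos[OF assms, of e]
  by (simp add: lse_def exp_add ln_mult flip: sum_distrib_right)

lemma sm_tilt:
  assumes "finite P" "P \<noteq> {}"
  shows "sm P (\<lambda>p. e p + d p) \<phi> = sm P e (\<lambda>p. exp (d p) * \<phi> p) / sm P e (\<lambda>p. exp (d p))"
  using sum_exp_pos[OF assms, of e] by (simp add: sm_def exp_add mult.assoc)

lemma lse_tilt:
  assumes "finite P" "P \<noteq> {}"
  shows "lse P (\<lambda>p. e p + d p) = lse P e + ln (sm P e (\<lambda>p. exp (d p)))"
  using sum_exp_pos[OF assms, of e] sum_exp_pos[OF assms, of "\<lambda>p. e p + d p"]
  by (simp add: lse_def sm_def exp_add ln_div)

lemma sm_exp_ge1:
  assumes "finite P" "P \<noteq> {}" "sm P e d = 0"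
  shows "1 \<le> sm P e (\<lambda>p. exp (d p))"
proof -
  have "sm P e (\<lambda>p. 1 + d p) \<le> sm P e (\<lambda>p. exp (d p))"
    by (intro sm_mono) (simp add: exp_ge_add_one_self)
  then show ?thesis using assms by (simp add: sm_add sm_const)
qed

text \<open>The tangent-line bound for a convex function: once the mean of \<open>d\<close> is
  subtracted, the tilting factor is at least 1 because \<open>exp t \<ge> 1 + t\<close>.\<close>

lemma lse_ge_linear:
  assumes "finite P" "P \<noteq> {}"
  shows "lse P e + sm P e d \<le> lse P (\<lambda>p. e p + d p)"
proof -
  let ?m = "sm P e d"
  have "lse P (\<lambda>p. e p + d p) = lse P (\<lambda>p. (e p + (d p - ?m)) + ?m)" by simp
  also have "\<dots> = lse P (\<lambda>p. e p + (d p - ?m)) + ?m" by (rule lse_shift[OF assms])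
  also have "lse P (\<lambda>p. e p + (d p - ?m)) = lse P e + ln (sm P e (\<lambda>p. exp (d p - ?m)))"
    by (rule lse_tilt[OF assms])
  finally show ?thesis
    using sm_exp_ge1[OF assms, of e "\<lambda>p. d p - ?m"] by (simp add: sm_diff sm_const assms)
qed

section \<open>Second-order expansions of log-sum-exp and of softmax means\<close>

lemma exp_taylor_cubic:
  assumes "\<bar>t\<bar> \<le> (1::real)"
  shows "\<bar>exp t - 1 - t - t\<^sup>2 / 2\<bar> \<le> \<bar>t\<bar> ^ 3 / 2"
proof -
  obtain s where s: "\<bar>s\<bar> \<le> \<bar>t\<bar>" and e: "exp t = (\<Sum>m<3. t ^ m / fact m) + exp s / fact 3 * t ^ 3"
    using Maclaurin_exp_le[of t 3] by blast
  have "exp s \<le> exp 1" using s assms by simp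
  then have "exp s \<le> 3" using exp_le by linarith
  have "exp t - 1 - t - t\<^sup>2 / 2 = exp s / 6 * t ^ 3"
    using e by (simp add: numeral_eq_Suc power2_eq_square)
  then have "\<bar>exp t - 1 - t - t\<^sup>2 / 2\<bar> = \<bar>exp s / 6 * t ^ 3\<bar>" by (rule arg_cong)
  also have "\<dots> = exp s / 6 * \<bar>t\<bar> ^ 3" by (simp add: abs_mult power_abs)
  also have "\<dots> \<le> 1 / 2 * \<bar>t\<bar> ^ 3" using \<open>exp s \<le> 3\<close> by (intro mult_right_mono) auto
  finally show ?thesis by simp
qed

lemma exp_quadratic_upper: "\<bar>t\<bar> \<le> 1 \<Longrightarrow> exp (t::real) \<le> 1 + t + t\<^sup>2 / 2 + \<bar>t\<bar> ^ 3"
  using exp_taylor_cubic[of t] zero_le_power[of "\<bar>t\<bar>" 3] by linarith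

lemma exp_quadratic_abs:
  assumes "\<bar>t\<bar> \<le> 1"
  shows "\<bar>exp (t::real) - 1 - t\<bar> \<le> t\<^sup>2"
proof -
  have "\<bar>t\<bar> ^ 3 \<le> \<bar>t\<bar> ^ 2" using assms by (intro power_decreasing) auto
  then show ?thesis using exp_taylor_cubic[OF assms] by (simp add: abs_if split: if_splits)
qed

text \<open>Centring \<open>d\<close> removes the linear term under the logarithm, so
  \<open>ln x \<le> x - 1\<close> loses nothing at second order. It doubles the bound
  \<open>M\<close>, which explains the condition \<open>M \<le> 1/2\<close> and the constant
  \<open>8 = 2^3\<close>.\<close>

lemma lse_le_quadratic:
  assumes "finite P" "P \<noteq> {}" "\<And>p. p \<in> P \<Longrightarrow> \<bar>d p\<bar> \<le> M" "M \<le> 1/2"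
  shows "lse P (\<lambda>p. e p + d p) \<le> lse P e + sm P e d + cv P e d d / 2 + 8 * M ^ 3"
proof -
  let ?m = "sm P e d"
  let ?d = "\<lambda>p. d p - ?m"
  have m: "\<bar>?m\<bar> \<le> M" by (rule sm_abs_le) (use assms in auto)
  have d: "\<bar>?d p\<bar> \<le> 2 * M" if "p \<in> P" for p using assms(3)[OF that] m by linarith
  have z: "sm P e ?d = 0" by (simp add: sm_diff sm_const assms)
  have "lse P (\<lambda>p. e p + d p) = lse P (\<lambda>p. (e p + ?d p) + ?m)" by simp
  also have "\<dots> = lse P (\<lambda>p. e p + ?d p) + ?m" by (rule lse_shift[OF assms(1,2)])
  also have "lse P (\<lambda>p. e p + ?d p) = lse P e + ln (sm P e (\<lambda>p. exp (?d p)))"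
    by (rule lse_tilt[OF assms(1,2)])
  also have "ln (sm P e (\<lambda>p. exp (?d p))) \<le> sm P e (\<lambda>p. exp (?d p)) - 1"
    using sm_exp_ge1[OF assms(1,2) z] by (intro ln_le_minus_one) auto
  also have "sm P e (\<lambda>p. exp (?d p)) \<le> sm P e (\<lambda>p. 1 + ?d p + ?d p * ?d p * (1/2) + 8 * M ^ 3)"
  proof (rule sm_mono)
    fix p assume p: "p \<in> P"
    have "exp (?d p) \<le> 1 + ?d p + (?d p)\<^sup>2 / 2 + \<bar>?d p\<bar> ^ 3"
      using d[OF p] assms(4) by (intro exp_quadratic_upper) linarith
    moreover have "\<bar>?d p\<bar> ^ 3 \<le> (2 * M) ^ 3" by (intro power_mono d p) auto
    ultimately show "exp (?d p) \<le> 1 + ?d p + ?d p * ?d p * (1/2) + 8 * M ^ 3"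
      by (simp add: power2_eq_square power_mult_distrib)
  qed
  also have "\<dots> = 1 + sm P e (\<lambda>p. ?d p * ?d p) * (1/2) + 8 * M ^ 3"
    by (simp only: sm_add sm_const[OF assms(1,2)] z sm_cmult_right)
  also have "sm P e (\<lambda>p. ?d p * ?d p) = cv P e d d"
  proof -
    have "sm P e (\<lambda>p. ?d p * ?d p) = sm P e (\<lambda>p. d p * d p - 2 * ?m * d p + ?m * ?m)"
      by (simp add: algebra_simps)
    also have "\<dots> = cv P e d d"
      by (simp only: sm_add sm_diff sm_cmult sm_const[OF assms(1,2)]) (simp add: cv_def)
    finally show ?thesis .
  qed
  finally show ?thesis by simp
qed

text \<open>The derivative of a softmax mean is a covariance. Both functions are centred, so the
  normalising factor \<open>?Z\<close> differs from 1 only at second order and the quotient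
  contributes nothing at first order.\<close>

lemma sm_perturb:
  assumes "finite P" "P \<noteq> {}" "\<And>p. p \<in> P \<Longrightarrow> \<bar>d p\<bar> \<le> M" "M \<le> 1/2"
    "\<And>p. p \<in> P \<Longrightarrow> \<bar>\<phi> p\<bar> \<le> B"
  shows "\<bar>sm P (\<lambda>p. e p + d p) \<phi> - sm P e \<phi> - cv P e \<phi> d\<bar> \<le> 32 * M\<^sup>2 * B"
proof -
  let ?m = "sm P e d" and ?b = "sm P e \<phi>"
  let ?d = "\<lambda>p. d p - ?m" and ?f = "\<lambda>p. \<phi> p - ?b"
  have M0: "0 \<le> M" and B0: "0 \<le> B" using assms by fastforce+
  have m: "\<bar>?m\<bar> \<le> M" by (rule sm_abs_le) (use assms in auto)
  have b: "\<bar>?b\<bar> \<le> B" by (rule sm_abs_le) (use assms in auto)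
  have d: "\<bar>?d p\<bar> \<le> 2 * M" if "p \<in> P" for p using assms(3)[OF that] m by linarith
  have f: "\<bar>?f p\<bar> \<le> 2 * B" if "p \<in> P" for p using assms(5)[OF that] b by linarith
  have zd: "sm P e ?d = 0" and zf: "sm P e ?f = 0" by (simp_all add: sm_diff sm_const assms)
  let ?Z = "sm P e (\<lambda>p. exp (?d p))"
  have Z1: "1 \<le> ?Z" by (rule sm_exp_ge1[OF assms(1,2) zd])
  have ed: "\<bar>exp (?d p) - 1 - ?d p\<bar> \<le> 4 * M\<^sup>2" if "p \<in> P" for p
  proof -
    have "\<bar>exp (?d p) - 1 - ?d p\<bar> \<le> (?d p)\<^sup>2"
      using d[OF that] assms(4) by (intro exp_quadratic_abs) linarith
    also have "\<dots> \<le> (2 * M)\<^sup>2" using d[OF that] by (metis abs_ge_zero power2_abs power_mono)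
    finally show ?thesis by (simp add: power_mult_distrib)
  qed
  have "?Z - 1 = sm P e (\<lambda>p. (exp (?d p) - 1 - ?d p))"
    by (simp only: sm_diff[of P e "\<lambda>p. exp (?d p) - 1" ?d] zd)
       (simp add: sm_diff sm_const[OF assms(1,2)])
  then have Zb: "\<bar>?Z - 1\<bar> \<le> 4 * M\<^sup>2"
    using sm_abs_le[OF assms(1,2) ed, where e = e] by simp
  have cv: "sm P e (\<lambda>p. ?d p * ?f p) = cv P e \<phi> d"
  proof -
    have "sm P e (\<lambda>p. ?d p * ?f p) = sm P e (\<lambda>p. \<phi> p * d p - ?b * d p - (?m * \<phi> p - ?m * ?b))"
      by (simp add: algebra_simps)
    also have "\<dots> = cv P e \<phi> d"
      by (simp only: sm_add sm_diff sm_cmult sm_const[OF assms(1,2)]) (simp add: cv_def)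
    finally show ?thesis .
  qed
  have cvb: "\<bar>cv P e \<phi> d\<bar> \<le> 2 * B * M"
    by (rule cv_abs_le) (use assms in auto)
  have "sm P e (\<lambda>p. exp (?d p) * ?f p) - cv P e \<phi> d
      = sm P e (\<lambda>p. exp (?d p) * ?f p - (?d p * ?f p + ?f p))"
    by (simp only: sm_diff sm_add cv zf) (simp add: sm_diff sm_const assms)
  also have "\<dots> = sm P e (\<lambda>p. (exp (?d p) - 1 - ?d p) * ?f p)"
    by (simp add: algebra_simps)
  finally have num: "\<bar>sm P e (\<lambda>p. exp (?d p) * ?f p) - cv P e \<phi> d\<bar> \<le> 4 * M\<^sup>2 * (2 * B)"
  proof (simp only:, intro sm_abs_le[OF assms(1,2)])
    fix p assume p: "p \<in> P"
    show "\<bar>(exp (?d p) - 1 - ?d p) * ?f p\<bar> \<le> 4 * M\<^sup>2 * (2 * B)"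
      unfolding abs_mult using ed[OF p] f[OF p] by (intro mult_mono) auto
  qed
  have "sm P (\<lambda>p. e p + d p) \<phi> - ?b = sm P (\<lambda>p. e p + d p) ?f"
    by (simp add: sm_diff sm_const assms)
  also have "\<dots> = sm P (\<lambda>p. (e p + d p) + (- ?m)) ?f" by (rule sm_shift[symmetric])
  also have "\<dots> = sm P (\<lambda>p. e p + ?d p) ?f" by (simp add: algebra_simps)
  also have "\<dots> = sm P e (\<lambda>p. exp (?d p) * ?f p) / ?Z" by (rule sm_tilt[OF assms(1,2)])
  finally have eq: "sm P (\<lambda>p. e p + d p) \<phi> - ?b - cv P e \<phi> d
     = (sm P e (\<lambda>p. exp (?d p) * ?f p) - cv P e \<phi> d - cv P e \<phi> d * (?Z - 1)) / ?Z"
    using Z1 by (simp add: field_simps)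
  have "\<bar>cv P e \<phi> d * (?Z - 1)\<bar> \<le> 2 * B * M * (4 * M\<^sup>2)"
    unfolding abs_mult using B0 M0 by (intro mult_mono cvb Zb) auto
  also have "\<dots> \<le> 4 * M\<^sup>2 * B"
  proof -
    have "2 * B * M * (4 * M\<^sup>2) = (4 * M\<^sup>2 * B) * (2 * M)" by simp
    also have "\<dots> \<le> (4 * M\<^sup>2 * B) * 1" using assms(4) B0 by (intro mult_left_mono) auto
    finally show ?thesis by simp
  qed
  finally have "\<bar>sm P e (\<lambda>p. exp (?d p) * ?f p) - cv P e \<phi> d - cv P e \<phi> d * (?Z - 1)\<bar> \<le> 12 * (M\<^sup>2 * B)"
    using num by linarith
  moreover have "\<bar>x / ?Z\<bar> \<le> \<bar>x\<bar>" for x using Z1 by (simp add: abs_divide divide_le_eq mult_left_le_one_le mult_le_cancel_left1)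
  ultimately have "\<bar>sm P (\<lambda>p. e p + d p) \<phi> - ?b - cv P e \<phi> d\<bar> \<le> 12 * (M\<^sup>2 * B)"
    unfolding eq by (meson order_trans)
  also have "\<dots> \<le> 32 * M\<^sup>2 * B" using B0 by (simp add: mult.assoc)
  finally show ?thesis .
qed

lemma lse_lower:
  assumes "finite P" "p \<in> P"
  shows "e p \<le> lse P e"
proof -
  have "exp (e p) \<le> (\<Sum>p\<in>P. exp (e p))" using assms by (intro member_le_sum) auto
  then show ?thesis unfolding lse_def
    by (metis exp_gt_zero ln_exp ln_le_cancel_iff order_less_le_trans)
qed

lemma lse_upper:
  assumes "finite P" "P \<noteq> {}" "\<And>p. p \<in> P \<Longrightarrow> e p \<le> c"
  shows "lse P e \<le> c + ln (real (card P))"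
proof -
  have "(\<Sum>p\<in>P. exp (e p)) \<le> real (card P) * exp c"
    using assms by (intro sum_bounded_above) auto
  then have "lse P e \<le> ln (real (card P) * exp c)"
    unfolding lse_def using sum_exp_pos[OF assms(1,2), of e] by (subst ln_le_cancel_iff) linarith+
  also have "\<dots> = c + ln (real (card P))" using assms by (simp add: ln_mult card_gt_0_iff)
  finally show ?thesis .
qed

section \<open>Averages over random signs\<close>

text \<open>A subset \<open>A\<close> of \<open>J\<close> encodes the sign vector \<open>(eps j A)\<close>, \<open>j \<in> J\<close>.\<close>

definition avg :: "'i set \<Rightarrow> ('i set \<Rightarrow> real) \<Rightarrow> real"
  where "avg J F = (\<Sum>A\<in>Pow J. F A) / 2 ^ card J"

definition eps :: "'i \<Rightarrow> 'i set \<Rightarrow> real"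
  where "eps j A = (if j \<in> A then 1 else -1)"

text \<open>A discrete derivative whose value at \<open>A\<close> does not depend on whether
  \<open>j\<close> belongs to \<open>A\<close>; \<open>stab_derivative\<close> relies on
  this.\<close>

definition dif :: "'i \<Rightarrow> ('i set \<Rightarrow> real) \<Rightarrow> 'i set \<Rightarrow> real"
  where "dif j F A = (F (insert j A) - F (A - {j})) / 2"

lemma avg_add: "avg J (\<lambda>A. F A + G A) = avg J F + avg J G"
  by (simp add: avg_def sum.distrib add_divide_distrib)

lemma avg_diff: "avg J (\<lambda>A. F A - G A) = avg J F - avg J G"
  by (simp add: avg_def sum_subtractf diff_divide_distrib)

lemma avg_cmult: "avg J (\<lambda>A. c * F A) = c * avg J F"
  by (simp add: avg_def sum_distrib_left)

lemma avg_cmult_right: "avg J (\<lambda>A. F A * c) = avg J F * c"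
  by (simp add: avg_def sum_distrib_right)

lemma avg_sum: "avg J (\<lambda>A. \<Sum>i\<in>I. F i A) = (\<Sum>i\<in>I. avg J (F i))"
  unfolding avg_def by (subst sum.swap) (simp add: sum_divide_distrib)

lemma avg_const: "finite J \<Longrightarrow> avg J (\<lambda>_. c) = c"
  by (simp add: avg_def card_Pow)

lemma avg_mono: "(\<And>A. A \<subseteq> J \<Longrightarrow> F A \<le> G A) \<Longrightarrow> avg J F \<le> avg J G"
  unfolding avg_def by (intro divide_right_mono sum_mono) auto

lemma avg_cong: "(\<And>A. A \<subseteq> J \<Longrightarrow> F A = G A) \<Longrightarrow> avg J F = avg J G"
  unfolding avg_def by (metis (no_types, lifting) PowD sum.cong)

lemma avg_le: "finite J \<Longrightarrow> (\<And>A. A \<subseteq> J \<Longrightarrow> F A \<le> c) \<Longrightarrow> avg J F \<le> c"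
  using avg_mono[of J F "\<lambda>_. c"] by (simp add: avg_const)

lemma avg_ge: "finite J \<Longrightarrow> (\<And>A. A \<subseteq> J \<Longrightarrow> c \<le> F A) \<Longrightarrow> c \<le> avg J F"
  using avg_mono[of J "\<lambda>_. c" F] by (simp add: avg_const)

lemma avg_abs_le:
  assumes "finite J" "\<And>A. A \<subseteq> J \<Longrightarrow> \<bar>F A\<bar> \<le> c"
  shows "\<bar>avg J F\<bar> \<le> c"
proof -
  have "avg J F \<le> c" by (rule avg_le[OF assms(1)], drule assms(2), linarith)
  moreover have "-c \<le> avg J F" by (rule avg_ge[OF assms(1)], drule assms(2), linarith)
  ultimately show ?thesis by linarith
qed

lemma avg_swap: "avg J (\<lambda>A. avg K (\<lambda>B. F A B)) = avg K (\<lambda>B. avg J (\<lambda>A. F A B))"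
proof -
  have "(\<Sum>A\<in>Pow J. \<Sum>B\<in>Pow K. F A B) = (\<Sum>B\<in>Pow K. \<Sum>A\<in>Pow J. F A B)" by (rule sum.swap)
  then show ?thesis by (simp add: avg_def flip: sum_divide_distrib)
qed

lemma avg_split:
  assumes "finite J" "j \<in> J"
  shows "avg J F = avg J (\<lambda>A. (F (insert j A) + F (A - {j})) / 2)"
proof -
  obtain K where J: "J = insert j K" "j \<notin> K" using assms by (metis mk_disjoint_insert)
  have fK: "finite K" using assms J by simp
  have disj: "Pow K \<inter> insert j ` Pow K = {}" using J(2) by auto
  have inj: "inj_on (insert j) (Pow K)" using J(2) by (auto simp: inj_on_def)
  have split: "(\<Sum>A\<in>Pow J. G A) = (\<Sum>A\<in>Pow K. G A) + (\<Sum>A\<in>Pow K. G (insert j A))" for G :: "_ \<Rightarrow> real"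
    unfolding J(1) Pow_insert using disj inj fK
    by (subst sum.union_disjoint) (auto simp: sum.reindex)
  have *: "A - {j} = A" if "A \<in> Pow K" for A using that J(2) by auto
  have "(\<Sum>A\<in>Pow J. (F (insert j A) + F (A - {j})) / 2) = (\<Sum>A\<in>Pow J. F A)"
    unfolding split using J(2)
    by (simp add: * sum.distrib add_divide_distrib flip: sum_divide_distrib)
  then show ?thesis by (simp add: avg_def)
qed

text \<open>Discrete integration by parts, the counterpart for one sign of
  \<open>E[G f(G)] = E[f'(G)]\<close> for a Gaussian variable. Everything about Gaussian vectors
  below is reduced to it.\<close>

lemma avg_eps:
  assumes "finite J" "j \<in> J"
  shows "avg J (\<lambda>A. eps j A * F A) = avg J (dif j F)"
  by (subst avg_split[OF assms], rule avg_cong) (simp add: eps_def dif_def)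

lemma eps_square: "eps j A * eps j A = 1"
  by (simp add: eps_def)

lemma avg_eps_eq_zero: "finite J \<Longrightarrow> j \<in> J \<Longrightarrow> avg J (eps j) = 0"
  using avg_eps[of J j "\<lambda>_. 1"] by (simp add: dif_def[abs_def] avg_const)

lemma avg_eps_mult:
  assumes "finite J" "j \<in> J" "i \<in> J"
  shows "avg J (\<lambda>A. eps i A * eps j A) = (if i = j then 1 else 0)"
proof (cases "i = j")
  case True
  then show ?thesis by (simp add: eps_square avg_const assms)
next
  case False
  have "dif i (eps j) = (\<lambda>_. 0)" using False by (auto simp: dif_def eps_def)
  then show ?thesis using avg_eps[OF assms(1,3), of "eps j"] False assms by (simp add: avg_const)
qed

lemma avg_insert:
  assumes "finite J" "j \<notin> J"
  shows "avg (insert j J) F = avg J (\<lambda>A. (F (insert j A) + F A) / 2)"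
proof -
  have disj: "Pow J \<inter> insert j ` Pow J = {}" using assms by auto
  have inj: "inj_on (insert j) (Pow J)" using assms by (auto simp: inj_on_def)
  have "(\<Sum>A\<in>Pow (insert j J). F A) = (\<Sum>A\<in>Pow J. F A) + (\<Sum>A\<in>Pow J. F (insert j A))"
    unfolding Pow_insert using disj inj assms
    by (subst sum.union_disjoint) (auto simp: sum.reindex)
  then show ?thesis
    using assms by (simp add: avg_def sum.distrib add_divide_distrib sum_divide_distrib)
qed

section \<open>Moments of Rademacher sums and Khinchine's inequality\<close>

lemma rademacher_moments:
  assumes "finite J"
  shows "avg J (\<lambda>A. (\<Sum>j\<in>J. c j * eps j A)\<^sup>2) = (\<Sum>j\<in>J. (c j)\<^sup>2)"
    and "avg J (\<lambda>A. (\<Sum>j\<in>J. c j * eps j A) ^ 4) \<le> 3 * (\<Sum>j\<in>J. (c j)\<^sup>2)\<^sup>2"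
proof -
  have two: "avg J (\<lambda>A. (\<Sum>j\<in>J. c j * eps j A)\<^sup>2) = (\<Sum>j\<in>J. (c j)\<^sup>2)" if "finite J" for J
  proof -
    have "avg J (\<lambda>A. (\<Sum>j\<in>J. c j * eps j A)\<^sup>2)
       = avg J (\<lambda>A. \<Sum>i\<in>J. \<Sum>j\<in>J. c i * c j * (eps i A * eps j A))"
      by (simp add: power2_eq_square sum_product ac_simps)
    also have "\<dots> = (\<Sum>i\<in>J. \<Sum>j\<in>J. c i * c j * (if i = j then 1 else 0))"
      unfolding avg_sum avg_cmult using that by (intro sum.cong refl) (simp add: avg_eps_mult)
    also have "\<dots> = (\<Sum>j\<in>J. (c j)\<^sup>2)"
      using that by (simp add: if_distrib power2_eq_square cong: if_cong)
    finally show ?thesis .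
  qed
  show "avg J (\<lambda>A. (\<Sum>j\<in>J. c j * eps j A)\<^sup>2) = (\<Sum>j\<in>J. (c j)\<^sup>2)" by (rule two[OF assms])
  show "avg J (\<lambda>A. (\<Sum>j\<in>J. c j * eps j A) ^ 4) \<le> 3 * (\<Sum>j\<in>J. (c j)\<^sup>2)\<^sup>2"
    using assms
  proof (induction J rule: finite_induct)
    case empty
    then show ?case by (simp add: avg_def)
  next
    case (insert k J)
    let ?T = "\<lambda>A. \<Sum>j\<in>J. c j * eps j A"
    have T: "?T (insert k A) = ?T A" for A
      using insert.hyps by (intro sum.cong refl) (auto simp: eps_def)
    have "avg (insert k J) (\<lambda>A. (\<Sum>j\<in>insert k J. c j * eps j A) ^ 4)
      = avg J (\<lambda>A. ((c k + ?T A) ^ 4 + (c k * eps k A + ?T A) ^ 4) / 2)"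
      using insert.hyps by (subst avg_insert) (simp_all add: T, simp add: eps_def)
    also have "\<dots> = avg J (\<lambda>A. c k ^ 4 + 6 * (c k)\<^sup>2 * (?T A)\<^sup>2 + ?T A ^ 4)"
    proof (rule avg_cong)
      fix A assume "A \<subseteq> J"
      then have "eps k A = -1" using insert.hyps by (auto simp: eps_def)
      then show "((c k + ?T A) ^ 4 + (c k * eps k A + ?T A) ^ 4) / 2 = c k ^ 4 + 6 * (c k)\<^sup>2 * (?T A)\<^sup>2 + ?T A ^ 4"
        by (simp add: field_simps power2_eq_square power4_eq_xxxx)
    qed
    also have "\<dots> = c k ^ 4 + 6 * (c k)\<^sup>2 * (\<Sum>j\<in>J. (c j)\<^sup>2) + avg J (\<lambda>A. ?T A ^ 4)"
      by (simp add: avg_add avg_cmult avg_const two insert.hyps)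
    also have "\<dots> \<le> 3 * ((c k)\<^sup>2 + (\<Sum>j\<in>J. (c j)\<^sup>2))\<^sup>2"
    proof -
      have "3 * ((c k)\<^sup>2 + s)\<^sup>2 = 3 * c k ^ 4 + 6 * (c k)\<^sup>2 * s + 3 * s\<^sup>2" for s
        by (simp add: field_simps power2_eq_square power4_eq_xxxx)
      moreover have "c k ^ 4 \<ge> 0" by simp
      ultimately show ?thesis using insert.IH by (smt (verit))
    qed
    finally show ?case using insert.hyps by simp
  qed
qed

text \<open>An even quartic touching \<open>|t|\<close> at \<open>|t| = 2\<close>, the double root
  of the factorisation. For second moment 1 and fourth moment at most 3 it yields the constant
  \<open>3/4 - 3/16 = 9/16\<close> of \<open>khinchine\<close>.\<close>

lemma abs_ge_quartic: "(3/4) * t\<^sup>2 - t ^ 4 / 16 \<le> \<bar>t::real\<bar>"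
proof -
  have "0 \<le> (\<bar>t\<bar> / 16) * ((\<bar>t\<bar> - 2)\<^sup>2 * (\<bar>t\<bar> + 4))" by auto
  also have "\<dots> = \<bar>t\<bar> - (3/4) * \<bar>t\<bar>\<^sup>2 + \<bar>t\<bar> ^ 4 / 16"
    by (simp add: field_simps power2_eq_square power4_eq_xxxx)
  finally show ?thesis by simp
qed

lemma khinchine:
  assumes "finite J"
  shows "9/16 * sqrt (\<Sum>j\<in>J. (c j)\<^sup>2) \<le> avg J (\<lambda>A. \<bar>\<Sum>j\<in>J. c j * eps j A\<bar>)"
proof (cases "(\<Sum>j\<in>J. (c j)\<^sup>2) = 0")
  case True
  then show ?thesis by (simp add: avg_ge assms)
next
  case False
  define s where "s = sqrt (\<Sum>j\<in>J. (c j)\<^sup>2)"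
  have s2: "s\<^sup>2 = (\<Sum>j\<in>J. (c j)\<^sup>2)" by (simp add: s_def sum_nonneg)
  have s0: "s > 0" using False by (simp add: s_def sum_nonneg order_less_le)
  let ?T = "\<lambda>A. \<Sum>j\<in>J. c j * eps j A"
  have "9/16 * s = s * ((3/4) * (1/s\<^sup>2) * s\<^sup>2 - (1 / (16 * s ^ 4)) * (3 * (s\<^sup>2)\<^sup>2))"
    using s0 by (simp add: field_simps power2_eq_square power4_eq_xxxx)
  also have "\<dots> \<le> s * ((3/4) * (1/s\<^sup>2) * avg J (\<lambda>A. (?T A)\<^sup>2) - (1 / (16 * s ^ 4)) * avg J (\<lambda>A. ?T A ^ 4))"
    using rademacher_moments[OF assms, of c] s0 unfolding s2
    by (intro mult_left_mono diff_mono) (auto simp: sum_nonneg)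
  also have "\<dots> = avg J (\<lambda>A. s * ((3/4) * (1/s\<^sup>2) * (?T A)\<^sup>2 - (1 / (16 * s ^ 4)) * ?T A ^ 4))"
    by (simp only: avg_cmult avg_diff)
  also have "\<dots> = avg J (\<lambda>A. s * ((3/4) * (?T A / s)\<^sup>2 - (?T A / s) ^ 4 / 16))"
    by (simp add: power_divide ac_simps)
  also have "\<dots> \<le> avg J (\<lambda>A. s * \<bar>?T A / s\<bar>)"
    by (intro avg_mono mult_left_mono abs_ge_quartic) (use s0 in auto)
  also have "\<dots> = avg J (\<lambda>A. \<bar>?T A\<bar>)" using s0 by simp
  finally show ?thesis by (simp add: s_def)
qed

section \<open>The linear coefficient of a bounded polynomial\<close>

text \<open>Up to sign this is the finite difference of order \<open>M\<close> of a polynomial of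
  degree \<open>k < M\<close>. The shift \<open>c\<close> stays arbitrary because Pascal's rule
  produces the difference of the values at \<open>c\<close> and \<open>c + 1\<close>, and that
  difference lowers the degree.\<close>

lemma alternating_binomial_power:
  assumes "k < M"
  shows "(\<Sum>j\<le>M. (-1) ^ j * real (M choose j) * (c + real j) ^ k) = 0"
  using assms
proof (induction M arbitrary: k c)
  case 0
  then show ?case by simp
next
  case (Suc M)
  define S where "S = (\<lambda>c. \<Sum>j\<le>M. (-1) ^ j * real (M choose j) * (c + real j) ^ k)"
  have "(\<Sum>j\<le>Suc M. (-1) ^ j * real (Suc M choose j) * (c + real j) ^ k)
     = c ^ k + (\<Sum>j\<le>M. (-1) ^ Suc j * real (Suc M choose Suc j) * (c + real (Suc j)) ^ k)"
    by (subst sum.atMost_Suc_shift) simp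
  also have "(\<Sum>j\<le>M. (-1) ^ Suc j * real (Suc M choose Suc j) * (c + real (Suc j)) ^ k)
     = (\<Sum>j\<le>M. (-1) ^ Suc j * real (M choose Suc j) * (c + real (Suc j)) ^ k)
      - S (c + 1)"
  proof -
    have "(-1) ^ Suc j * real (Suc M choose Suc j) * (c + real (Suc j)) ^ k
       = (-1) ^ Suc j * real (M choose Suc j) * (c + real (Suc j)) ^ k
         - (-1) ^ j * real (M choose j) * (c + 1 + real j) ^ k" for j
      by (simp add: algebra_simps)
    then show ?thesis by (simp only: S_def sum_subtractf)
  qed
  also have "c ^ k + ((\<Sum>j\<le>M. (-1) ^ Suc j * real (M choose Suc j) * (c + real (Suc j)) ^ k) - S (c + 1))
     = (\<Sum>j\<le>Suc M. (-1) ^ j * real (M choose j) * (c + real j) ^ k) - S (c + 1)"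
    by (subst sum.atMost_Suc_shift) simp
  also have "(\<Sum>j\<le>Suc M. (-1) ^ j * real (M choose j) * (c + real j) ^ k) = S c"
    by (simp add: S_def)
  also have "S c - S (c + 1) = (\<Sum>j\<le>M. (-1) ^ j * real (M choose j) * ((c + real j) ^ k - (c + real j + 1) ^ k))"
    by (simp add: S_def algebra_simps sum_subtractf)
  also have "\<dots> = (\<Sum>j\<le>M. \<Sum>i<k. - real (k choose i) * ((-1) ^ j * real (M choose j) * (c + real j) ^ i))"
  proof (intro sum.cong refl)
    fix j
    have "(c + real j + 1) ^ k = (\<Sum>i<k. real (k choose i) * (c + real j) ^ i) + (c + real j) ^ k"
      by (subst binomial_ring) (simp flip: lessThan_Suc_atMost)
    then show "(-1) ^ j * real (M choose j) * ((c + real j) ^ k - (c + real j + 1) ^ k)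
      = (\<Sum>i<k. - real (k choose i) * ((-1) ^ j * real (M choose j) * (c + real j) ^ i))"
      by (simp add: sum_distrib_left sum_negf ac_simps)
  qed
  also have "\<dots> = (\<Sum>i<k. - real (k choose i) * (\<Sum>j\<le>M. (-1) ^ j * real (M choose j) * (c + real j) ^ i))"
    by (subst sum.swap) (simp add: sum_distrib_left)
  also have "\<dots> = 0" using Suc by (intro sum.neutral) auto
  finally show ?case .
qed

lemma sum_inverse_squares_le: "(\<Sum>i=1..m. 1 / (real i)\<^sup>2) \<le> 2"
proof -
  have *: "(\<Sum>i=1..m. 1 / (real i)\<^sup>2) \<le> 2 - 1 / real m" if "m \<ge> 1" for m
    using that
  proof (induction m rule: dec_induct)
    case base
    then show ?case by simp
  next
    case (step k)
    have "1 / (real (Suc k))\<^sup>2 \<le> 1 / real k - 1 / real (Suc k)"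
    proof -
      have "1 / (real (Suc k))\<^sup>2 \<le> 1 / (real k * real (Suc k))"
        using step.hyps by (intro divide_left_mono) (auto simp: power2_eq_square)
      also have "\<dots> = 1 / real k - 1 / real (Suc k)" using step.hyps by (simp add: field_simps)
      finally show ?thesis .
    qed
    then show ?case using step.IH step.hyps by simp
  qed
  have "2 - 1 / real m \<le> 2" by simp
  then show ?thesis using *[of m] by (cases "m \<ge> 1") (linarith, simp)
qed

text \<open>Lagrange interpolation at the nodes \<open>j\<^sup>2 / (2 m\<^sup>2)\<close>: their interpolation weights at \<open>0\<close>
  are quotients of binomial coefficients, so they are bounded by \<open>2\<close>.\<close>

lemma linear_coeff_bound:
  fixes a :: "nat \<Rightarrow> real"
  assumes q: "\<And>x. 0 \<le> x \<Longrightarrow> x \<le> 1/2 \<Longrightarrow> \<bar>\<Sum>k=1..M. a k * x ^ k\<bar> \<le> \<kappa>"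
    and D: "\<And>k. \<bar>a k\<bar> \<le> D" and m: "m \<ge> 1" and Dm: "D / 2 ^ m \<le> \<kappa>" and M: "M \<ge> 1"
  shows "\<bar>a 1\<bar> \<le> 16 * (real m)\<^sup>2 * \<kappa>"
proof -
  \<comment> \<open>Extension by zero allows the cut-off \<open>m\<close> to exceed the degree
    \<open>M\<close>.\<close>
  define b where "b k = (if k \<in> {1..M} then a k else 0)" for k
  have bD: "\<bar>b k\<bar> \<le> D" for k using D[of k] by (auto simp: b_def)
  have D0: "0 \<le> D" using D[of 0] by linarith
  \<comment> \<open>The terms of degree at most \<open>m\<close>, divided by \<open>x\<close>. The
    wanted coefficient is the value at 0, exactly where the bound \<open>2 * \<kappa> / x\<close>
    obtained for \<open>g\<close> degenerates.\<close>
  define g where "g x = (\<Sum>k<m. b (Suc k) * x ^ k)" for x :: real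
  have g0: "g 0 = a 1"
  proof -
    have "g 0 = (\<Sum>k<m. if k = 0 then b 1 else 0)"
      unfolding g_def by (intro sum.cong) auto
    then show ?thesis using m M by (simp add: b_def)
  qed
  have g: "\<bar>g x\<bar> \<le> 2 * \<kappa> / x" if x: "0 < x" "x \<le> 1/2" for x
  proof -
    have "(\<Sum>k=1..M. a k * x ^ k) = (\<Sum>k=1..M+m. b k * x ^ k)"
      by (rule sum.mono_neutral_cong_left) (auto simp: b_def)
    also have "\<dots> = (\<Sum>k=1..m. b k * x ^ k) + (\<Sum>k=m+1..M+m. b k * x ^ k)"
      using sum.ub_add_nat[of 1 m "\<lambda>k. b k * x ^ k" M] by (simp add: add.commute)
    also have "(\<Sum>k=1..m. b k * x ^ k) = x * g x"
      unfolding g_def sum_distrib_left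
      by (rule sum.reindex_bij_witness[of _ Suc "\<lambda>k. k - 1"])
         (auto simp: Suc_le_eq simp flip: power_Suc)
    finally have split: "(\<Sum>k=1..M. a k * x ^ k) = x * g x + (\<Sum>k=m+1..M+m. b k * x ^ k)" .
    have "\<bar>\<Sum>k=m+1..M+m. b k * x ^ k\<bar> \<le> 2 * D * x ^ (m + 1)"
    proof -
      have "\<bar>\<Sum>k=m+1..M+m. b k * x ^ k\<bar> \<le> (\<Sum>k=m+1..M+m. D * x ^ k)"
        using bD x by (intro order_trans[OF sum_abs] sum_mono) (auto simp: abs_mult intro!: mult_right_mono)
      also have "\<dots> = D * x ^ (m + 1) * (\<Sum>i<M. x ^ i)"
        unfolding sum_distrib_left
        by (rule sum.reindex_bij_witness[of _ "\<lambda>i. i + (m+1)" "\<lambda>k. k - (m+1)"])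
           (auto simp: mult.assoc Suc_le_eq simp flip: power_add power_Suc)
      also have "(\<Sum>i<M. x ^ i) = (1 - x ^ M) / (1 - x)"
        using x by (subst geometric_sum) (auto simp: field_simps)
      also have "D * x ^ (m + 1) * ((1 - x ^ M) / (1 - x)) \<le> D * x ^ (m + 1) * 2"
      proof (intro mult_left_mono)
        have "0 \<le> x ^ M" using x by simp
        then have "1 - x ^ M \<le> 1" by (simp only: diff_le_eq)
        also have "1 \<le> 2 * (1 - x)" using x by simp
        finally have "1 - x ^ M \<le> 2 * (1 - x)" .
        then show "(1 - x ^ M) / (1 - x) \<le> 2" using x by (simp add: divide_le_eq)
      qed (use x D0 in auto)
      finally show ?thesis by (simp add: ac_simps)
    qed
    then have "\<bar>x * g x\<bar> \<le> \<kappa> + 2 * D * x ^ (m + 1)"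
      using q[of x] x split by linarith
    also have "2 * D * x ^ (m + 1) \<le> 2 * \<kappa> * x"
    proof -
      have "D * x ^ m \<le> D * (1/2) ^ m" using x D0 by (intro mult_left_mono power_mono) auto
      also have "\<dots> \<le> \<kappa>" using Dm by (simp add: power_divide)
      finally show ?thesis using x by (simp add: mult_right_mono mult.commute mult.left_commute)
    qed
    also have "2 * \<kappa> * x \<le> \<kappa>"
    proof -
      have "0 \<le> \<kappa>" using q[of 0] by linarith
      then show ?thesis using x mult_left_mono[of x "1/2" "2 * \<kappa>"] by simp
    qed
    finally show ?thesis using x by (simp add: abs_mult field_simps)
  qed
  \<comment> \<open>Each node other than 0 occurs twice, for \<open>j\<close> and
    \<open>2 * m - j\<close>, and \<open>j = m\<close> gives 0. As a function of
    \<open>j - m\<close> the composition of \<open>g\<close> and \<open>z\<close> has degree at most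
    \<open>2 * m - 2\<close>, so its difference of order \<open>2 * m\<close> vanishes. The nodes
    accumulate quadratically at 0, which makes the extrapolation cost \<open>m^2\<close> instead of
    an exponential factor.\<close>
  define z where "z j = (real j - real m)\<^sup>2 / (2 * (real m)\<^sup>2)" for j
  have zero: "(\<Sum>j\<le>2*m. (-1) ^ j * real (2 * m choose j) * g (z j)) = 0"
  proof -
    have "(\<Sum>j\<le>2*m. (-1) ^ j * real (2 * m choose j) * g (z j))
      = (\<Sum>j\<le>2*m. \<Sum>k<m. b (Suc k) / (2 * (real m)\<^sup>2) ^ k * ((-1) ^ j * real (2 * m choose j) * (- real m + real j) ^ (2 * k)))"
    proof -
      have "(- real m + real j) ^ (2 * k) = ((real j - real m)\<^sup>2) ^ k" for j k
        by (simp add: power_mult)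
      then show ?thesis unfolding g_def z_def sum_distrib_left
        by (intro sum.cong refl) (simp only: power_divide, simp)
    qed
    also have "\<dots> = (\<Sum>k<m. b (Suc k) / (2 * (real m)\<^sup>2) ^ k * (\<Sum>j\<le>2*m. (-1) ^ j * real (2 * m choose j) * (- real m + real j) ^ (2 * k)))"
      by (subst sum.swap) (simp only: sum_distrib_left)
    also have "\<dots> = 0" by (intro sum.neutral ballI) (subst alternating_binomial_power, auto)
    finally show ?thesis .
  qed
  let ?c = "real (2 * m choose m)"
  have c0: "?c > 0" by simp
  let ?R = "\<Sum>j\<in>{..2*m} - {m}. (-1) ^ j * real (2 * m choose j) * g (z j)"
  have "(-1) ^ m * ?c * g 0 + ?R = 0"
    using zero by (subst (asm) sum.remove[of _ m]) (auto simp: z_def)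
  then have R: "?R = - ((-1) ^ m * ?c * g 0)" by (subst eq_neg_iff_add_eq_0, subst add.commute)
  have "?c * \<bar>g 0\<bar> = \<bar>?R\<bar>"
    unfolding R by (simp add: abs_mult power_abs)
  also have "\<dots> \<le> (\<Sum>j\<in>{..2*m} - {m}. ?c * (4 * \<kappa> * (real m)\<^sup>2 * (1 / (real j - real m)\<^sup>2)))"
  proof (intro order_trans[OF sum_abs] sum_mono)
    fix j assume j: "j \<in> {..2*m} - {m}"
    have zj: "0 < z j" "z j \<le> 1/2"
    proof -
      show "0 < z j" using j m by (auto simp: z_def)
      have "\<bar>real j - real m\<bar> \<le> \<bar>real m\<bar>" using j by auto
      then have "(real j - real m)\<^sup>2 \<le> (real m)\<^sup>2" by (simp only: abs_le_square_iff)
      then show "z j \<le> 1/2" using m by (simp add: z_def field_simps)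
    qed
    have "\<bar>(-1) ^ j * real (2 * m choose j) * g (z j)\<bar> = real (2 * m choose j) * \<bar>g (z j)\<bar>"
      by (simp add: abs_mult power_abs)
    also have "\<dots> \<le> ?c * (2 * \<kappa> / z j)"
      using binomial_maximum'[of m j] g[OF zj] by (intro mult_mono) auto
    also have "2 * \<kappa> / z j = 4 * \<kappa> * (real m)\<^sup>2 * (1 / (real j - real m)\<^sup>2)" by (simp add: z_def)
    finally show "\<bar>(-1) ^ j * real (2 * m choose j) * g (z j)\<bar>
      \<le> ?c * (4 * \<kappa> * (real m)\<^sup>2 * (1 / (real j - real m)\<^sup>2))" .
  qed
  also have "\<dots> = ?c * (4 * \<kappa> * (real m)\<^sup>2 * (\<Sum>j\<in>{..2*m} - {m}. 1 / (real j - real m)\<^sup>2))"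
    by (simp add: sum_distrib_left)
  also have "\<dots> \<le> ?c * (4 * \<kappa> * (real m)\<^sup>2 * 4)"
  proof -
    have k0: "0 \<le> \<kappa>" using q[of 0] by linarith
    have split: "{..2*m} - {m} = {..<m} \<union> {m+1..2*m}" by auto
    have "(\<Sum>j\<in>{..2*m} - {m}. 1 / (real j - real m)\<^sup>2)
      = (\<Sum>j<m. 1 / (real j - real m)\<^sup>2) + (\<Sum>j=m+1..2*m. 1 / (real j - real m)\<^sup>2)"
      unfolding split by (rule sum.union_disjoint) auto
    also have "(\<Sum>j<m. 1 / (real j - real m)\<^sup>2) = (\<Sum>i=1..m. 1 / (real i)\<^sup>2)"
      by (rule sum.reindex_bij_witness[of _ "\<lambda>i. m - i" "\<lambda>i. m - i"]) (auto simp: power2_commute)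
    also have "(\<Sum>j=m+1..2*m. 1 / (real j - real m)\<^sup>2) = (\<Sum>i=1..m. 1 / (real i)\<^sup>2)"
      by (rule sum.reindex_bij_witness[of _ "\<lambda>i. i + m" "\<lambda>i. i - m"]) auto
    finally show ?thesis using sum_inverse_squares_le[of m] k0
      by (intro mult_left_mono) auto
  qed
  finally have "?c * \<bar>g 0\<bar> \<le> ?c * (16 * (real m)\<^sup>2 * \<kappa>)" by (simp add: ac_simps)
  then show ?thesis using c0 g0 by (simp only: mult_le_cancel_left_pos)
qed

section \<open>Noise and the level-one Walsh coefficients\<close>

text \<open>The density of a \<open>\<rho>\<close>-correlated pair of random sign vectors.\<close>

definition noise :: "'i set \<Rightarrow> real \<Rightarrow> 'i set \<Rightarrow> 'i set \<Rightarrow> real"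
  where "noise J \<rho> A B = (\<Prod>j\<in>J. 1 + \<rho> * (eps j A * eps j B))"

text \<open>The noise stability, that is the pairing of \<open>u\<close> with the image of
  \<open>f\<close> under the noise operator.\<close>

definition stab :: "'i set \<Rightarrow> ('i set \<Rightarrow> real) \<Rightarrow> ('i set \<Rightarrow> real) \<Rightarrow> real \<Rightarrow> real"
  where "stab J u f \<rho> = avg J (\<lambda>A. avg J (\<lambda>B. noise J \<rho> A B * (u A * f B)))"

definition walsh :: "'i set \<Rightarrow> 'i set \<Rightarrow> real"
  where "walsh S A = (\<Prod>j\<in>S. eps j A)"

lemma eps_abs [simp]: "\<bar>eps j A\<bar> = 1"
  by (simp add: eps_def)

lemma eps_insert_other [simp]: "i \<noteq> j \<Longrightarrow> eps i (insert j A) = eps i A" "i \<noteq> j \<Longrightarrow> eps i (A - {j}) = eps i A"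
  by (auto simp: eps_def)

lemma noise_expand:
  assumes "finite J"
  shows "noise J \<rho> A B = (\<Sum>S\<in>Pow J. \<rho> ^ card S * (walsh S A * walsh S B))"
  unfolding noise_def
  by (subst add.commute, subst prod_add[OF assms])
     (simp add: walsh_def prod.distrib)

lemma stab_expand:
  assumes "finite J"
  shows "stab J u f \<rho> = (\<Sum>S\<in>Pow J. \<rho> ^ card S * (avg J (\<lambda>A. u A * walsh S A) * avg J (\<lambda>B. f B * walsh S B)))"
proof -
  have "stab J u f \<rho> = avg J (\<lambda>A. avg J (\<lambda>B. \<Sum>S\<in>Pow J. \<rho> ^ card S * ((u A * walsh S A) * (f B * walsh S B))))"
    unfolding stab_def noise_expand[OF assms] by (simp add: sum_distrib_left sum_distrib_right ac_simps)
  then show ?thesis by (simp only: avg_sum avg_cmult avg_cmult_right)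
qed

text \<open>At \<open>\<rho> = 1\<close> the noise density is concentrated on the diagonal, so this
  is \<open>stab_expand\<close> at that value.\<close>

lemma parseval:
  assumes "finite J"
  shows "(\<Sum>S\<in>Pow J. (avg J (\<lambda>A. u A * walsh S A))\<^sup>2) = avg J (\<lambda>A. (u A)\<^sup>2)"
proof -
  have n1: "noise J 1 A B = (if A = B then 2 ^ card J else 0)" if AB: "A \<subseteq> J" "B \<subseteq> J" for A B
  proof (cases "A = B")
    case True
    then show ?thesis by (simp add: noise_def eps_square)
  next
    case False
    then obtain j where "j \<in> J" "j \<in> A \<longleftrightarrow> j \<notin> B" using AB by blast
    then have "1 + 1 * (eps j A * eps j B) = 0" by (auto simp: eps_def)
    then have "noise J 1 A B = 0" unfolding noise_def using \<open>j \<in> J\<close> assms by (intro prod_zero) auto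
    then show ?thesis using False by simp
  qed
  have "(\<Sum>S\<in>Pow J. (avg J (\<lambda>A. u A * walsh S A))\<^sup>2) = stab J u u 1"
    by (simp add: stab_expand[OF assms] power2_eq_square)
  also have "\<dots> = avg J (\<lambda>A. (u A)\<^sup>2)"
    unfolding stab_def
  proof (rule avg_cong)
    fix A assume A: "A \<subseteq> J"
    have "(\<Sum>B\<in>Pow J. noise J 1 A B * (u A * u B)) = (\<Sum>B\<in>Pow J. if B = A then 2 ^ card J * (u A * u A) else 0)"
      using A by (intro sum.cong) (auto simp: n1)
    then show "avg J (\<lambda>B. noise J 1 A B * (u A * u B)) = (u A)\<^sup>2"
      using A assms by (simp add: avg_def power2_eq_square)
  qed
  finally show ?thesis .
qed

text \<open>Differentiating the factor of \<open>j\<close> leaves \<open>eps j A * eps j B\<close>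
  times the product over the other signs. Integration by parts in \<open>A\<close> and in
  \<open>B\<close> turns these signs into discrete derivatives. Since a discrete derivative is
  independent of its own sign, the missing factor can be restored: its correction term averages to
  zero.\<close>

lemma stab_derivative:
  assumes "finite J"
  shows "(stab J u f has_field_derivative
    avg J (\<lambda>A. avg J (\<lambda>B. noise J \<rho> A B * (\<Sum>j\<in>J. dif j u A * dif j f B)))) (at \<rho>)"
proof -
  define N where "N j A B = (\<Prod>i\<in>J-{j}. 1 + \<rho> * (eps i A * eps i B))" for j A B
  have Nins: "N j (insert j A) B = N j A B" "N j (A - {j}) B = N j A B"
    "N j A (insert j B) = N j A B" "N j A (B - {j}) = N j A B" for j A B
    by (auto simp: N_def intro!: prod.cong)
  have dN: "dif j (\<lambda>A. N j A B * u A) A = N j A B * dif j u A" for u j A B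
    by (simp add: dif_def Nins right_diff_distrib)
  have dN': "dif j (\<lambda>B. N j A B * u B) B = N j A B * dif j u B" for u j A B
    by (simp add: dif_def Nins right_diff_distrib)
  have dd: "dif j (\<lambda>B. c * dif j f B) B = 0" for j c f and B :: "'a set" by (simp add: dif_def)
  have trm: "avg J (\<lambda>A. avg J (\<lambda>B. eps j A * eps j B * N j A B * (u A * f B)))
    = avg J (\<lambda>A. avg J (\<lambda>B. noise J \<rho> A B * (dif j u A * dif j f B)))" if j: "j \<in> J" for j
  proof -
    have "avg J (\<lambda>A. avg J (\<lambda>B. eps j A * eps j B * N j A B * (u A * f B)))
       = avg J (\<lambda>A. eps j A * u A * avg J (\<lambda>B. eps j B * (N j A B * f B)))"
      by (simp add: ac_simps flip: avg_cmult)
    also have "\<dots> = avg J (\<lambda>A. eps j A * u A * avg J (\<lambda>B. N j A B * dif j f B))"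
      by (simp add: avg_eps[OF assms j] dN'[abs_def])
    also have "\<dots> = avg J (\<lambda>B. dif j f B * avg J (\<lambda>A. eps j A * (N j A B * u A)))"
      by (simp add: ac_simps flip: avg_cmult) (rule avg_swap)
    also have "\<dots> = avg J (\<lambda>B. dif j f B * avg J (\<lambda>A. N j A B * dif j u A))"
      by (simp add: avg_eps[OF assms j] dN[abs_def])
    also have "\<dots> = avg J (\<lambda>A. avg J (\<lambda>B. N j A B * (dif j u A * dif j f B)))"
      by (simp add: ac_simps flip: avg_cmult) (rule avg_swap)
    also have "\<dots> = avg J (\<lambda>A. avg J (\<lambda>B. N j A B * (dif j u A * dif j f B))
        + \<rho> * eps j A * dif j u A * avg J (\<lambda>B. eps j B * (N j A B * dif j f B)))"
      by (simp add: avg_eps[OF assms j] dN'[abs_def] dd[of j 1, simplified])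
         (simp add: dif_def avg_const assms)
    also have "\<dots> = avg J (\<lambda>A. avg J (\<lambda>B. (1 + \<rho> * (eps j A * eps j B)) * N j A B * (dif j u A * dif j f B)))"
      by (simp add: algebra_simps flip: avg_cmult avg_add)
    also have "\<dots> = avg J (\<lambda>A. avg J (\<lambda>B. noise J \<rho> A B * (dif j u A * dif j f B)))"
      unfolding noise_def N_def using assms j by (simp add: prod.remove[of J j])
    finally show ?thesis .
  qed
  have K: "((\<lambda>\<rho>. noise J \<rho> A B) has_field_derivative (\<Sum>j\<in>J. (eps j A * eps j B) * N j A B)) (at \<rho>)" for A B
    unfolding noise_def N_def
    by (rule has_field_derivative_prod) (auto intro!: derivative_eq_intros)
  have "(stab J u f has_field_derivative
      avg J (\<lambda>A. avg J (\<lambda>B. (\<Sum>j\<in>J. (eps j A * eps j B) * N j A B) * (u A * f B)))) (at \<rho>)"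
    unfolding stab_def[abs_def] avg_def
    by (intro DERIV_cdivide DERIV_sum DERIV_cmult_right K)
  also have "avg J (\<lambda>A. avg J (\<lambda>B. (\<Sum>j\<in>J. (eps j A * eps j B) * N j A B) * (u A * f B)))
     = (\<Sum>j\<in>J. avg J (\<lambda>A. avg J (\<lambda>B. eps j A * eps j B * N j A B * (u A * f B))))"
    by (simp only: sum_distrib_right avg_sum)
  also have "\<dots> = (\<Sum>j\<in>J. avg J (\<lambda>A. avg J (\<lambda>B. noise J \<rho> A B * (dif j u A * dif j f B))))"
    by (intro sum.cong refl trm)
  also have "\<dots> = avg J (\<lambda>A. avg J (\<lambda>B. noise J \<rho> A B * (\<Sum>j\<in>J. dif j u A * dif j f B)))"
    by (simp only: sum_distrib_left avg_sum)
  finally show ?thesis .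
qed

lemma noise_nonneg: "\<bar>\<rho>\<bar> \<le> 1 \<Longrightarrow> 0 \<le> noise J \<rho> A B"
  unfolding noise_def by (intro prod_nonneg) (auto simp: eps_def)

lemma avg_noise:
  assumes "finite J"
  shows "avg J (\<lambda>A. avg J (\<lambda>B. noise J \<rho> A B)) = 1"
proof -
  have d: "(stab J (\<lambda>_. 1) (\<lambda>_. 1) has_field_derivative 0) (at x)" for x
    using stab_derivative[OF assms, of "\<lambda>_. 1" "\<lambda>_. 1" x] by (simp add: dif_def avg_const assms)
  have "stab J (\<lambda>_. 1) (\<lambda>_. 1) \<rho> = stab J (\<lambda>_. 1) (\<lambda>_. 1) 0"
    using DERIV_isconst_all[of "stab J (\<lambda>_. 1) (\<lambda>_. 1)"] d by blast
  then show ?thesis by (simp add: stab_def noise_def avg_const assms)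
qed

text \<open>The argument of Pisier's K-convexity theorem. Noise is applied with nonnegative correlation
  only; the missing lower bound on \<open>[0, 1/2]\<close> comes from the positivity of the derivative.\<close>

lemma level_one_bound:
  fixes u f :: "nat \<Rightarrow> 'i set \<Rightarrow> real"
  assumes J: "finite J" "J \<noteq> {}"
    and up: "\<And>A B. A \<subseteq> J \<Longrightarrow> B \<subseteq> J \<Longrightarrow> (\<Sum>a<n. u a A * f a B) \<le> \<kappa>"
    and f0: "\<And>a. a < n \<Longrightarrow> avg J (f a) = 0"
    and der: "\<And>A B. A \<subseteq> J \<Longrightarrow> B \<subseteq> J \<Longrightarrow> -\<kappa> \<le> (\<Sum>a<n. \<Sum>j\<in>J. dif j (u a) A * dif j (f a) B)"
    and u2: "\<And>A. A \<subseteq> J \<Longrightarrow> (\<Sum>a<n. (u a A)\<^sup>2) \<le> D"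
    and f2: "\<And>A. A \<subseteq> J \<Longrightarrow> (\<Sum>a<n. (f a A)\<^sup>2) \<le> D"
    and m: "m \<ge> 1" "D / 2 ^ m \<le> \<kappa>"
  shows "(\<Sum>j\<in>J. \<Sum>a<n. avg J (\<lambda>A. u a A * eps j A) * avg J (\<lambda>A. f a A * eps j A)) \<le> 16 * (real m)\<^sup>2 * \<kappa>"
proof -
  define c where "c S = (\<Sum>a<n. avg J (\<lambda>A. u a A * walsh S A) * avg J (\<lambda>A. f a A * walsh S A))" for S
  define q where "q \<rho> = (\<Sum>a<n. stab J (u a) (f a) \<rho>)" for \<rho>
  define co where "co k = (\<Sum>S\<in>{S\<in>Pow J. card S = k}. c S)" for k
  have \<kappa>0: "0 \<le> \<kappa>"
    using m(2) u2[of "{}"] sum_nonneg[of "{..<n}" "\<lambda>a. (u a {})\<^sup>2"] by (smt (verit) divide_nonneg_pos zero_le_power zero_less_power zero_le_power2 empty_subsetI)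
  have qc: "q \<rho> = (\<Sum>S\<in>Pow J. \<rho> ^ card S * c S)" for \<rho>
    unfolding q_def c_def stab_expand[OF J(1)] by (subst sum.swap) (simp add: sum_distrib_left)
  have c0: "c {} = 0" using f0 by (simp add: c_def walsh_def)
  \<comment> \<open>Noise multiplies the Walsh part of degree \<open>k\<close> by the power
    \<open>\<rho>^k\<close>, so \<open>q\<close> is a polynomial; the zero means \<open>f0\<close>
    remove its constant term.\<close>
  have qco: "q \<rho> = (\<Sum>k=1..card J. co k * \<rho> ^ k)" for \<rho>
  proof -
    have "q \<rho> = (\<Sum>k\<in>{0..card J}. \<Sum>S\<in>{S\<in>Pow J. card S = k}. \<rho> ^ card S * c S)"
      unfolding qc using J by (intro sum.group[symmetric]) (auto intro: card_mono)
    also have "\<dots> = (\<Sum>k\<in>{0..card J}. co k * \<rho> ^ k)"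
      unfolding co_def sum_distrib_right by (intro sum.cong refl) (auto simp: mult.commute)
    also have "\<dots> = (\<Sum>k=1..card J. co k * \<rho> ^ k)"
    proof -
      have "{S \<in> Pow J. card S = 0} = {{}}" using J(1) by (auto dest: finite_subset)
      then have "co 0 = 0" using c0 by (simp add: co_def)
      then show ?thesis by (simp add: sum.atLeast_Suc_atMost)
    qed
    finally show ?thesis .
  qed
  have qder: "(q has_field_derivative
      (\<Sum>a<n. avg J (\<lambda>A. avg J (\<lambda>B. noise J \<rho> A B * (\<Sum>j\<in>J. dif j (u a) A * dif j (f a) B))))) (at \<rho>)" for \<rho>
    unfolding q_def[abs_def] by (intro DERIV_sum stab_derivative J)
  have dlow: "-\<kappa> \<le> (\<Sum>a<n. avg J (\<lambda>A. avg J (\<lambda>B. noise J \<rho> A B * (\<Sum>j\<in>J. dif j (u a) A * dif j (f a) B))))"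
    if "0 \<le> \<rho>" "\<rho> \<le> 1" for \<rho>
  proof -
    have "-\<kappa> = avg J (\<lambda>A. avg J (\<lambda>B. noise J \<rho> A B * -\<kappa>))"
      by (simp only: avg_cmult_right avg_noise[OF J(1)])
    also have "\<dots> \<le> avg J (\<lambda>A. avg J (\<lambda>B. noise J \<rho> A B * (\<Sum>a<n. \<Sum>j\<in>J. dif j (u a) A * dif j (f a) B)))"
      by (intro avg_mono mult_left_mono der noise_nonneg) (use that in auto)
    also have "\<dots> = (\<Sum>a<n. avg J (\<lambda>A. avg J (\<lambda>B. noise J \<rho> A B * (\<Sum>j\<in>J. dif j (u a) A * dif j (f a) B))))"
      by (simp only: sum_distrib_left avg_sum)
    finally show ?thesis .
  qed
  have q0: "q 0 = 0" unfolding qco by (intro sum.neutral) auto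
  have qlow: "-\<kappa> \<le> q \<rho>" if "0 \<le> \<rho>" "\<rho> \<le> 1/2" for \<rho>
  proof (cases "\<rho> = 0")
    case False
    then have "0 < \<rho>" using that by simp
    then obtain z where z: "0 < z" "z < \<rho>" and e: "q \<rho> - q 0 = (\<rho> - 0) * (\<Sum>a<n. avg J (\<lambda>A. avg J (\<lambda>B. noise J z A B * (\<Sum>j\<in>J. dif j (u a) A * dif j (f a) B))))"
      using MVT2[OF _ qder] by blast
    have "q \<rho> \<ge> \<rho> * -\<kappa>" using e q0 dlow[of z] z that by (simp only: diff_zero) (intro mult_left_mono, auto)
    also have "\<rho> * -\<kappa> \<ge> -\<kappa>" using \<kappa>0 that mult_right_mono[of \<rho> 1 \<kappa>] by simp
    finally show ?thesis .
  qed (use q0 \<kappa>0 in simp)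
  have qup: "q \<rho> \<le> \<kappa>" if "0 \<le> \<rho>" "\<rho> \<le> 1/2" for \<rho>
  proof -
    have "q \<rho> = avg J (\<lambda>A. avg J (\<lambda>B. noise J \<rho> A B * (\<Sum>a<n. u a A * f a B)))"
      by (simp only: q_def stab_def sum_distrib_left avg_sum)
    also have "\<dots> \<le> avg J (\<lambda>A. avg J (\<lambda>B. noise J \<rho> A B * \<kappa>))"
      by (intro avg_mono mult_left_mono up noise_nonneg) (use that in auto)
    also have "\<dots> = \<kappa>" by (simp only: avg_cmult_right avg_noise[OF J(1)])
    finally show ?thesis .
  qed
  \<comment> \<open>Parseval controls the coefficients of all degrees at once. The crude bound
    \<open>D\<close> matters only through the choice of \<open>m\<close>, hence
    logarithmically.\<close>
  have coD: "\<bar>co k\<bar> \<le> D" for k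
  proof -
    have par: "(\<Sum>S\<in>Pow J. \<Sum>a<n. (avg J (\<lambda>A. g a A * walsh S A))\<^sup>2) \<le> D"
      if "\<And>A. A \<subseteq> J \<Longrightarrow> (\<Sum>a<n. (g a A)\<^sup>2) \<le> D" for g :: "nat \<Rightarrow> 'i set \<Rightarrow> real"
    proof -
      have "(\<Sum>S\<in>Pow J. \<Sum>a<n. (avg J (\<lambda>A. g a A * walsh S A))\<^sup>2) = avg J (\<lambda>A. \<Sum>a<n. (g a A)\<^sup>2)"
        by (subst sum.swap) (simp only: parseval[OF J(1)] avg_sum)
      also have "\<dots> \<le> D" by (intro avg_le J that)
      finally show ?thesis .
    qed
    have "\<bar>co k\<bar> \<le> (\<Sum>S\<in>{S\<in>Pow J. card S = k}. \<bar>c S\<bar>)" unfolding co_def by (rule sum_abs)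
    also have "\<dots> \<le> (\<Sum>S\<in>Pow J. \<bar>c S\<bar>)" using J by (intro sum_mono2) auto
    also have "\<dots> \<le> (\<Sum>S\<in>Pow J. ((\<Sum>a<n. (avg J (\<lambda>A. u a A * walsh S A))\<^sup>2) + (\<Sum>a<n. (avg J (\<lambda>A. f a A * walsh S A))\<^sup>2)) / 2)"
    proof (rule sum_mono)
      fix S
      have xy: "\<bar>x * y\<bar> \<le> (x\<^sup>2 + y\<^sup>2) / 2" for x y :: real
        using sum_squares_bound[of "\<bar>x\<bar>" "\<bar>y\<bar>"] by (simp add: abs_mult)
      show "\<bar>c S\<bar> \<le> ((\<Sum>a<n. (avg J (\<lambda>A. u a A * walsh S A))\<^sup>2) + (\<Sum>a<n. (avg J (\<lambda>A. f a A * walsh S A))\<^sup>2)) / 2"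
        unfolding c_def sum.distrib[symmetric] sum_divide_distrib
        by (intro order_trans[OF sum_abs] sum_mono xy)
    qed
    also have "\<dots> \<le> D"
    proof -
      have "(\<Sum>S\<in>Pow J. \<Sum>a<n. (avg J (\<lambda>A. u a A * walsh S A))\<^sup>2) \<le> D" by (rule par) (rule u2)
      moreover have "(\<Sum>S\<in>Pow J. \<Sum>a<n. (avg J (\<lambda>A. f a A * walsh S A))\<^sup>2) \<le> D" by (rule par) (rule f2)
      ultimately show ?thesis by (simp add: sum.distrib add_divide_distrib flip: sum_divide_distrib)
    qed
    finally show ?thesis .
  qed
  have "\<bar>co 1\<bar> \<le> 16 * (real m)\<^sup>2 * \<kappa>"
  proof (rule linear_coeff_bound[where M = "card J", OF _ coD m])
    fix x :: real assume "0 \<le> x" "x \<le> 1/2"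
    then show "\<bar>\<Sum>k=1..card J. co k * x ^ k\<bar> \<le> \<kappa>"
      using qlow[of x] qup[of x] by (simp add: qco abs_le_iff)
  next
    show "1 \<le> card J" using J by (simp add: Suc_le_eq card_gt_0_iff)
  qed
  moreover have "co 1 = (\<Sum>j\<in>J. \<Sum>a<n. avg J (\<lambda>A. u a A * eps j A) * avg J (\<lambda>A. f a A * eps j A))"
  proof -
    have "{S \<in> Pow J. card S = 1} = (\<lambda>j. {j}) ` J" by (auto simp: card_1_singleton_iff)
    then have "co 1 = (\<Sum>j\<in>J. c {j})" by (simp add: co_def sum.reindex)
    then show ?thesis by (simp add: c_def walsh_def)
  qed
  ultimately show ?thesis by linarith
qed

section \<open>The mean width estimate\<close>

definition ip :: "nat \<Rightarrow> (nat \<Rightarrow> real) \<Rightarrow> (nat \<Rightarrow> real) \<Rightarrow> real"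
  where "ip n x y = (\<Sum>i<n. x i * y i)"

definition grid :: "nat \<Rightarrow> nat \<Rightarrow> (nat \<times> nat) set"
  where "grid n N = {..<n} \<times> {..<N}"

text \<open>The \<open>n\<close> coordinates of this vector play the role of independent Gaussian variables.\<close>

definition gau :: "nat \<Rightarrow> (nat \<times> nat) set \<Rightarrow> nat \<Rightarrow> real"
  where "gau N A b = (\<Sum>l<N. eps (b, l) A) / sqrt (real N)"

lemma finite_grid [simp]: "finite (grid n N)"
  by (simp add: grid_def)

lemma ip_commute: "ip n x y = ip n y x"
  by (simp add: ip_def mult.commute)

lemma ip_self_nonneg: "0 \<le> ip n x x"
  by (simp add: ip_def sum_nonneg)

lemma sum_grid: "(\<Sum>j\<in>grid n N. g j) = (\<Sum>b<n. \<Sum>l<N. g (b, l))"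
  by (simp add: grid_def sum.cartesian_product split_def)

lemma ip_gau: "ip n x (gau N A) = (\<Sum>j\<in>grid n N. x (fst j) / sqrt (real N) * eps j A)"
  by (simp add: ip_def gau_def sum_grid sum_distrib_left sum_divide_distrib)

lemma sum_grid_coeff:
  assumes "N \<ge> 1"
  shows "(\<Sum>j\<in>grid n N. (x (fst j) / sqrt (real N))\<^sup>2) = ip n x x"
  using assms by (simp add: sum_grid power_divide ip_def power2_eq_square)

lemma avg_ip_gau_square:
  assumes "N \<ge> 1"
  shows "avg (grid n N) (\<lambda>A. (ip n x (gau N A))\<^sup>2) = ip n x x"
  unfolding ip_gau by (subst rademacher_moments(1)) (simp_all only: finite_grid sum_grid_coeff[OF assms])

lemma avg_abs_ip_gau:
  assumes "N \<ge> 1"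
  shows "9/16 * sqrt (ip n x x) \<le> avg (grid n N) (\<lambda>A. \<bar>ip n x (gau N A)\<bar>)"
  using khinchine[OF finite_grid, of "\<lambda>j. x (fst j) / sqrt (real N)" n N]
  unfolding ip_gau[symmetric] sum_grid_coeff[OF assms] .

lemma avg_ip_gau: "avg (grid n N) (\<lambda>A. ip n x (gau N A)) = 0"
  unfolding ip_gau avg_sum avg_cmult by (intro sum.neutral) (simp add: avg_eps_eq_zero)

section \<open>Discrete derivatives of softmax means along the random vector\<close>

lemma gau_insert:
  assumes "l < N" "(b, l) \<notin> A"
  shows "gau N (insert (b, l) A) c = gau N A c + (if c = b then 2 / sqrt (real N) else 0)"
proof (cases "c = b")
  case True
  have "(\<Sum>k<N. eps (b, k) (insert (b, l) A)) = (\<Sum>k<N. eps (b, k) A + (if k = l then 2 else 0))"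
    using assms(2) by (intro sum.cong refl) (auto simp: eps_def)
  also have "\<dots> = (\<Sum>k<N. eps (b, k) A) + 2" using assms(1) by (simp add: sum.distrib)
  finally show ?thesis using True by (simp add: gau_def add_divide_distrib)
next
  case False
  then show ?thesis by (simp add: gau_def)
qed

lemma ip_insert:
  assumes "l < N" "(b, l) \<notin> A" "b < n"
  shows "ip n x (gau N (insert (b, l) A)) = ip n x (gau N A) + 2 / sqrt (real N) * x b"
proof -
  have "x i * gau N (insert (b, l) A) i = x i * gau N A i + (if i = b then 2 / sqrt (real N) * x b else 0)" for i
    using assms(1,2) by (simp add: gau_insert distrib_left)
  then show ?thesis using assms(3) by (simp add: ip_def sum.distrib)
qed

text \<open>One flipped sign moves each exponent by \<open>2 / sqrt N\<close> times a coordinate, so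
  \<open>sm_perturb\<close> applies with \<open>M = 2 * R / sqrt N\<close>. The base point
  \<open>A\<close> is one of the two sets occurring in \<open>dif\<close>; the cases differ in the
  sign of the step.\<close>

lemma dif_sm:
  assumes P: "finite P" "P \<noteq> {}" and j: "(b, l) \<in> grid n N"
    and d: "\<And>p. p \<in> P \<Longrightarrow> \<bar>d p b\<bar> \<le> R" and R: "2 * R / sqrt (real N) \<le> 1/2"
    and \<phi>: "\<And>p. p \<in> P \<Longrightarrow> \<bar>\<phi> p\<bar> \<le> B"
  shows "\<bar>dif (b, l) (\<lambda>A. sm P (\<lambda>p. w p + ip n (d p) (gau N A)) \<phi>) A
    - cv P (\<lambda>p. w p + ip n (d p) (gau N A)) \<phi> (\<lambda>p. d p b) / sqrt (real N)\<bar> \<le> 64 * R\<^sup>2 * B / real N"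
proof -
  let ?e = "\<lambda>A p. w p + ip n (d p) (gau N A)"
  have bl: "b < n" "l < N" using j by (auto simp: grid_def)
  have main: "\<bar>sm P (?e A') \<phi> - sm P (?e A) \<phi> - s * cv P (?e A) \<phi> (\<lambda>p. d p b)\<bar> \<le> 128 * R\<^sup>2 * B / real N"
    if e: "\<And>p. ?e A' p = ?e A p + s * d p b" and s: "\<bar>s\<bar> = 2 / sqrt (real N)" for A' s
  proof -
    have "\<bar>s * d p b\<bar> \<le> 2 * R / sqrt (real N)" if "p \<in> P" for p
      using d[OF that] s by (simp add: abs_mult divide_right_mono)
    then have "\<bar>sm P (\<lambda>p. ?e A p + s * d p b) \<phi> - sm P (?e A) \<phi> - cv P (?e A) \<phi> (\<lambda>p. s * d p b)\<bar>
      \<le> 32 * (2 * R / sqrt (real N))\<^sup>2 * B"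
      by (intro sm_perturb P R \<phi>)
    then show ?thesis using bl
      by (simp add: e[symmetric] cv_cmult_right power_divide power_mult_distrib)
  qed
  show ?thesis
  proof (cases "(b, l) \<in> A")
    case True
    then have ins: "insert (b, l) (A - {(b, l)}) = A" by blast
    have "?e (A - {(b, l)}) p = ?e A p + (- 2 / sqrt (real N)) * d p b" for p
      using ip_insert[OF bl(2) _ bl(1), of "A - {(b, l)}" "d p"] unfolding ins by simp
    from main[OF this] show ?thesis
      using True by (simp add: dif_def insert_absorb abs_le_iff field_simps)
  next
    case False
    have "?e (insert (b, l) A) p = ?e A p + (2 / sqrt (real N)) * d p b" for p
      using ip_insert[OF bl(2) False bl(1), of "d p"] by simp
    from main[OF this] show ?thesis
      using False by (simp add: dif_def abs_le_iff field_simps)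
  qed
qed

text \<open>A function of the random vector is invariant under transpositions of signs within a
  block. All signs of the block thus have the same correlation with it, and their normalised sum is
  the coordinate \<open>gau N A b\<close>.\<close>

lemma avg_eps_block:
  assumes "b < n" "l < N"
  shows "avg (grid n N) (\<lambda>A. F (gau N A) * eps (b, l) A) = avg (grid n N) (\<lambda>A. F (gau N A) * gau N A b) / sqrt (real N)"
proof -
  have sym: "avg (grid n N) (\<lambda>A. F (gau N A) * eps (b, k) A) = avg (grid n N) (\<lambda>A. F (gau N A) * eps (b, l) A)"
    if k: "k < N" for k
  proof -
    define \<tau> where "\<tau> = Transposition.transpose (b, k) (b, l)"
    have inv: "\<tau> (\<tau> x) = x" for x by (simp add: \<tau>_def)
    have tbl: "\<tau> (b, l) = (b, k)" by (simp add: \<tau>_def)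
    have tG: "\<tau> x \<in> grid n N" if "x \<in> grid n N" for x
      using that k assms by (auto simp: \<tau>_def grid_def Transposition.transpose_def)
    have ii: "\<tau> ` \<tau> ` A = A" for A by (simp add: image_image inv)
    have eps: "eps j (\<tau> ` A) = eps (\<tau> j) A" for j A
      using inv by (metis (no_types, lifting) eps_def image_eqI imageE)
    have gau: "gau N (\<tau> ` A) = gau N A" for A
    proof
      fix c
      have "(\<Sum>i<N. eps (\<tau> (c, i)) A) = (\<Sum>i<N. eps (c, i) A)"
      proof (cases "c = b")
        case True
        have "\<tau> (b, i) = (b, Transposition.transpose k l i)" for i by (auto simp: \<tau>_def Transposition.transpose_def)
        moreover have "(\<Sum>i<N. eps (b, Transposition.transpose k l i) A) = (\<Sum>i<N. eps (b, i) A)"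
          by (rule sum.reindex_bij_witness[of _ "Transposition.transpose k l" "Transposition.transpose k l"])
             (use k assms in \<open>auto simp: Transposition.transpose_def\<close>)
        ultimately show ?thesis using True by simp
      next
        case False
        then show ?thesis by (simp add: \<tau>_def Transposition.transpose_def)
      qed
      then show "gau N (\<tau> ` A) c = gau N A c" by (simp add: gau_def eps)
    qed
    have "(\<Sum>A\<in>Pow (grid n N). F (gau N A) * eps (b, k) A) = (\<Sum>A\<in>Pow (grid n N). F (gau N A) * eps (b, l) A)"
    proof (rule sum.reindex_bij_witness[of _ "(`) \<tau>" "(`) \<tau>"])
      fix A assume "A \<in> Pow (grid n N)"
      then show "F (gau N (\<tau> ` A)) * eps (b, l) (\<tau> ` A) = F (gau N A) * eps (b, k) A"
        by (simp only: gau eps tbl)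
    qed (use tG ii in auto)
    then show ?thesis by (simp add: avg_def)
  qed
  have "avg (grid n N) (\<lambda>A. F (gau N A) * gau N A b) = (\<Sum>k<N. avg (grid n N) (\<lambda>A. F (gau N A) * eps (b, k) A)) / sqrt (real N)"
  proof -
    have "F (gau N A) * gau N A b = (1 / sqrt (real N)) * (\<Sum>k<N. F (gau N A) * eps (b, k) A)" for A
      by (simp add: gau_def flip: sum_distrib_left)
    then show ?thesis by (simp only: avg_cmult avg_sum) simp
  qed
  also have "\<dots> = real N * avg (grid n N) (\<lambda>A. F (gau N A) * eps (b, l) A) / sqrt (real N)"
    by (simp add: sym)
  also have "\<dots> = sqrt (real N) * avg (grid n N) (\<lambda>A. F (gau N A) * eps (b, l) A)"
    by (simp only: times_divide_eq_left[symmetric] real_div_sqrt[OF of_nat_0_le_iff])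
  finally show ?thesis using assms by simp
qed

text \<open>The Hessians of the two convex functions are the covariances, so this is the inequality
  \<open>tr (H\<^sub>1 H\<^sub>2) \<ge> 0\<close> for positive semidefinite matrices.\<close>

lemma trace_cv_nonneg:
  assumes "finite P" "P \<noteq> {}" "finite Q" "Q \<noteq> {}"
  shows "0 \<le> (\<Sum>a<n. \<Sum>b<n. cv P e (\<lambda>x. x a) (\<lambda>x. x b) * cv Q e' (\<lambda>y. y a) (\<lambda>y::nat \<Rightarrow> real. y b))"
proof -
  let ?G = "\<lambda>a b. cv P e (\<lambda>x. x a) (\<lambda>x. x b)"
  have G: "0 \<le> (\<Sum>a<n. \<Sum>b<n. ?G a b * (z a * z b))" for z :: "nat \<Rightarrow> real"
  proof -
    have "(\<Sum>a<n. \<Sum>b<n. ?G a b * (z a * z b))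
      = sm P e (\<lambda>x. sm P e (\<lambda>x'. \<Sum>a<n. \<Sum>b<n. (x a - x' a) * (x b - x' b) * (z a * z b))) / 2"
      by (simp add: cv_double assms sm_sum sm_cmult_right sum_divide_distrib)
    also have "\<dots> = sm P e (\<lambda>x. sm P e (\<lambda>x'. (\<Sum>a<n. (x a - x' a) * z a)\<^sup>2)) / 2"
      by (simp add: power2_eq_square sum_product ac_simps)
    also have "\<dots> \<ge> 0" by (intro divide_nonneg_pos sm_ge assms) auto
    finally show ?thesis .
  qed
  \<comment> \<open>The second covariance matrix is an average of rank-one matrices, which reduces
    the trace to values of the quadratic form of the first.\<close>
  have "(\<Sum>a<n. \<Sum>b<n. ?G a b * cv Q e' (\<lambda>y. y a) (\<lambda>y. y b))
    = sm Q e' (\<lambda>y. sm Q e' (\<lambda>y'. \<Sum>a<n. \<Sum>b<n. ?G a b * ((y a - y' a) * (y b - y' b)))) / 2"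
    by (simp add: cv_double[OF assms(3,4)] sm_sum sm_cmult sum_divide_distrib)
  also have "\<dots> \<ge> 0" by (intro divide_nonneg_pos sm_ge assms G) auto
  finally show ?thesis .
qed

text \<open>The tangent-line bound taken from \<open>e\<close> to the zero exponent, where
  \<open>lse\<close> is the logarithm of the cardinality. It allows a width to be estimated by the
  gradient paired with the random vector.\<close>

lemma lse_le_sm:
  assumes "finite P" "P \<noteq> {}"
  shows "lse P e \<le> sm P e e + ln (real (card P))"
proof -
  have "lse P e + sm P e (\<lambda>p. - 1 * e p) \<le> lse P (\<lambda>p. e p + - 1 * e p)"
    by (rule lse_ge_linear[OF assms])
  then show ?thesis unfolding sm_cmult by (simp add: lse_def)
qed

text \<open>\<open>f\<close> and the softmax mean \<open>u\<close> over \<open>Xs\<close> are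
  gradients of two smoothed support functions. By \<open>f1\<close> the level-one coefficients of
  \<open>f\<close> form \<open>lam\<close> times the identity, so the level-one pairing of
  \<open>u\<close> and \<open>f\<close> is \<open>lam\<close> times the average of \<open>u\<close>
  paired with \<open>gau\<close>; that average dominates the smoothed width of \<open>Xs\<close> up
  to \<open>ln (card Xs)\<close>. In \<open>level_one_bound\<close> the pointwise hypothesis is the
  duality, and the derivative hypothesis is the trace inequality, with discretisation errors kept
  below \<open>\<kappa>\<close> by a large \<open>N\<close>.\<close>

proposition width_bound:
  fixes Xs Ys :: "(nat \<Rightarrow> real) set" and w :: "(nat \<Rightarrow> real) \<Rightarrow> real" and n N :: nat
  defines "f \<equiv> \<lambda>A. sm Ys (\<lambda>y. w y + ip n y (gau N A))"
  assumes X: "finite Xs" "Xs \<noteq> {}" and Y: "finite Ys" "Ys \<noteq> {}"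
    and dual: "\<And>x y. x \<in> Xs \<Longrightarrow> y \<in> Ys \<Longrightarrow> ip n x y \<le> \<kappa>"
    and xR: "\<And>x a. x \<in> Xs \<Longrightarrow> a < n \<Longrightarrow> \<bar>x a\<bar> \<le> R" and yR: "\<And>y a. y \<in> Ys \<Longrightarrow> a < n \<Longrightarrow> \<bar>y a\<bar> \<le> R"
    and R: "1 \<le> R" and N: "4352 * (real n)\<^sup>2 * R ^ 6 \<le> \<kappa> * sqrt (real N)" "16 * R\<^sup>2 \<le> real N" and n: "1 \<le> n"
    and f0: "\<And>a. a < n \<Longrightarrow> avg (grid n N) (\<lambda>A. f A (\<lambda>y. y a)) = 0"
    and f1: "\<And>a b. a < n \<Longrightarrow> b < n \<Longrightarrow>
      avg (grid n N) (\<lambda>A. f A (\<lambda>y. y a) * gau N A b) = (if a = b then lam else 0)"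
    and m: "m \<ge> 1" "real n * R\<^sup>2 / 2 ^ m \<le> \<kappa>" and lam: "0 \<le> lam"
  shows "lam * avg (grid n N) (\<lambda>A. lse Xs (\<lambda>x. ip n x (gau N A))) \<le> 16 * (real m)\<^sup>2 * \<kappa> + lam * ln (real (card Xs))"
proof -
  let ?J = "grid n N"
  define u where "u a A = sm Xs (\<lambda>x. 0 + ip n x (gau N A)) (\<lambda>x. x a)" for a A
  define g where "g a A = f A (\<lambda>y. y a)" for a A
  define r where "r = sqrt (real N)"
  have "1 \<le> R\<^sup>2" using R by (rule one_le_power)
  then have "real N \<ge> 16 * 1" using N(2) by linarith
  then have N1: "N \<ge> 1" by simp
  have r0: "r > 0" and r2: "r * r = real N" using N1 by (simp_all add: r_def)
  have "(4 * R)\<^sup>2 \<le> r\<^sup>2" using N(2) r2 by (simp add: power2_eq_square)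
  then have r4: "4 * R \<le> r" by (rule power2_le_imp_le) (use r0 in simp)
  have r1: "1 \<le> r" using r4 R by linarith
  have RN: "2 * R / sqrt (real N) \<le> 1/2" using r4 r0 by (simp add: r_def[symmetric] field_simps)
  have "(0, 0) \<in> ?J" using N1 n by (auto simp: grid_def)
  then have J0: "?J \<noteq> {}" by blast
  have ub: "\<bar>u a A\<bar> \<le> R" if "a < n" for a A unfolding u_def by (intro sm_abs_le X xR that)
  have gb: "\<bar>g a A\<bar> \<le> R" if "a < n" for a A unfolding g_def f_def by (intro sm_abs_le Y yR that)
  have pair: "(\<Sum>a<n. u a A * g a B) \<le> \<kappa>" for A B
  proof -
    have "(\<Sum>a<n. u a A * g a B) = sm Xs (\<lambda>x. 0 + ip n x (gau N A)) (\<lambda>x. sm Ys (\<lambda>y. w y + ip n y (gau N B)) (\<lambda>y. ip n x y))"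
      by (simp add: u_def g_def f_def ip_def sm_sum sm_cmult sm_cmult_right)
    also have "\<dots> \<le> \<kappa>" by (intro sm_le X Y dual)
    finally show ?thesis .
  qed
  have sq: "(\<Sum>a<n. (h a A)\<^sup>2) \<le> real n * R\<^sup>2" if "\<And>a. a < n \<Longrightarrow> \<bar>h a A\<bar> \<le> R" for h :: "nat \<Rightarrow> (nat \<times> nat) set \<Rightarrow> real" and A
  proof -
    have "(h a A)\<^sup>2 \<le> R\<^sup>2" if "a < n" for a using \<open>\<And>a. a < n \<Longrightarrow> \<bar>h a A\<bar> \<le> R\<close>[OF that] by (metis abs_ge_zero power2_abs power_mono)
    then have "(\<Sum>a<n. (h a A)\<^sup>2) \<le> (\<Sum>a<n. R\<^sup>2)" by (intro sum_mono) auto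
    then show ?thesis by simp
  qed
  have der: "-\<kappa> \<le> (\<Sum>a<n. \<Sum>j\<in>?J. dif j (u a) A * dif j (g a) B)" for A B
  proof -
    let ?Cu = "\<lambda>a b. cv Xs (\<lambda>x. 0 + ip n x (gau N A)) (\<lambda>x. x a) (\<lambda>x. x b)"
    let ?Cg = "\<lambda>a b. cv Ys (\<lambda>y. w y + ip n y (gau N B)) (\<lambda>y. y a) (\<lambda>y. y b)"
    \<comment> \<open>\<open>\<eta>\<close> is the error of one discrete derivative and
      \<open>E\<close> that of a product of two. The main terms are at most
      \<open>2 * R^2 / r\<close>, which gives \<open>4352 = 4 * 64 + 64^2\<close>.\<close>
    define \<eta> where "\<eta> = 64 * R\<^sup>2 * R / real N"
    define E where "E = 4352 * R ^ 6 / r ^ 3"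
    have est: "?Cu a b * ?Cg a b / real N - E \<le> dif (b, l) (u a) A * dif (b, l) (g a) B"
      if a: "a < n" and bl: "(b, l) \<in> ?J" for a b l
    proof -
      have b: "b < n" using bl by (auto simp: grid_def)
      define p q s t where "p = ?Cu a b / r" and "q = ?Cg a b / r"
        and "s = dif (b, l) (u a) A" and "t = dif (b, l) (g a) B"
      have sp: "\<bar>s - p\<bar> \<le> \<eta>" unfolding s_def p_def \<eta>_def r_def u_def[abs_def]
        by (rule dif_sm[OF X bl _ RN]) (use xR a b in auto)
      have tq: "\<bar>t - q\<bar> \<le> \<eta>" unfolding t_def q_def \<eta>_def r_def g_def[abs_def] f_def
        by (rule dif_sm[OF Y bl _ RN]) (use yR a b in auto)
      have p: "\<bar>p\<bar> \<le> 2 * R * R / r"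
        unfolding p_def abs_divide using r0 by (auto intro!: divide_right_mono cv_abs_le X xR a b)
      have q: "\<bar>q\<bar> \<le> 2 * R * R / r"
        unfolding q_def abs_divide using r0 by (auto intro!: divide_right_mono cv_abs_le Y yR a b)
      have \<eta>0: "0 \<le> \<eta>" using sp by linarith
      have "p * q - s * t = - (p * (t - q) + (s - p) * q + (s - p) * (t - q))" by (simp add: algebra_simps)
      also have "\<dots> \<le> \<bar>p\<bar> * \<bar>t - q\<bar> + \<bar>s - p\<bar> * \<bar>q\<bar> + \<bar>s - p\<bar> * \<bar>t - q\<bar>"
        unfolding abs_mult[symmetric] by linarith
      also have "\<dots> \<le> 2 * R * R / r * \<eta> + \<eta> * (2 * R * R / r) + \<eta> * \<eta>"
        using sp tq p q \<eta>0 by (intro add_mono mult_mono) auto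
      also have "\<dots> = 256 * R ^ 5 / r ^ 3 + 4096 * R ^ 6 / r ^ 4"
        unfolding \<eta>_def r2[symmetric] by (simp add: field_simps eval_nat_numeral)
      also have "\<dots> \<le> E"
      proof -
        have "R ^ 5 \<le> R ^ 6" using R by (intro power_increasing) auto
        then have "256 * R ^ 5 / r ^ 3 \<le> 256 * R ^ 6 / r ^ 3" using r0 by (intro divide_right_mono) auto
        moreover have "4096 * R ^ 6 / r ^ 4 \<le> 4096 * R ^ 6 / r ^ 3"
          using r1 R by (intro divide_left_mono power_increasing) auto
        ultimately have "256 * R ^ 5 / r ^ 3 + 4096 * R ^ 6 / r ^ 4 \<le> 256 * R ^ 6 / r ^ 3 + 4096 * R ^ 6 / r ^ 3"
          by (rule add_mono)
        also have "\<dots> = E" by (simp add: E_def flip: add_divide_distrib)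
        finally show ?thesis .
      qed
      finally show ?thesis unfolding s_def[symmetric] t_def[symmetric]
        using r2 r0 by (simp add: p_def q_def)
    qed
    have "(\<Sum>a<n. \<Sum>j\<in>?J. dif j (u a) A * dif j (g a) B)
      = (\<Sum>a<n. \<Sum>b<n. \<Sum>l<N. dif (b, l) (u a) A * dif (b, l) (g a) B)"
      by (simp add: sum_grid)
    also have "\<dots> \<ge> (\<Sum>a<n. \<Sum>b<n. \<Sum>l<N. ?Cu a b * ?Cg a b / real N - E)"
      by (intro sum_mono est) (auto simp: grid_def)
    also have "(\<Sum>a<n. \<Sum>b<n. \<Sum>l<N. ?Cu a b * ?Cg a b / real N - E)
       = (\<Sum>a<n. \<Sum>b<n. ?Cu a b * ?Cg a b) - (real n)\<^sup>2 * real N * E"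
      using N1 by (simp add: sum_subtractf power2_eq_square right_diff_distrib)
    also have "(real n)\<^sup>2 * real N * E = 4352 * (real n)\<^sup>2 * R ^ 6 / r"
      unfolding E_def r2[symmetric] using r0 by (simp add: power3_eq_cube)
    finally have "(\<Sum>a<n. \<Sum>b<n. ?Cu a b * ?Cg a b) - 4352 * (real n)\<^sup>2 * R ^ 6 / r
      \<le> (\<Sum>a<n. \<Sum>j\<in>?J. dif j (u a) A * dif j (g a) B)" .
    moreover have "4352 * (real n)\<^sup>2 * R ^ 6 / r \<le> \<kappa>"
      using N(1) r0 by (simp add: r_def[symmetric] divide_le_eq)
    moreover have "0 \<le> (\<Sum>a<n. \<Sum>b<n. ?Cu a b * ?Cg a b)" by (rule trace_cv_nonneg[OF X Y])
    ultimately show ?thesis by linarith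
  qed
  have "(\<Sum>j\<in>?J. \<Sum>a<n. avg ?J (\<lambda>A. u a A * eps j A) * avg ?J (\<lambda>A. g a A * eps j A)) \<le> 16 * (real m)\<^sup>2 * \<kappa>"
    by (rule level_one_bound[OF finite_grid J0 pair _ der _ _ m])
       (use f0 ub gb in \<open>auto simp: g_def[abs_def] intro: sq\<close>)
  also have "(\<Sum>j\<in>?J. \<Sum>a<n. avg ?J (\<lambda>A. u a A * eps j A) * avg ?J (\<lambda>A. g a A * eps j A))
     = (\<Sum>b<n. \<Sum>l<N. \<Sum>a<n. avg ?J (\<lambda>A. u a A * gau N A b) / r * ((if a = b then lam else 0) / r))"
  proof -
    have "avg ?J (\<lambda>A. u a A * eps (b, l) A) = avg ?J (\<lambda>A. u a A * gau N A b) / r"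
      "avg ?J (\<lambda>A. g a A * eps (b, l) A) = (if a = b then lam else 0) / r"
      if "b < n" "l < N" "a < n" for a b l
      using avg_eps_block[OF that(1,2), of "\<lambda>G. sm Xs (\<lambda>x. 0 + ip n x G) (\<lambda>x. x a)"]
        avg_eps_block[OF that(1,2), of "\<lambda>G. sm Ys (\<lambda>y. w y + ip n y G) (\<lambda>y. y a)"] f1[OF that(3,1)]
      by (auto simp: u_def g_def f_def r_def)
    then show ?thesis unfolding sum_grid by (intro sum.cong refl) auto
  qed
  also have "\<dots> = (\<Sum>b<n. \<Sum>l<N. lam * avg ?J (\<lambda>A. u b A * gau N A b) / real N)"
    using r2 by (intro sum.cong refl) (simp add: if_distrib if_distribR ac_simps cong: if_cong)
  also have "\<dots> = lam * avg ?J (\<lambda>A. \<Sum>b<n. u b A * gau N A b)"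
    using N1 by (simp add: avg_sum sum_distrib_left)
  also have "(\<lambda>A. \<Sum>b<n. u b A * gau N A b) = (\<lambda>A. sm Xs (\<lambda>x. ip n x (gau N A)) (\<lambda>x. ip n x (gau N A)))"
  proof
    fix A
    show "(\<Sum>b<n. u b A * gau N A b) = sm Xs (\<lambda>x. ip n x (gau N A)) (\<lambda>x. ip n x (gau N A))"
      unfolding u_def by (subst (3) ip_def) (simp add: sm_sum sm_cmult_right)
  qed
  finally have *: "lam * avg ?J (\<lambda>A. sm Xs (\<lambda>x. ip n x (gau N A)) (\<lambda>x. ip n x (gau N A))) \<le> 16 * (real m)\<^sup>2 * \<kappa>" .
  have "avg ?J (\<lambda>A. lse Xs (\<lambda>x. ip n x (gau N A)))
     \<le> avg ?J (\<lambda>A. sm Xs (\<lambda>x. ip n x (gau N A)) (\<lambda>x. ip n x (gau N A)) + ln (real (card Xs)))"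
    by (intro avg_mono lse_le_sm X)
  also have "\<dots> = avg ?J (\<lambda>A. sm Xs (\<lambda>x. ip n x (gau N A)) (\<lambda>x. ip n x (gau N A))) + ln (real (card Xs))"
    by (simp add: avg_add avg_const)
  finally have "lam * avg ?J (\<lambda>A. lse Xs (\<lambda>x. ip n x (gau N A)))
    \<le> lam * (avg ?J (\<lambda>A. sm Xs (\<lambda>x. ip n x (gau N A)) (\<lambda>x. ip n x (gau N A))) + ln (real (card Xs)))"
    using lam by (rule mult_left_mono)
  then show ?thesis using * by (simp add: distrib_left)
qed

section \<open>Orthogonal matrices and Chevet's inequality\<close>

lemma attains_min_bounded:
  fixes G :: "('i \<Rightarrow> real) \<Rightarrow> real"
  assumes "closed C" "C \<noteq> {}" "\<And>x i. x \<in> C \<Longrightarrow> \<bar>x i\<bar> \<le> M" "continuous_on C G"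
  obtains x where "x \<in> C" "\<And>y. y \<in> C \<Longrightarrow> G x \<le> G y"
proof -
  have "compact (PiE UNIV (\<lambda>_::'i. {-M..M}))"
    using compactin_PiE[of "\<lambda>_::'i. euclidean :: real topology" UNIV "\<lambda>_. {-M..M}"]
    by (simp add: euclidean_product_topology)
  then have "compact (PiE UNIV (\<lambda>_::'i. {-M..M}) \<inter> C)" by (rule compact_Int_closed) (rule assms)
  moreover have "PiE UNIV (\<lambda>_::'i. {-M..M}) \<inter> C = C"
  proof -
    have "-M \<le> x i" "x i \<le> M" if "x \<in> C" for x i using assms(3)[OF that, of i] by linarith+
    then show ?thesis by (auto simp: PiE_iff)
  qed
  ultimately have "compact C" by simp
  then show ?thesis using continuous_attains_inf[OF _ assms(2,4)] that by blast
qed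

lemma continuous_on_lse [continuous_intros]:
  assumes "finite P" "P \<noteq> {}" "\<And>p. p \<in> P \<Longrightarrow> continuous_on S (\<lambda>x. e x p)"
  shows "continuous_on S (\<lambda>x. lse P (e x))"
proof -
  have "\<forall>x\<in>S. (\<Sum>p\<in>P. exp (e x p)) \<noteq> 0"
  proof
    fix x
    have "0 < (\<Sum>p\<in>P. exp (e x p))" by (rule sum_exp_pos[OF assms(1,2)])
    then show "(\<Sum>p\<in>P. exp (e x p)) \<noteq> 0" by linarith
  qed
  then show ?thesis unfolding lse_def
    by (intro continuous_on_ln continuous_on_sum continuous_on_exp assms)
qed

lemma continuous_on_avg [continuous_intros]:
  assumes "\<And>A. continuous_on S (\<lambda>x. F x A)"
  shows "continuous_on S (\<lambda>x. avg J (F x))"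
  unfolding avg_def by (intro continuous_intros assms) auto

section \<open>Euclidean norm and orthogonal matrices\<close>

definition nrm :: "nat \<Rightarrow> (nat \<Rightarrow> real) \<Rightarrow> real"
  where "nrm n x = sqrt (ip n x x)"

lemma nrm_nonneg [simp]: "0 \<le> nrm n x"
  by (simp add: nrm_def ip_self_nonneg)

lemma nrm_square: "nrm n x * nrm n x = ip n x x"
  by (simp add: nrm_def ip_self_nonneg)

lemma ip_cmult_left: "ip n (\<lambda>i. c * x i) z = c * ip n x z"
  by (simp add: ip_def sum_distrib_left mult.assoc)

lemma ip_add_right: "ip n z (\<lambda>i. x i + y i) = ip n z x + ip n z y"
  by (simp add: ip_def distrib_left sum.distrib)

lemma ip_diff_right: "ip n z (\<lambda>i. x i - y i) = ip n z x - ip n z y"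
  by (simp add: ip_def right_diff_distrib sum_subtractf)

lemma ip_cmult_right: "ip n z (\<lambda>i. c * x i) = c * ip n z x"
  by (simp add: ip_def sum_distrib_left ac_simps)

lemma ip_cauchy_schwarz: "\<bar>ip n x y\<bar> \<le> nrm n x * nrm n y"
proof -
  have "(ip n x y)\<^sup>2 \<le> ip n x x * ip n y y"
    using Cauchy_Schwarz_ineq_sum[of x y "{..<n}"] by (simp add: ip_def power2_eq_square)
  then have "sqrt ((ip n x y)\<^sup>2) \<le> sqrt (ip n x x * ip n y y)" by (rule real_sqrt_le_mono)
  then show ?thesis by (simp add: nrm_def real_sqrt_mult)
qed

lemma abs_coord_le_nrm: "i < n \<Longrightarrow> \<bar>x i\<bar> \<le> nrm n x"
proof -
  assume "i < n"
  then have "x i * x i \<le> ip n x x" unfolding ip_def by (intro member_le_sum) auto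
  then have "sqrt ((x i)\<^sup>2) \<le> sqrt (ip n x x)" by (intro real_sqrt_le_mono) (simp add: power2_eq_square)
  then show ?thesis by (simp add: nrm_def)
qed

definition mv :: "nat \<Rightarrow> (nat \<times> nat \<Rightarrow> real) \<Rightarrow> (nat \<Rightarrow> real) \<Rightarrow> nat \<Rightarrow> real"
  where "mv n U x = (\<lambda>i. \<Sum>k<n. U (i, k) * x k)"

text \<open>Vanishing outside the \<open>n \<times> n\<close> block makes the orthogonal group compact in the product topology.\<close>

definition orth :: "nat \<Rightarrow> (nat \<times> nat \<Rightarrow> real) set"
  where "orth n = {U. (\<forall>i<n. \<forall>j<n. (\<Sum>k<n. U (k, i) * U (k, j)) = (if i = j then 1 else 0)) \<and>
    (\<forall>i j. \<not> (i < n \<and> j < n) \<longrightarrow> U (i, j) = 0)}"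

lemma orth_ip:
  assumes "U \<in> orth n"
  shows "ip n (mv n U x) (mv n U y) = ip n x y"
proof -
  have "ip n (mv n U x) (mv n U y) = (\<Sum>k<n. \<Sum>i<n. \<Sum>j<n. U (k, i) * U (k, j) * (x i * y j))"
    by (simp add: ip_def mv_def sum_product ac_simps)
  also have "\<dots> = (\<Sum>i<n. \<Sum>j<n. \<Sum>k<n. U (k, i) * U (k, j) * (x i * y j))"
    by (subst sum.swap) (intro sum.cong refl sum.swap)
  also have "\<dots> = (\<Sum>i<n. \<Sum>j<n. (if i = j then 1 else 0) * (x i * y j))"
    using assms by (intro sum.cong refl) (simp add: orth_def flip: sum_distrib_right)
  also have "\<dots> = ip n x y" by (simp add: ip_def if_distrib if_distribR cong: if_cong)
  finally show ?thesis .
qed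

lemma orth_nrm: "U \<in> orth n \<Longrightarrow> nrm n (mv n U x) = nrm n x"
  by (simp add: nrm_def orth_ip)

lemma orth_abs_le: "U \<in> orth n \<Longrightarrow> \<bar>U i\<bar> \<le> 1"
proof (cases i)
  case (Pair a b)
  assume U: "U \<in> orth n"
  show ?thesis
  proof (cases "a < n \<and> b < n")
    case True
    then have "U (a, b) * U (a, b) \<le> (\<Sum>k<n. U (k, b) * U (k, b))" by (intro member_le_sum) auto
    also have "\<dots> = 1" using U True by (simp add: orth_def)
    finally have "(U (a, b))\<^sup>2 \<le> 1" by (simp add: power2_eq_square)
    then show ?thesis using Pair by (simp add: abs_square_le_1)
  qed (use U Pair in \<open>auto simp: orth_def\<close>)
qed

lemma closed_orth: "closed (orth n)"
  unfolding orth_def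
  by (intro closed_Collect_conj closed_Collect_all closed_Collect_imp open_Collect_const
      closed_Collect_eq continuous_intros continuous_on_product_coordinates)

definition scalar :: "nat \<Rightarrow> real \<Rightarrow> nat \<times> nat \<Rightarrow> real"
  where "scalar n c = (\<lambda>(i, j). if i = j \<and> i < n then c else 0)"

lemma scalar_orth: "c * c = 1 \<Longrightarrow> scalar n c \<in> orth n"
  by (auto simp: orth_def scalar_def if_distrib if_distribR cong: if_cong)

lemma mv_scalar: "i < n \<Longrightarrow> mv n (scalar n c) x i = c * x i"
  by (simp add: mv_def scalar_def if_distrib if_distribR cong: if_cong)

lemma ip_scalar: "ip n (mv n (scalar n c) x) y = c * ip n x y"
  by (simp add: ip_def mv_scalar sum_distrib_left mult.assoc)

text \<open>Left multiplication by a rotation in the rows \<open>a\<close> and \<open>b\<close>.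
  Taking \<open>c\<close> and \<open>s\<close> as arguments in place of an angle turns orthogonality
  into a polynomial identity modulo \<open>c * c + s * s = 1\<close>.\<close>

definition givens :: "real \<Rightarrow> real \<Rightarrow> nat \<Rightarrow> nat \<Rightarrow> (nat \<times> nat \<Rightarrow> real) \<Rightarrow> nat \<times> nat \<Rightarrow> real"
  where "givens c s a b U = (\<lambda>(i, j). if i = a then c * U (a, j) - s * U (b, j)
    else if i = b then s * U (a, j) + c * U (b, j) else U (i, j))"

lemma sum_two_changed:
  fixes f g :: "nat \<Rightarrow> real"
  assumes "a < n" "b < n" "a \<noteq> b" "\<And>k. k < n \<Longrightarrow> k \<noteq> a \<Longrightarrow> k \<noteq> b \<Longrightarrow> f k = g k"
  shows "(\<Sum>k<n. f k) = (\<Sum>k<n. g k) + (f a - g a) + (f b - g b)"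
proof -
  have "(\<Sum>k<n. f k - g k) = (\<Sum>k\<in>{a, b}. f k - g k)"
    using assms by (intro sum.mono_neutral_right) auto
  then show ?thesis using assms(3) by (simp add: sum_subtractf)
qed

lemma givens_orth:
  assumes "U \<in> orth n" "a < n" "b < n" "a \<noteq> b" "c * c + s * s = 1"
  shows "givens c s a b U \<in> orth n"
proof -
  let ?V = "givens c s a b U"
  have "(\<Sum>k<n. ?V (k, i) * ?V (k, j)) = (\<Sum>k<n. U (k, i) * U (k, j))" for i j
  proof -
    have "(\<Sum>k<n. ?V (k, i) * ?V (k, j)) = (\<Sum>k<n. U (k, i) * U (k, j))
      + (?V (a, i) * ?V (a, j) - U (a, i) * U (a, j)) + (?V (b, i) * ?V (b, j) - U (b, i) * U (b, j))"
      by (rule sum_two_changed) (use assms in \<open>auto simp: givens_def\<close>)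
    moreover have "?V (a, i) * ?V (a, j) + ?V (b, i) * ?V (b, j)
      = (c * c + s * s) * (U (a, i) * U (a, j)) + (c * c + s * s) * (U (b, i) * U (b, j))"
      using assms(4) by (simp add: givens_def algebra_simps)
    ultimately show ?thesis using assms(5) by simp
  qed
  then show ?thesis using assms by (auto simp: orth_def givens_def)
qed

lemma ip_givens:
  assumes "a < n" "b < n" "a \<noteq> b"
  shows "ip n (mv n (givens c s a b U) x) q = ip n (mv n U x) q
    + ((c - 1) * (mv n U x a * q a + mv n U x b * q b) + s * (mv n U x a * q b - mv n U x b * q a))"
proof -
  have "mv n (givens c s a b U) x k = (if k = a then c * mv n U x a - s * mv n U x b
    else if k = b then s * mv n U x a + c * mv n U x b else mv n U x k)" for k
    by (simp add: mv_def givens_def algebra_simps sum.distrib sum_subtractf sum_distrib_left)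
  then have "ip n (mv n (givens c s a b U) x) q = ip n (mv n U x) q
     + ((c * mv n U x a - s * mv n U x b) * q a - mv n U x a * q a)
     + ((s * mv n U x a + c * mv n U x b) * q b - mv n U x b * q b)"
    unfolding ip_def using sum_two_changed[OF assms, of "\<lambda>k. mv n (givens c s a b U) x k * q k" "\<lambda>k. mv n U x k * q k"] assms(3)
    by simp
  then show ?thesis by (simp add: algebra_simps)
qed

lemma cv_quadratic:
  "cv P e (\<lambda>p. x * \<phi> p + y * \<psi> p) (\<lambda>p. x * \<phi> p + y * \<psi> p)
    = x\<^sup>2 * cv P e \<phi> \<phi> + 2 * x * y * cv P e \<phi> \<psi> + y\<^sup>2 * cv P e \<psi> \<psi>"
proof -
  have "sm P e (\<lambda>p. (x * \<phi> p + y * \<psi> p) * (x * \<phi> p + y * \<psi> p))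
    = sm P e (\<lambda>p. x\<^sup>2 * (\<phi> p * \<phi> p) + 2 * x * y * (\<phi> p * \<psi> p) + y\<^sup>2 * (\<psi> p * \<psi> p))"
    by (simp add: algebra_simps power2_eq_square)
  also have "\<dots> = x\<^sup>2 * sm P e (\<lambda>p. \<phi> p * \<phi> p) + 2 * x * y * sm P e (\<lambda>p. \<phi> p * \<psi> p)
      + y\<^sup>2 * sm P e (\<lambda>p. \<psi> p * \<psi> p)"
    by (simp only: sm_add sm_cmult)
  finally show ?thesis unfolding cv_def sm_add sm_cmult by (simp add: algebra_simps power2_eq_square)
qed

lemma le_if_le_add_small:
  assumes "\<And>t. 0 < t \<Longrightarrow> t \<le> t0 \<Longrightarrow> x \<le> y + C * t" "0 < t0"
  shows "x \<le> (y::real)"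
proof (rule field_le_epsilon)
  fix e :: real assume e: "0 < e"
  define t where "t = min t0 (e / (\<bar>C\<bar> + 1))"
  have t: "0 < t" "t \<le> t0" "t \<le> e / (\<bar>C\<bar> + 1)" using e assms(2) by (auto simp: t_def)
  have "C * t \<le> (\<bar>C\<bar> + 1) * t" using t by (intro mult_right_mono) auto
  also have "\<dots> \<le> e" using t(3) by (simp add: pos_le_divide_eq mult.commute)
  finally show "x \<le> y + e" using assms(1)[OF t(1,2)] by linarith
qed

section \<open>Comparison of increments and approximate Gaussian integration by parts\<close>

lemma sum_scaled_diff_square:
  "(\<Sum>k<n. (c * x k - d * y k)\<^sup>2) = c\<^sup>2 * ip n x x - 2 * c * d * ip n x y + d\<^sup>2 * ip n y y"
  by (simp add: ip_def sum_distrib_left power2_eq_square algebra_simps sum.distrib sum_subtractf)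

text \<open>The comparison behind Chevet's inequality. The right side minus the left side is the
  square of \<open>\<alpha> * \<beta> - \<alpha>' * \<beta>'\<close> plus twice
  \<open>(\<alpha> * \<alpha>' - X) * (\<beta> * \<beta>' - Y)\<close>, and both factors of the last
  product are nonnegative by Cauchy-Schwarz.\<close>

lemma tensor_increment:
  "(\<Sum>a<n. \<Sum>b<n. (z a * q b - z' a * q' b)\<^sup>2)
    \<le> (\<Sum>k<n. (nrm n z * q k - nrm n z' * q' k)\<^sup>2) + (\<Sum>k<n. (nrm n q * z k - nrm n q' * z' k)\<^sup>2)"
proof -
  define \<alpha> \<beta> \<alpha>' \<beta>' X Y where "\<alpha> = nrm n z" and "\<beta> = nrm n q" and "\<alpha>' = nrm n z'" and "\<beta>' = nrm n q'"
    and "X = ip n z z'" and "Y = ip n q q'"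
  have sq: "ip n z z = \<alpha> * \<alpha>" "ip n q q = \<beta> * \<beta>" "ip n z' z' = \<alpha>' * \<alpha>'" "ip n q' q' = \<beta>' * \<beta>'"
    by (simp_all add: \<alpha>_def \<beta>_def \<alpha>'_def \<beta>'_def nrm_square)
  have "(\<Sum>a<n. \<Sum>b<n. (z a * q b - z' a * q' b)\<^sup>2)
    = (\<Sum>a<n. \<Sum>b<n. (z a * z a) * (q b * q b) - 2 * ((z a * z' a) * (q b * q' b)) + (z' a * z' a) * (q' b * q' b))"
    by (simp add: power2_eq_square algebra_simps)
  also have "\<dots> = ip n z z * ip n q q - 2 * (X * Y) + ip n z' z' * ip n q' q'"
  proof -
    have p: "ip n x x' * ip n y y' = (\<Sum>a<n. \<Sum>b<n. (x a * x' a) * (y b * y' b))" for x x' y y'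
      by (simp only: ip_def sum_product)
    show ?thesis unfolding X_def Y_def p by (simp only: sum.distrib sum_subtractf sum_distrib_left)
  qed
  finally have L: "(\<Sum>a<n. \<Sum>b<n. (z a * q b - z' a * q' b)\<^sup>2) = (\<alpha> * \<alpha>) * (\<beta> * \<beta>) - 2 * (X * Y) + (\<alpha>' * \<alpha>') * (\<beta>' * \<beta>')"
    unfolding sq .
  have "0 \<le> (\<alpha> * \<alpha>' - X) * (\<beta> * \<beta>' - Y)"
    using ip_cauchy_schwarz[of n z z'] ip_cauchy_schwarz[of n q q']
    unfolding \<alpha>_def \<beta>_def \<alpha>'_def \<beta>'_def X_def Y_def by (intro mult_nonneg_nonneg) linarith+
  moreover have "0 \<le> (\<alpha> * \<beta> - \<alpha>' * \<beta>')\<^sup>2" by simp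
  moreover have "(\<Sum>k<n. (nrm n z * q k - nrm n z' * q' k)\<^sup>2) = \<alpha>\<^sup>2 * (\<beta> * \<beta>) - 2 * \<alpha> * \<alpha>' * Y + \<alpha>'\<^sup>2 * (\<beta>' * \<beta>')"
    using sum_scaled_diff_square[of "nrm n z" q "nrm n z'" q' n] by (simp only: sq \<alpha>_def \<alpha>'_def \<beta>_def \<beta>'_def Y_def)
  moreover have "(\<Sum>k<n. (nrm n q * z k - nrm n q' * z' k)\<^sup>2) = \<beta>\<^sup>2 * (\<alpha> * \<alpha>) - 2 * \<beta> * \<beta>' * X + \<beta>'\<^sup>2 * (\<alpha>' * \<alpha>')"
    using sum_scaled_diff_square[of "nrm n q" z "nrm n q'" z' n] by (simp only: sq \<alpha>_def \<alpha>'_def \<beta>_def \<beta>'_def X_def)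
  ultimately show ?thesis unfolding L by (simp add: power2_eq_square algebra_simps)
qed

text \<open>Gaussian integration by parts up to discretisation: \<open>avg_eps\<close> for each of
  the \<open>N\<close> signs of a coordinate, then \<open>dif_sm\<close>. The \<open>N\<close>
  errors of order \<open>1 / N\<close>, multiplied by the normalisation \<open>1 / sqrt N\<close>,
  add up to order \<open>1 / sqrt N\<close>.\<close>

lemma ibp_sm:
  fixes w :: "'p \<Rightarrow> real" and n N :: nat and d :: "'p \<Rightarrow> nat \<Rightarrow> real"
  assumes P: "finite P" "P \<noteq> {}" and d: "\<And>p k. p \<in> P \<Longrightarrow> k < n \<Longrightarrow> \<bar>d p k\<bar> \<le> D"
    and \<phi>: "\<And>p k. p \<in> P \<Longrightarrow> k < n \<Longrightarrow> \<bar>\<phi> k p\<bar> \<le> B" and DN: "2 * D / sqrt (real N) \<le> 1/2" and N1: "1 \<le> N"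
  defines "e \<equiv> \<lambda>A p. w p + ip n (d p) (gau N A)"
  shows "\<bar>avg (grid n N) (\<lambda>A. \<Sum>k<n. gau N A k * sm P (e A) (\<phi> k))
    - avg (grid n N) (\<lambda>A. \<Sum>k<n. cv P (e A) (\<phi> k) (\<lambda>p. d p k))\<bar> \<le> real n * (64 * D\<^sup>2 * B) / sqrt (real N)"
proof -
  let ?J = "grid n N" and ?r = "sqrt (real N)"
  have r0: "0 < ?r" and rr: "?r * ?r = real N" using N1 by simp_all
  have coord: "\<bar>avg ?J (\<lambda>A. gau N A k * sm P (e A) (\<phi> k)) - avg ?J (\<lambda>A. cv P (e A) (\<phi> k) (\<lambda>p. d p k))\<bar> \<le> 64 * D\<^sup>2 * B / ?r"
    if k: "k < n" for k
  proof -
    let ?F = "\<lambda>A. sm P (e A) (\<phi> k)" and ?C = "avg ?J (\<lambda>A. cv P (e A) (\<phi> k) (\<lambda>p. d p k))"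
    have "avg ?J (\<lambda>A. gau N A k * ?F A) = (\<Sum>l<N. avg ?J (\<lambda>A. eps (k, l) A * ?F A)) / ?r"
    proof -
      have "gau N A k * ?F A = (1 / ?r) * (\<Sum>l<N. eps (k, l) A * ?F A)" for A
        by (simp add: gau_def flip: sum_distrib_right)
      then show ?thesis by (simp only: avg_cmult avg_sum) simp
    qed
    also have "(\<Sum>l<N. avg ?J (\<lambda>A. eps (k, l) A * ?F A)) = (\<Sum>l<N. avg ?J (dif (k, l) ?F))"
      using k by (intro sum.cong refl avg_eps) (auto simp: grid_def)
    finally have "avg ?J (\<lambda>A. gau N A k * ?F A) = (\<Sum>l<N. avg ?J (dif (k, l) ?F)) / ?r" .
    moreover have "?C = (\<Sum>l<N. ?C / ?r) / ?r" using r0 rr by (simp add: field_simps)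
    ultimately have "avg ?J (\<lambda>A. gau N A k * ?F A) - ?C = (\<Sum>l<N. avg ?J (dif (k, l) ?F) - ?C / ?r) / ?r"
      by (simp only: sum_subtractf diff_divide_distrib)
    also have "\<bar>\<dots>\<bar> \<le> (\<Sum>l<N. 64 * D\<^sup>2 * B / real N) / ?r"
      unfolding abs_divide abs_of_pos[OF r0]
    proof (intro divide_right_mono order_trans[OF sum_abs] sum_mono)
      fix l assume l: "l \<in> {..<N}"
      have "\<bar>avg ?J (\<lambda>A. dif (k, l) ?F A - cv P (e A) (\<phi> k) (\<lambda>p. d p k) / ?r)\<bar> \<le> 64 * D\<^sup>2 * B / real N"
        unfolding e_def using k l d \<phi>
        by (intro avg_abs_le finite_grid dif_sm P DN) (auto simp: grid_def)
      moreover have "avg ?J (\<lambda>A. dif (k, l) ?F A - cv P (e A) (\<phi> k) (\<lambda>p. d p k) / ?r) = avg ?J (dif (k, l) ?F) - ?C / ?r"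
        using avg_cmult[of ?J "1 / ?r" "\<lambda>A. cv P (e A) (\<phi> k) (\<lambda>p. d p k)"] by (simp add: avg_diff)
      ultimately show "\<bar>avg ?J (dif (k, l) ?F) - ?C / ?r\<bar> \<le> 64 * D\<^sup>2 * B / real N" by simp
    qed (use r0 in simp)
    also have "\<dots> = 64 * D\<^sup>2 * B / ?r" using N1 by simp
    finally show ?thesis .
  qed
  have "avg ?J (\<lambda>A. \<Sum>k<n. gau N A k * sm P (e A) (\<phi> k)) - avg ?J (\<lambda>A. \<Sum>k<n. cv P (e A) (\<phi> k) (\<lambda>p. d p k))
    = (\<Sum>k<n. avg ?J (\<lambda>A. gau N A k * sm P (e A) (\<phi> k)) - avg ?J (\<lambda>A. cv P (e A) (\<phi> k) (\<lambda>p. d p k)))"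
    by (simp add: avg_sum sum_subtractf)
  also have "\<bar>\<dots>\<bar> \<le> (\<Sum>k<n. 64 * D\<^sup>2 * B / ?r)"
    by (intro order_trans[OF sum_abs] sum_mono coord) auto
  finally show ?thesis by simp
qed

section \<open>The interpolation argument for Chevet's inequality\<close>

lemma gau_abs_le: "\<bar>gau N A b\<bar> \<le> sqrt (real N)"
proof -
  have "\<bar>\<Sum>l<N. eps (b, l) A\<bar> \<le> (\<Sum>l<N. 1)" by (intro order_trans[OF sum_abs] sum_mono) simp
  then have "\<bar>gau N A b\<bar> \<le> real N / sqrt (real N)" unfolding gau_def abs_divide
    by (simp add: divide_right_mono)
  then show ?thesis by (simp add: real_div_sqrt)
qed

lemma nrm_gau_le: "nrm n (gau N A) \<le> sqrt (real n * real N)"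
proof -
  have "ip n (gau N A) (gau N A) \<le> (\<Sum>b<n. real N)"
    unfolding ip_def
  proof (rule sum_mono)
    fix b
    have "(gau N A b)\<^sup>2 \<le> (sqrt (real N))\<^sup>2" using gau_abs_le by (metis abs_ge_zero power2_abs power_mono)
    then show "gau N A b * gau N A b \<le> real N" by (simp add: power2_eq_square)
  qed
  then show ?thesis by (simp add: nrm_def real_sqrt_le_mono)
qed

text \<open>The index set is a set of pairs, not a product: two families of inequalities will have
  to hold for one and the same orthogonal matrix, and \<open>P\<close> will be a union of two
  products.\<close>

locale pair_process =
  fixes n N :: nat and P :: "((nat \<Rightarrow> real) \<times> (nat \<Rightarrow> real)) set" and R :: real
  assumes P_finite: "finite P" and P_nonempty: "P \<noteq> {}"
    and pR: "\<And>p q. (p, q) \<in> P \<Longrightarrow> nrm n p \<le> R" and qR: "\<And>p q. (p, q) \<in> P \<Longrightarrow> nrm n q \<le> R"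
    and n2: "2 \<le> n" and N1: "1 \<le> N"
begin

abbreviation "aa F \<equiv> avg (grid n N) (\<lambda>A. avg (grid n N) (\<lambda>B. F A B))"

definition cpl :: "(nat \<times> nat \<Rightarrow> real) \<Rightarrow> (nat \<Rightarrow> real) \<times> (nat \<Rightarrow> real) \<Rightarrow> real"
  where "cpl U pq = ip n (mv n U (fst pq)) (snd pq)"

definition nse :: "(nat \<times> nat) set \<Rightarrow> (nat \<times> nat) set \<Rightarrow> (nat \<Rightarrow> real) \<times> (nat \<Rightarrow> real) \<Rightarrow> real"
  where "nse A B pq = nrm n (fst pq) * ip n (snd pq) (gau N A) + nrm n (snd pq) * ip n (fst pq) (gau N B)"

text \<open>Interpolates between the bilinear form of \<open>U\<close> (at \<open>\<sigma> = 0\<close>) and the Gaussian-like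
  process of Chevet's inequality (at \<open>s = 0\<close>).\<close>

definition ex :: "real \<Rightarrow> real \<Rightarrow> (nat \<times> nat \<Rightarrow> real) \<Rightarrow> (nat \<times> nat) set \<Rightarrow> (nat \<times> nat) set \<Rightarrow> (nat \<Rightarrow> real) \<times> (nat \<Rightarrow> real) \<Rightarrow> real"
  where "ex s \<sigma> U A B pq = s * cpl U pq + \<sigma> * nse A B pq"

definition pot :: "real \<Rightarrow> real \<Rightarrow> (nat \<times> nat \<Rightarrow> real) \<Rightarrow> real"
  where "pot s \<sigma> U = aa (\<lambda>A B. lse P (ex s \<sigma> U A B))"

lemma aa_simps:
  "aa (\<lambda>A B. F A B + G A B) = aa F + aa G"
  "aa (\<lambda>A B. F A B - G A B) = aa F - aa G"
  "aa (\<lambda>A B. c * F A B) = c * aa F"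
  "aa (\<lambda>A B. c) = c"
  by (simp_all add: avg_add avg_diff avg_cmult avg_const)

lemma aa_mono: "(\<And>A B. F A B \<le> G A B) \<Longrightarrow> aa F \<le> aa G"
  by (intro avg_mono) auto

lemma R_nonneg: "0 \<le> R"
  using P_nonempty pR by (metis ex_in_conv nrm_nonneg order_trans surj_pair)

lemma cpl_abs_le:
  assumes "U \<in> orth n" "pq \<in> P"
  shows "\<bar>cpl U pq\<bar> \<le> R * R"
proof -
  have "\<bar>cpl U pq\<bar> \<le> nrm n (mv n U (fst pq)) * nrm n (snd pq)" unfolding cpl_def by (rule ip_cauchy_schwarz)
  also have "\<dots> \<le> R * R" unfolding orth_nrm[OF assms(1)]
    using assms(2) pR qR R_nonneg by (intro mult_mono) (auto simp: prod_eq_iff, metis prod.collapse, metis prod.collapse)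
  finally show ?thesis .
qed

lemma min_exists:
  obtains U where "U \<in> orth n" "\<And>V. V \<in> orth n \<Longrightarrow> pot s \<sigma> U \<le> pot s \<sigma> V"
proof (rule attains_min_bounded[OF closed_orth])
  show "orth n \<noteq> {}" using scalar_orth[of 1 n] by auto
  show "\<bar>U i\<bar> \<le> 1" if "U \<in> orth n" for U i by (rule orth_abs_le[OF that])
  show "continuous_on (orth n) (pot s \<sigma>)"
    unfolding pot_def[abs_def] ex_def cpl_def ip_def mv_def
    by (intro continuous_intros P_finite P_nonempty continuous_on_subset[OF continuous_on_product_coordinates]) auto
qed (use that in blast)

text \<open>Rotations by opposite angles in the \<open>(a, b)\<close>-plane cancel the first-order term \<open>Y\<close>.\<close>

lemma rotation_second_order:
  assumes U: "U \<in> orth n" and mini: "\<And>V. V \<in> orth n \<Longrightarrow> pot s \<sigma> U \<le> pot s \<sigma> V"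
    and ab: "a < n" "b < n" "a \<noteq> b" and s: "0 \<le> s"
  defines "X \<equiv> \<lambda>pq. mv n U (fst pq) a * snd pq a + mv n U (fst pq) b * snd pq b"
  defines "Y \<equiv> \<lambda>pq. mv n U (fst pq) a * snd pq b - mv n U (fst pq) b * snd pq a"
  shows "s * aa (\<lambda>A B. sm P (ex s \<sigma> U A B) X) \<le> s\<^sup>2 * aa (\<lambda>A B. cv P (ex s \<sigma> U A B) Y Y)"
proof (cases "s = 0")
  case False
  then have s0: "0 < s" using s by simp
  define u v w where "u = aa (\<lambda>A B. sm P (ex s \<sigma> U A B) X)"
    and "v = aa (\<lambda>A B. cv P (ex s \<sigma> U A B) Y Y)" and "w = aa (\<lambda>A B. cv P (ex s \<sigma> U A B) X X)"
  have v0: "0 \<le> v" unfolding v_def by (intro avg_ge finite_grid cv_self_nonneg P_finite P_nonempty)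
  have coord: "\<bar>mv n U (fst pq) i * snd pq j\<bar> \<le> R * R" if "pq \<in> P" "i < n" "j < n" for pq i j
  proof -
    have "\<bar>mv n U (fst pq) i\<bar> \<le> R"
      using abs_coord_le_nrm[OF that(2), of "mv n U (fst pq)"] orth_nrm[OF U] pR that(1)
      by (metis order_trans prod.collapse)
    moreover have "\<bar>snd pq j\<bar> \<le> R"
      using abs_coord_le_nrm[OF that(3), of "snd pq"] qR that(1) by (metis order_trans prod.collapse)
    ultimately show ?thesis unfolding abs_mult using R_nonneg by (intro mult_mono) auto
  qed
  have Xb: "\<bar>X pq\<bar> \<le> 2 * (R * R)" and Yb: "\<bar>Y pq\<bar> \<le> 2 * (R * R)" if "pq \<in> P" for pq
    using coord[OF that ab(1) ab(1)] coord[OF that ab(2) ab(2)] coord[OF that ab(1) ab(2)] coord[OF that ab(2) ab(1)]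
    unfolding X_def Y_def by linarith+
  define K where "K = 8 * s * (R * R)"
  have K_nonneg: "0 \<le> K" using s R_nonneg by (simp add: K_def)
  \<comment> \<open>Minimality against a single rotation, combined with the second-order upper bound
    for the potential. When \<open>|c - 1|\<close> and \<open>|d|\<close> are at most
    \<open>2 * t\<close>, the exponent changes by at most \<open>K * t\<close>.\<close>
  have half: "0 \<le> s * (c - 1) * u + s * d * aa (\<lambda>A B. sm P (ex s \<sigma> U A B) Y)
      + (1/2) * ((s * (c - 1))\<^sup>2 * w + 2 * (s * (c - 1)) * (s * d) * aa (\<lambda>A B. cv P (ex s \<sigma> U A B) X Y)
          + (s * d)\<^sup>2 * v) + 8 * (K * t) ^ 3"
    if cd: "c * c + d * d = 1" "\<bar>c - 1\<bar> \<le> 2 * t" "\<bar>d\<bar> \<le> 2 * t" and t: "0 < t" "K * t \<le> 1/2" for c d t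
  proof -
    let ?D = "\<lambda>pq. s * (c - 1) * X pq + s * d * Y pq"
    have exeq: "ex s \<sigma> (givens c d a b U) A B pq = ex s \<sigma> U A B pq + ?D pq" for A B pq
      by (simp add: ex_def cpl_def ip_givens[OF ab] X_def Y_def algebra_simps)
    have D: "\<bar>?D pq\<bar> \<le> K * t" if "pq \<in> P" for pq
    proof -
      have "\<bar>?D pq\<bar> \<le> s * (\<bar>c - 1\<bar> * \<bar>X pq\<bar>) + s * (\<bar>d\<bar> * \<bar>Y pq\<bar>)"
        using s by (intro order_trans[OF abs_triangle_ineq]) (simp add: abs_mult mult.assoc)
      also have "\<dots> \<le> s * (2 * t * (2 * (R * R))) + s * (2 * t * (2 * (R * R)))"
        using cd t s Xb[OF that] Yb[OF that] by (intro add_mono mult_left_mono mult_mono) auto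
      also have "\<dots> = K * t" by (simp add: K_def)
      finally show ?thesis .
    qed
    have "pot s \<sigma> U \<le> pot s \<sigma> (givens c d a b U)"
      by (intro mini givens_orth U ab cd)
    also have "\<dots> \<le> aa (\<lambda>A B. lse P (ex s \<sigma> U A B) + sm P (ex s \<sigma> U A B) ?D + cv P (ex s \<sigma> U A B) ?D ?D / 2 + 8 * (K * t) ^ 3)"
      unfolding pot_def exeq by (intro aa_mono lse_le_quadratic P_finite P_nonempty D t)
    also have "\<dots> = aa (\<lambda>A B. lse P (ex s \<sigma> U A B) + s * (c - 1) * sm P (ex s \<sigma> U A B) X + s * d * sm P (ex s \<sigma> U A B) Y
       + (1/2) * ((s * (c - 1))\<^sup>2 * cv P (ex s \<sigma> U A B) X X + 2 * (s * (c - 1)) * (s * d) * cv P (ex s \<sigma> U A B) X Y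
          + (s * d)\<^sup>2 * cv P (ex s \<sigma> U A B) Y Y) + 8 * (K * t) ^ 3)"
      unfolding cv_quadratic sm_add sm_cmult by (simp add: add.assoc)
    also have "\<dots> = pot s \<sigma> U + s * (c - 1) * u + s * d * aa (\<lambda>A B. sm P (ex s \<sigma> U A B) Y)
       + (1/2) * ((s * (c - 1))\<^sup>2 * w + 2 * (s * (c - 1)) * (s * d) * aa (\<lambda>A B. cv P (ex s \<sigma> U A B) X Y)
          + (s * d)\<^sup>2 * v) + 8 * (K * t) ^ 3"
      unfolding aa_simps pot_def u_def v_def w_def by simp
    finally show ?thesis by linarith
  qed
  define t0 where "t0 = min 1 (1 / (2 * (K + 1)))"
  have t00: "0 < t0" using K_nonneg by (simp add: t0_def)
  have "s * u \<le> s\<^sup>2 * v + (s\<^sup>2 * \<bar>w\<bar> + 8 * K ^ 3) * t" if t: "0 < t" "t \<le> t0" for t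
  proof -
    have t1: "t \<le> 1" using t by (simp add: t0_def)
    have "K * t \<le> (K + 1) * t" using t by (simp add: mult_right_mono)
    also have "\<dots> \<le> (K + 1) * (1 / (2 * (K + 1)))" using t K_nonneg by (intro mult_left_mono) (auto simp: t0_def)
    also have "\<dots> = 1/2" using K_nonneg by simp
    finally have Kt: "K * t \<le> 1/2" .
    \<comment> \<open>The rational parametrisation of the circle by the tangent \<open>t\<close> of
      the half angle: \<open>c - 1\<close> is of order \<open>t^2\<close> and \<open>d\<close> of
      order \<open>t\<close>. Adding the inequalities for \<open>d\<close> and \<open>-d\<close> and
      dividing by \<open>4 * t^2 / (1 + t^2)\<close>, only the two wanted terms survive as
      \<open>t\<close> tends to 0.\<close>
    define c d where "c = (1 - t\<^sup>2) / (1 + t\<^sup>2)" and "d = 2 * t / (1 + t\<^sup>2)"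
    have q: "1 + t\<^sup>2 > 0" by (simp add: add_pos_nonneg)
    have "c * c + d * d = ((1 - t\<^sup>2) * (1 - t\<^sup>2) + (2 * t) * (2 * t)) / ((1 + t\<^sup>2) * (1 + t\<^sup>2))"
      by (simp add: c_def d_def add_divide_distrib)
    also have "(1 - t\<^sup>2) * (1 - t\<^sup>2) + (2 * t) * (2 * t) = (1 + t\<^sup>2) * (1 + t\<^sup>2)"
      by (simp add: algebra_simps power2_eq_square)
    finally have cd1: "c * c + d * d = 1" using q by simp
    have c1: "c - 1 = - (2 * t\<^sup>2) / (1 + t\<^sup>2)" using q by (simp add: c_def field_simps)
    have dt: "\<bar>d\<bar> \<le> 2 * t" using t q by (simp add: d_def divide_le_eq)
    have "\<bar>c - 1\<bar> = 2 * t\<^sup>2 / (1 + t\<^sup>2)" unfolding c1 using q by simp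
    also have "\<dots> \<le> 2 * t\<^sup>2" using q by (simp add: divide_le_eq mult_le_cancel_left1)
    also have "\<dots> \<le> 2 * t" using t t1 by (simp add: power2_eq_square mult_le_cancel_left1)
    finally have ct: "\<bar>c - 1\<bar> \<le> 2 * t" .
    note h1 = half[OF cd1 ct dt t(1) Kt]
    have "c * c + - d * - d = 1" "\<bar>- d\<bar> \<le> 2 * t" using cd1 dt by simp_all
    note h2 = half[OF this(1) ct this(2) t(1) Kt]
    have "0 \<le> 2 * (s * (c - 1) * u) + ((s * (c - 1))\<^sup>2 * w + (s * d)\<^sup>2 * v) + 16 * (K * t) ^ 3"
    proof -
      have "0 \<le> 2 * x + (p + r) + 16 * e"
        if "0 \<le> x + y + 1/2 * (p + z + r) + 8 * e" "0 \<le> x + - y + 1/2 * (p + - z + r) + 8 * e" for x y p z r e :: real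
        using that by (simp add: field_simps)
      from this[OF h1 h2[unfolded mult_minus_right mult_minus_left power2_minus]] show ?thesis .
    qed
    then have "0 \<le> 2 * s * (c - 1) * u + s\<^sup>2 * (c - 1)\<^sup>2 * w + s\<^sup>2 * d\<^sup>2 * v + 16 * (K * t) ^ 3"
      by (simp add: power_mult_distrib)
    also have "\<dots> = (4 * t\<^sup>2 / (1 + t\<^sup>2)) * (- (s * u) + s\<^sup>2 * (t\<^sup>2 / (1 + t\<^sup>2)) * w + s\<^sup>2 * v / (1 + t\<^sup>2)
       + 4 * K ^ 3 * t * (1 + t\<^sup>2))"
      unfolding c1 d_def using q t(1)
      by (simp add: divide_simps) (simp add: algebra_simps power2_eq_square power3_eq_cube power4_eq_xxxx)
    finally have "0 \<le> - (s * u) + s\<^sup>2 * (t\<^sup>2 / (1 + t\<^sup>2)) * w + s\<^sup>2 * v / (1 + t\<^sup>2) + 4 * K ^ 3 * t * (1 + t\<^sup>2)"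
      using q t(1) by (simp only: zero_le_mult_iff) (smt (verit) divide_pos_pos zero_less_power)
    moreover have "s\<^sup>2 * v / (1 + t\<^sup>2) \<le> s\<^sup>2 * v"
      using divide_left_mono[of 1 "1 + t\<^sup>2" "s\<^sup>2 * v"] q v0 by simp
    moreover have "s\<^sup>2 * (t\<^sup>2 / (1 + t\<^sup>2)) * w \<le> s\<^sup>2 * \<bar>w\<bar> * t"
    proof -
      have "t\<^sup>2 / (1 + t\<^sup>2) \<le> t" using q t t1 by (simp add: divide_le_eq power2_eq_square mult_le_cancel_left1) (smt (verit) mult_nonneg_nonneg mult_le_one mult_left_le)
      then have "s\<^sup>2 * (t\<^sup>2 / (1 + t\<^sup>2)) * \<bar>w\<bar> \<le> s\<^sup>2 * t * \<bar>w\<bar>" by (intro mult_right_mono mult_left_mono) auto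
      moreover have "s\<^sup>2 * (t\<^sup>2 / (1 + t\<^sup>2)) * w \<le> s\<^sup>2 * (t\<^sup>2 / (1 + t\<^sup>2)) * \<bar>w\<bar>"
        using q by (intro mult_left_mono) auto
      ultimately show ?thesis by (simp add: ac_simps)
    qed
    ultimately have "s * u \<le> s\<^sup>2 * v + s\<^sup>2 * \<bar>w\<bar> * t + 4 * K ^ 3 * t * (1 + t\<^sup>2)" by linarith
    also have "4 * K ^ 3 * t * (1 + t\<^sup>2) \<le> 4 * K ^ 3 * t * 2"
      using K_nonneg t t1 by (intro mult_left_mono) (auto simp: power_le_one)
    finally show ?thesis by (simp add: algebra_simps)
  qed
  then have "s * u \<le> s\<^sup>2 * v" by (rule le_if_le_add_small[OF _ t00])
  then show ?thesis by (simp add: u_def v_def)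
qed simp

text \<open>The trace of the softmax covariance of the coefficient vectors with which
  \<open>nse\<close> depends on its two random vectors. It is the common scale on which the
  derivatives of \<open>pot\<close> in \<open>s\<close> and in \<open>\<sigma>\<close> are
  compared.\<close>

definition nvar :: "real \<Rightarrow> real \<Rightarrow> (nat \<times> nat \<Rightarrow> real) \<Rightarrow> (nat \<times> nat) set \<Rightarrow> (nat \<times> nat) set \<Rightarrow> real"
  where "nvar s \<sigma> U A B =
    (\<Sum>k<n. cv P (ex s \<sigma> U A B) (\<lambda>pq. nrm n (fst pq) * snd pq k) (\<lambda>pq. nrm n (fst pq) * snd pq k)) +
    (\<Sum>k<n. cv P (ex s \<sigma> U A B) (\<lambda>pq. nrm n (snd pq) * fst pq k) (\<lambda>pq. nrm n (snd pq) * fst pq k))"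

lemma nvar_nonneg: "0 \<le> nvar s \<sigma> U A B"
  unfolding nvar_def by (intro add_nonneg_nonneg sum_nonneg cv_self_nonneg P_finite P_nonempty)

text \<open>The second-order inequalities are summed over all ordered pairs of distinct coordinates.
  The terms \<open>X\<close> add up to \<open>2 * (n - 1)\<close> times the bilinear form; the terms
  \<open>Y\<close> are antisymmetrised tensors, whose variances sum to at most
  \<open>4 * nvar\<close> by \<open>tensor_increment\<close>. The left side is \<open>n - 1\<close>
  times the derivative of \<open>pot\<close> in \<open>s\<close> at fixed \<open>U\<close>.\<close>

lemma minimizer_derivative:
  assumes U: "U \<in> orth n" and mini: "\<And>V. V \<in> orth n \<Longrightarrow> pot s \<sigma> U \<le> pot s \<sigma> V" and s: "0 < s"
  shows "(real n - 1) * aa (\<lambda>A B. sm P (ex s \<sigma> U A B) (cpl U)) \<le> 2 * s * aa (nvar s \<sigma> U)"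
proof -
  let ?z = "\<lambda>pq. mv n U (fst pq)"
  let ?X = "\<lambda>a b pq. ?z pq a * snd pq a + ?z pq b * snd pq b"
  let ?Y = "\<lambda>a b pq. ?z pq a * snd pq b - ?z pq b * snd pq a"
  let ?e = "ex s \<sigma> U"
  have pair: "(if a = b then 0 else aa (\<lambda>A B. sm P (?e A B) (?X a b))) \<le> s * aa (\<lambda>A B. cv P (?e A B) (?Y a b) (?Y a b))"
    if "a < n" "b < n" for a b
  proof (cases "a = b")
    case True
    then show ?thesis using s by (simp add: cv_def sm_const P_finite P_nonempty avg_const)
  next
    case False
    have "s * aa (\<lambda>A B. sm P (?e A B) (?X a b)) \<le> s * (s * aa (\<lambda>A B. cv P (?e A B) (?Y a b) (?Y a b)))"
      using rotation_second_order[OF U mini that False] s by (simp add: power2_eq_square mult.assoc)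
    then show ?thesis using False s by simp
  qed
  have "(\<Sum>a<n. \<Sum>b<n. (if a = b then 0 else aa (\<lambda>A B. sm P (?e A B) (?X a b))))
    = (\<Sum>a<n. \<Sum>b<n. aa (\<lambda>A B. sm P (?e A B) (?X a b)) - (if a = b then 2 * aa (\<lambda>A B. sm P (?e A B) (\<lambda>pq. ?z pq a * snd pq a)) else 0))"
    by (intro sum.cong refl) (simp add: sm_cmult aa_simps flip: mult_2)
  also have "\<dots> = (\<Sum>a<n. \<Sum>b<n. aa (\<lambda>A B. sm P (?e A B) (?X a b))) - 2 * (\<Sum>a<n. aa (\<lambda>A B. sm P (?e A B) (\<lambda>pq. ?z pq a * snd pq a)))"
    by (simp add: sum_subtractf sum_distrib_left)
  also have "(\<Sum>a<n. aa (\<lambda>A B. sm P (?e A B) (\<lambda>pq. ?z pq a * snd pq a))) = aa (\<lambda>A B. sm P (?e A B) (cpl U))"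
    by (simp add: cpl_def[abs_def] ip_def sm_sum avg_sum)
  also have "(\<Sum>a<n. \<Sum>b<n. aa (\<lambda>A B. sm P (?e A B) (?X a b))) = 2 * real n * aa (\<lambda>A B. sm P (?e A B) (cpl U))"
    by (simp add: cpl_def[abs_def] ip_def sm_sum sm_add avg_add avg_sum sum.distrib sum_distrib_left mult.assoc)
  finally have lhs: "(\<Sum>a<n. \<Sum>b<n. (if a = b then 0 else aa (\<lambda>A B. sm P (?e A B) (?X a b))))
    = 2 * ((real n - 1) * aa (\<lambda>A B. sm P (?e A B) (cpl U)))" by (simp add: algebra_simps)
  have var: "(\<Sum>a<n. \<Sum>b<n. cv P (?e A B) (?Y a b) (?Y a b)) \<le> 4 * nvar s \<sigma> U A B" for A B
  proof -
    let ?S = "\<lambda>F. sm P (?e A B) (\<lambda>x. sm P (?e A B) (\<lambda>y. F x y))"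
    have "(\<Sum>a<n. \<Sum>b<n. cv P (?e A B) (?Y a b) (?Y a b))
      = ?S (\<lambda>x y :: (nat \<Rightarrow> real) \<times> (nat \<Rightarrow> real). \<Sum>a<n. \<Sum>b<n. (?Y a b x - ?Y a b y) * (?Y a b x - ?Y a b y)) / 2"
      by (simp add: cv_double[OF P_finite P_nonempty] sm_sum sum_divide_distrib)
    also have "\<dots> \<le> ?S (\<lambda>x y :: (nat \<Rightarrow> real) \<times> (nat \<Rightarrow> real). 4 * ((\<Sum>k<n. (nrm n (fst x) * snd x k - nrm n (fst y) * snd y k) * (nrm n (fst x) * snd x k - nrm n (fst y) * snd y k))
         + (\<Sum>k<n. (nrm n (snd x) * fst x k - nrm n (snd y) * fst y k) * (nrm n (snd x) * fst x k - nrm n (snd y) * fst y k)))) / 2"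
    proof (intro divide_right_mono sm_mono)
      fix x y :: "(nat \<Rightarrow> real) \<times> (nat \<Rightarrow> real)"
      let ?T = "\<lambda>a b. ?z x a * snd x b - ?z y a * snd y b"
      have "(?Y a b x - ?Y a b y) * (?Y a b x - ?Y a b y) \<le> 2 * (?T a b)\<^sup>2 + 2 * (?T b a)\<^sup>2" for a b
      proof -
        have "(?Y a b x - ?Y a b y) * (?Y a b x - ?Y a b y) = (?T a b - ?T b a)\<^sup>2"
          by (simp add: power2_eq_square algebra_simps)
        moreover have "(\<alpha> - \<beta>)\<^sup>2 \<le> 2 * \<alpha>\<^sup>2 + 2 * \<beta>\<^sup>2" for \<alpha> \<beta> :: real
          using zero_le_power2[of "\<alpha> + \<beta>"] by (simp add: power2_sum power2_diff)
        ultimately show ?thesis by simp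
      qed
      then have "(\<Sum>a<n. \<Sum>b<n. (?Y a b x - ?Y a b y) * (?Y a b x - ?Y a b y))
        \<le> (\<Sum>a<n. \<Sum>b<n. 2 * (?T a b)\<^sup>2 + 2 * (?T b a)\<^sup>2)" by (intro sum_mono)
      also have "\<dots> = 2 * (\<Sum>a<n. \<Sum>b<n. (?T a b)\<^sup>2) + 2 * (\<Sum>a<n. \<Sum>b<n. (?T b a)\<^sup>2)"
        by (simp only: sum.distrib sum_distrib_left)
      also have "(\<Sum>a<n. \<Sum>b<n. (?T b a)\<^sup>2) = (\<Sum>a<n. \<Sum>b<n. (?T a b)\<^sup>2)" by (rule sum.swap)
      also have "(\<Sum>a<n. \<Sum>b<n. (?T a b)\<^sup>2)
        \<le> (\<Sum>k<n. (nrm n (?z x) * snd x k - nrm n (?z y) * snd y k)\<^sup>2)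
          + (\<Sum>k<n. (nrm n (snd x) * ?z x k - nrm n (snd y) * ?z y k)\<^sup>2)"
        by (rule tensor_increment)
      also have "(\<Sum>k<n. (nrm n (snd x) * ?z x k - nrm n (snd y) * ?z y k)\<^sup>2)
        = (\<Sum>k<n. (nrm n (snd x) * fst x k - nrm n (snd y) * fst y k)\<^sup>2)"
        unfolding sum_scaled_diff_square orth_ip[OF U] ..
      finally show "(\<Sum>a<n. \<Sum>b<n. (?Y a b x - ?Y a b y) * (?Y a b x - ?Y a b y))
        \<le> 4 * ((\<Sum>k<n. (nrm n (fst x) * snd x k - nrm n (fst y) * snd y k) * (nrm n (fst x) * snd x k - nrm n (fst y) * snd y k))
         + (\<Sum>k<n. (nrm n (snd x) * fst x k - nrm n (snd y) * fst y k) * (nrm n (snd x) * fst x k - nrm n (snd y) * fst y k)))"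
        by (simp add: orth_nrm[OF U] power2_eq_square)
    qed simp
    also have "\<dots> = 4 * nvar s \<sigma> U A B"
      by (simp add: nvar_def cv_double[OF P_finite P_nonempty] sm_cmult sm_add sm_sum flip: sum_divide_distrib)
    finally show ?thesis .
  qed
  have "2 * ((real n - 1) * aa (\<lambda>A B. sm P (?e A B) (cpl U)))
     \<le> (\<Sum>a<n. \<Sum>b<n. s * aa (\<lambda>A B. cv P (?e A B) (?Y a b) (?Y a b)))"
    unfolding lhs[symmetric] by (intro sum_mono pair) auto
  also have "\<dots> = s * aa (\<lambda>A B. \<Sum>a<n. \<Sum>b<n. cv P (?e A B) (?Y a b) (?Y a b))"
    by (simp only: avg_sum sum_distrib_left)
  also have "\<dots> \<le> s * aa (\<lambda>A B. 4 * nvar s \<sigma> U A B)"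
    using s by (intro mult_left_mono aa_mono var) auto
  finally show ?thesis by (simp add: aa_simps)
qed

text \<open>The right side is the derivative of \<open>pot\<close> in \<open>\<sigma>\<close>;
  integration by parts in each of the two random vectors produces \<open>\<sigma>\<close> times the
  variance.\<close>

lemma noise_derivative:
  assumes \<sigma>: "0 \<le> \<sigma>" "\<sigma> \<le> 1" and N: "4 * R\<^sup>2 \<le> sqrt (real N)"
  shows "\<sigma> * aa (nvar s \<sigma> U) - 128 * real n * R ^ 6 / sqrt (real N) \<le> aa (\<lambda>A B. sm P (ex s \<sigma> U A B) (nse A B))"
proof -
  let ?J = "grid n N" and ?e = "ex s \<sigma> U"
  let ?p = "\<lambda>k pq. nrm n (fst pq) * snd pq k" and ?q = "\<lambda>k pq. nrm n (snd pq) * fst pq k"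
  let ?E = "real n * (64 * (R\<^sup>2)\<^sup>2 * R\<^sup>2) / sqrt (real N)"
  have r0: "0 < sqrt (real N)" using N1 by simp
  have bp: "\<bar>?p k pq\<bar> \<le> R\<^sup>2" and bq: "\<bar>?q k pq\<bar> \<le> R\<^sup>2" if "pq \<in> P" "k < n" for k pq
  proof -
    have n: "nrm n (fst pq) \<le> R" "nrm n (snd pq) \<le> R" using that(1) pR qR by (metis prod.collapse)+
    have "\<bar>fst pq k\<bar> \<le> R" "\<bar>snd pq k\<bar> \<le> R"
      using abs_coord_le_nrm[OF that(2), of "fst pq"] abs_coord_le_nrm[OF that(2), of "snd pq"] n by linarith+
    then show "\<bar>?p k pq\<bar> \<le> R\<^sup>2" "\<bar>?q k pq\<bar> \<le> R\<^sup>2"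
      unfolding abs_mult power2_eq_square using n R_nonneg by (auto intro!: mult_mono)
  qed
  have RN: "2 * R\<^sup>2 / sqrt (real N) \<le> 1/2" using N r0 by (simp add: divide_le_eq)
  have mul: "\<bar>\<sigma> * x\<bar> \<le> R\<^sup>2" if "\<bar>x\<bar> \<le> R\<^sup>2" for x
    using mult_mono[of \<sigma> 1 "\<bar>x\<bar>" "R\<^sup>2"] that \<sigma> by (simp add: abs_mult)
  have first: "\<sigma> * avg ?J (\<lambda>A. \<Sum>k<n. cv P (?e A B) (?p k) (?p k)) - ?E
     \<le> avg ?J (\<lambda>A. sm P (?e A B) (\<lambda>pq. nrm n (fst pq) * ip n (snd pq) (gau N A)))" for B
  proof -
    let ?w = "\<lambda>pq. s * cpl U pq + \<sigma> * (nrm n (snd pq) * ip n (fst pq) (gau N B))"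
    have e: "?e A B = (\<lambda>pq. ?w pq + ip n (\<lambda>i. \<sigma> * ?p i pq) (gau N A))" for A
      by (auto simp: ex_def nse_def ip_cmult_left[of n "\<sigma>"] ip_cmult_left distrib_left)
    have "\<bar>avg ?J (\<lambda>A. \<Sum>k<n. gau N A k * sm P (?e A B) (?p k)) - avg ?J (\<lambda>A. \<Sum>k<n. cv P (?e A B) (?p k) (\<lambda>pq. \<sigma> * ?p k pq))\<bar> \<le> ?E"
      unfolding e by (rule ibp_sm[OF P_finite P_nonempty _ _ RN N1]) (use bp mul in auto)
    moreover have "(\<Sum>k<n. gau N A k * sm P (?e A B) (?p k)) = sm P (?e A B) (\<lambda>pq. nrm n (fst pq) * ip n (snd pq) (gau N A))" for A
      by (simp add: ip_def sum_distrib_left flip: sm_sum sm_cmult) (simp add: ac_simps)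
    moreover have "avg ?J (\<lambda>A. \<Sum>k<n. cv P (?e A B) (?p k) (\<lambda>pq. \<sigma> * ?p k pq)) = \<sigma> * avg ?J (\<lambda>A. \<Sum>k<n. cv P (?e A B) (?p k) (?p k))"
      by (simp add: cv_cmult_right flip: avg_cmult sum_distrib_left)
    ultimately show ?thesis by (simp add: abs_le_iff)
  qed
  have second: "\<sigma> * avg ?J (\<lambda>B. \<Sum>k<n. cv P (?e A B) (?q k) (?q k)) - ?E
     \<le> avg ?J (\<lambda>B. sm P (?e A B) (\<lambda>pq. nrm n (snd pq) * ip n (fst pq) (gau N B)))" for A
  proof -
    let ?w = "\<lambda>pq. s * cpl U pq + \<sigma> * (nrm n (fst pq) * ip n (snd pq) (gau N A))"
    have e: "?e A B = (\<lambda>pq. ?w pq + ip n (\<lambda>i. \<sigma> * ?q i pq) (gau N B))" for B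
      by (auto simp: ex_def nse_def ip_cmult_left[of n "\<sigma>"] ip_cmult_left distrib_left)
    have "\<bar>avg ?J (\<lambda>B. \<Sum>k<n. gau N B k * sm P (?e A B) (?q k)) - avg ?J (\<lambda>B. \<Sum>k<n. cv P (?e A B) (?q k) (\<lambda>pq. \<sigma> * ?q k pq))\<bar> \<le> ?E"
      unfolding e by (rule ibp_sm[OF P_finite P_nonempty _ _ RN N1]) (use bq mul in auto)
    moreover have "(\<Sum>k<n. gau N B k * sm P (?e A B) (?q k)) = sm P (?e A B) (\<lambda>pq. nrm n (snd pq) * ip n (fst pq) (gau N B))" for B
      by (simp add: ip_def sum_distrib_left flip: sm_sum sm_cmult) (simp add: ac_simps)
    moreover have "avg ?J (\<lambda>B. \<Sum>k<n. cv P (?e A B) (?q k) (\<lambda>pq. \<sigma> * ?q k pq)) = \<sigma> * avg ?J (\<lambda>B. \<Sum>k<n. cv P (?e A B) (?q k) (?q k))"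
      by (simp add: cv_cmult_right flip: avg_cmult sum_distrib_left)
    ultimately show ?thesis by (simp add: abs_le_iff)
  qed
  have "avg ?J (\<lambda>B. \<sigma> * avg ?J (\<lambda>A. \<Sum>k<n. cv P (?e A B) (?p k) (?p k)) - ?E)
     \<le> avg ?J (\<lambda>B. avg ?J (\<lambda>A. sm P (?e A B) (\<lambda>pq. nrm n (fst pq) * ip n (snd pq) (gau N A))))"
    by (intro avg_mono first)
  then have 1: "\<sigma> * aa (\<lambda>A B. \<Sum>k<n. cv P (?e A B) (?p k) (?p k)) - ?E
     \<le> aa (\<lambda>A B. sm P (?e A B) (\<lambda>pq. nrm n (fst pq) * ip n (snd pq) (gau N A)))"
    by (subst (1 2) avg_swap) (simp only: avg_diff avg_cmult avg_const finite_grid)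
  have "avg ?J (\<lambda>A. \<sigma> * avg ?J (\<lambda>B. \<Sum>k<n. cv P (?e A B) (?q k) (?q k)) - ?E)
     \<le> avg ?J (\<lambda>A. avg ?J (\<lambda>B. sm P (?e A B) (\<lambda>pq. nrm n (snd pq) * ip n (fst pq) (gau N B))))"
    by (intro avg_mono second)
  then have 2: "\<sigma> * aa (\<lambda>A B. \<Sum>k<n. cv P (?e A B) (?q k) (?q k)) - ?E
     \<le> aa (\<lambda>A B. sm P (?e A B) (\<lambda>pq. nrm n (snd pq) * ip n (fst pq) (gau N B)))"
    by (simp only: avg_diff avg_cmult avg_const finite_grid)
  have "aa (\<lambda>A B. sm P (?e A B) (nse A B)) = aa (\<lambda>A B. sm P (?e A B) (\<lambda>pq. nrm n (fst pq) * ip n (snd pq) (gau N A)))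
     + aa (\<lambda>A B. sm P (?e A B) (\<lambda>pq. nrm n (snd pq) * ip n (fst pq) (gau N B)))"
    by (simp only: nse_def[abs_def] sm_add aa_simps)
  moreover have "aa (nvar s \<sigma> U) = aa (\<lambda>A B. \<Sum>k<n. cv P (?e A B) (?p k) (?p k)) + aa (\<lambda>A B. \<Sum>k<n. cv P (?e A B) (?q k) (?q k))"
    by (simp only: nvar_def[abs_def] aa_simps)
  moreover have "128 * real n * R ^ 6 / sqrt (real N) = ?E + ?E" by (simp add: eval_nat_numeral)
  moreover have "a + b - (E + E) \<le> x + y" if "a - E \<le> x" "b - E \<le> y" for a b x y E :: real
    using that by linarith
  ultimately show ?thesis using 1 2 by (simp only: distrib_left)
qed

lemma nse_abs_le:
  assumes "pq \<in> P"
  shows "\<bar>nse A B pq\<bar> \<le> 2 * R\<^sup>2 * sqrt (real n * real N)"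
proof -
  have n: "nrm n (fst pq) \<le> R" "nrm n (snd pq) \<le> R" using assms pR qR by (metis prod.collapse)+
  have b: "\<bar>nrm n x * ip n y (gau N C)\<bar> \<le> R * (R * sqrt (real n * real N))" if "nrm n x \<le> R" "nrm n y \<le> R" for x y C
  proof -
    have "\<bar>ip n y (gau N C)\<bar> \<le> nrm n y * nrm n (gau N C)" by (rule ip_cauchy_schwarz)
    also have "\<dots> \<le> R * sqrt (real n * real N)" using that R_nonneg nrm_gau_le by (intro mult_mono) auto
    finally show ?thesis using that R_nonneg by (simp only: abs_mult) (intro mult_mono, auto)
  qed
  have "\<bar>nse A B pq\<bar> \<le> R * (R * sqrt (real n * real N)) + R * (R * sqrt (real n * real N))"
    unfolding nse_def by (intro order_trans[OF abs_triangle_ineq] add_mono b n)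
  then show ?thesis by (simp add: power2_eq_square mult.assoc)
qed

definition err :: real
  where "err = 128 * real n * R ^ 6 / sqrt (real N)"

text \<open>A bound for the noise that grows with \<open>N\<close>. This is harmless, as it only
  influences the number of interpolation steps.\<close>

definition K :: real
  where "K = 2 * R\<^sup>2 * sqrt (real n * real N)"

lemma K_nonneg: "0 \<le> K"
  by (simp add: K_def)

text \<open>At fixed \<open>U\<close>, raising \<open>s\<close> costs at most
  \<open>2 * s * V / (n - 1)\<close> per unit, and lowering \<open>\<sigma>\<close> gains at least
  \<open>\<sigma> * V - err\<close> per unit, with the same \<open>V\<close>. The condition
  \<open>speed\<close> balances the two, so only \<open>err\<close> and a second-order term
  remain.\<close>

lemma descent_step:
  assumes U: "U \<in> orth n"
    and D: "(real n - 1) * aa (\<lambda>A B. sm P (ex s \<sigma> U A B) (cpl U)) \<le> 2 * s * aa (nvar s \<sigma> U)"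
    and s: "0 \<le> s" "s \<le> s'" and \<sigma>: "0 \<le> \<sigma>'" "\<sigma>' \<le> \<sigma>" "\<sigma> \<le> 1"
    and speed: "2 * s * (s' - s) \<le> (real n - 1) * (\<sigma> * (\<sigma> - \<sigma>'))"
    and N: "4 * R\<^sup>2 \<le> sqrt (real N)"
    and M: "M = (s' - s) * R\<^sup>2 + (\<sigma> - \<sigma>') * K" "M \<le> 1/2"
  shows "pot s' \<sigma>' U \<le> pot s \<sigma> U + (\<sigma> - \<sigma>') * err + 5 * M\<^sup>2"
proof -
  let ?e = "ex s \<sigma> U"
  define c d V where "c = aa (\<lambda>A B. sm P (?e A B) (cpl U))" and "d = aa (\<lambda>A B. sm P (?e A B) (nse A B))"
    and "V = aa (nvar s \<sigma> U)"
  have n1: "0 < real n - 1" using n2 by simp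
  have V0: "0 \<le> V" unfolding V_def by (intro avg_ge finite_grid nvar_nonneg)
  let ?D = "\<lambda>A B pq. (s' - s) * cpl U pq + (\<sigma>' - \<sigma>) * nse A B pq"
  have M0: "0 \<le> M" using M s \<sigma> K_nonneg by simp
  have Db: "\<bar>?D A B pq\<bar> \<le> M" if "pq \<in> P" for A B pq
  proof -
    have "\<bar>?D A B pq\<bar> \<le> (s' - s) * \<bar>cpl U pq\<bar> + (\<sigma> - \<sigma>') * \<bar>nse A B pq\<bar>"
      using s \<sigma> by (intro order_trans[OF abs_triangle_ineq]) (simp add: abs_mult)
    also have "\<dots> \<le> M" unfolding M
      using s \<sigma> cpl_abs_le[OF U that] nse_abs_le[OF that, of A B]
      by (intro add_mono mult_left_mono) (auto simp: K_def power2_eq_square)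
    finally show ?thesis .
  qed
  have one: "lse P (ex s' \<sigma>' U A B) \<le> lse P (?e A B) + sm P (?e A B) (?D A B) + 5 * M\<^sup>2" for A B
  proof -
    have "lse P (ex s' \<sigma>' U A B) = lse P (\<lambda>pq. ?e A B pq + ?D A B pq)"
      by (simp add: ex_def[abs_def] algebra_simps)
    also have "\<dots> \<le> lse P (?e A B) + sm P (?e A B) (?D A B) + cv P (?e A B) (?D A B) (?D A B) / 2 + 8 * M ^ 3"
      by (rule lse_le_quadratic[OF P_finite P_nonempty Db M(2)])
    also have "cv P (?e A B) (?D A B) (?D A B) \<le> 2 * M * M"
      using cv_abs_le[OF P_finite P_nonempty Db Db, where e = "?e A B"] by (simp add: abs_le_iff)
    also have "8 * M ^ 3 \<le> 4 * M\<^sup>2"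
    proof -
      have "8 * M ^ 3 = (8 * M\<^sup>2) * M" by (simp add: power2_eq_square power3_eq_cube)
      also have "\<dots> \<le> (8 * M\<^sup>2) * (1/2)" using M(2) by (intro mult_left_mono) auto
      finally show ?thesis by simp
    qed
    finally show ?thesis by (simp add: power2_eq_square)
  qed
  have "pot s' \<sigma>' U \<le> aa (\<lambda>A B. lse P (?e A B) + sm P (?e A B) (?D A B) + 5 * M\<^sup>2)"
    unfolding pot_def by (intro aa_mono one)
  also have "\<dots> = pot s \<sigma> U + ((s' - s) * c + (\<sigma>' - \<sigma>) * d) + 5 * M\<^sup>2"
    by (simp only: sm_add sm_cmult aa_simps pot_def c_def d_def)
  also have "(s' - s) * c + (\<sigma>' - \<sigma>) * d \<le> (\<sigma> - \<sigma>') * err"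
  proof -
    have "(real n - 1) * ((s' - s) * c) = (s' - s) * ((real n - 1) * c)" by simp
    also have "\<dots> \<le> (s' - s) * (2 * s * V)" using D s by (intro mult_left_mono) (auto simp: c_def V_def)
    also have "\<dots> = (2 * s * (s' - s)) * V" by simp
    also have "\<dots> \<le> ((real n - 1) * (\<sigma> * (\<sigma> - \<sigma>'))) * V" using V0 by (intro mult_right_mono speed)
    also have "\<dots> = (real n - 1) * ((\<sigma> - \<sigma>') * (\<sigma> * V))" by simp
    finally have "(s' - s) * c \<le> (\<sigma> - \<sigma>') * (\<sigma> * V)" using n1 by (simp only: mult_le_cancel_left_pos)
    moreover have "(\<sigma> - \<sigma>') * (\<sigma> * V - err) \<le> (\<sigma> - \<sigma>') * d"
      using noise_derivative[of \<sigma> s U] \<sigma> N by (intro mult_left_mono) (auto simp: d_def V_def err_def)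
    ultimately show ?thesis by (simp add: algebra_simps)
  qed
  finally show ?thesis by simp
qed

lemma pot_zero: "pot 0 \<sigma> U = pot 0 \<sigma> V"
  by (simp add: pot_def ex_def[abs_def])

text \<open>Along \<open>s = c * sqrt \<theta>\<close>,
  \<open>\<sigma> = sqrt (1 - \<theta>)\<close> with \<open>c * c = (n - 1) / 2\<close> the two
  sides of \<open>speed\<close> have equal differentials. The path is followed in finitely many
  steps, and after each step the matrix is replaced by a minimiser for the new parameters. The noise
  is gone at the end, and the log-sum-exp dominates every single value of the bilinear form.\<close>

proposition chevet_orthogonal:
  assumes N: "4 * R\<^sup>2 \<le> sqrt (real N)" and errle: "128 * real n * R ^ 6 \<le> sqrt (real N)"
  obtains U where "U \<in> orth n"
    "\<And>pq. pq \<in> P \<Longrightarrow> sqrt ((real n - 1) / 2) * cpl U pq \<le> aa (\<lambda>A B. lse P (nse A B)) + 2"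
proof -
  define c where "c = sqrt ((real n - 1) / 2)"
  have c0: "0 \<le> c" and c2: "c * c = (real n - 1) / 2" using n2 by (simp_all add: c_def)
  define Q where "Q = c * R\<^sup>2 + K"
  have Q0: "0 \<le> Q" using c0 K_nonneg by (simp add: Q_def)
  define I where "I = scalar n 1"
  have err1: "err \<le> 1" using errle N1 by (simp add: err_def divide_le_eq)
  have err0: "0 \<le> err" using R_nonneg by (simp add: err_def)
  \<comment> \<open>One step changes the exponents by at most \<open>Q * h\<close>, and the bounds
    for all steps add up to \<open>Q\<close>. The second-order terms therefore total at most
    \<open>5 * Q * Q * h\<close>, which is at most 1 for many steps.\<close>
  obtain m :: nat where m: "(10 * (Q + 1)\<^sup>2)\<^sup>2 < real m" using reals_Archimedean2 by blast
  have "(0::real) < (10 * (Q + 1)\<^sup>2)\<^sup>2" using Q0 by (intro zero_less_power mult_pos_pos) auto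
  then have m0: "0 < real m" using m by linarith
  define h where "h = sqrt (1 / real m)"
  have h0: "0 \<le> h" by (simp add: h_def)
  have "10 * (Q + 1)\<^sup>2 * h \<le> 1"
  proof -
    have "10 * (Q + 1)\<^sup>2 = sqrt ((10 * (Q + 1)\<^sup>2)\<^sup>2)" by (simp only: real_sqrt_abs) simp
    also have "\<dots> \<le> sqrt (real m)" using m by (intro real_sqrt_le_mono) simp
    finally have "10 * (Q + 1)\<^sup>2 * h \<le> sqrt (real m) * h" using h0 by (rule mult_right_mono)
    also have "\<dots> = 1" using m0 by (simp add: h_def flip: real_sqrt_mult)
    finally show ?thesis .
  qed
  moreover have "Q * Q * h \<le> (Q + 1)\<^sup>2 * h" "Q * h \<le> (Q + 1)\<^sup>2 * h"
  proof -
    have "Q * Q \<le> (Q + 1)\<^sup>2" "Q \<le> (Q + 1)\<^sup>2" using Q0 by (auto simp: power2_eq_square algebra_simps)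
    then show "Q * Q * h \<le> (Q + 1)\<^sup>2 * h" "Q * h \<le> (Q + 1)\<^sup>2 * h" using h0 by (auto intro: mult_right_mono)
  qed
  ultimately have hQ: "5 * (Q * Q * h) \<le> 1" "Q * h \<le> 1/2" by linarith+
  define s where "s k = c * sqrt (real k / real m)" for k :: nat
  define \<sigma> where "\<sigma> k = sqrt (1 - real k / real m)" for k :: nat
  define bd where "bd k = pot 0 1 I + (1 - \<sigma> k) * err + 5 * (Q * h) * (s k * R\<^sup>2 + (1 - \<sigma> k) * K)" for k
  have "\<exists>U\<in>orth n. (\<forall>V\<in>orth n. pot (s k) (\<sigma> k) U \<le> pot (s k) (\<sigma> k) V) \<and> pot (s k) (\<sigma> k) U \<le> bd k \<and>
      (real n - 1) * aa (\<lambda>A B. sm P (ex (s k) (\<sigma> k) U A B) (cpl U)) \<le> 2 * s k * aa (nvar (s k) (\<sigma> k) U)"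
    if "k \<le> m" for k using that
  proof (induction k)
    case 0
    have s0: "s 0 = 0" "\<sigma> 0 = 1" by (simp_all add: s_def \<sigma>_def)
    \<comment> \<open>At \<open>s = 0\<close> the potential does not depend on the matrix, so every
      orthogonal matrix is a minimiser. The derivative inequality then has right-hand side 0 and
      requires a choice: it holds for the identity or for its negative.\<close>
    define a where "a z = aa (\<lambda>A B. sm P (ex 0 1 (scalar n z) A B) (cpl (scalar n z)))" for z
    have "cpl (scalar n (-1)) = (\<lambda>pq. -1 * cpl I pq)" by (simp add: cpl_def[abs_def] I_def ip_scalar)
    then have neg: "a (-1) = - a 1"
      unfolding a_def I_def by (simp add: ex_def[abs_def] sm_cmult[where c = "-1", simplified] avg_cmult[where c = "-1", simplified])
    obtain z :: real where z: "z * z = 1" "a z \<le> 0"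
    proof (cases "a 1 \<le> 0")
      case True
      then show ?thesis using that[of 1] by simp
    next
      case False
      then show ?thesis using that[of "-1"] neg by simp
    qed
    show ?case
    proof (intro bexI[of _ "scalar n z"] conjI ballI)
      show "scalar n z \<in> orth n" by (rule scalar_orth[OF z(1)])
      show "pot (s 0) (\<sigma> 0) (scalar n z) \<le> pot (s 0) (\<sigma> 0) V" for V unfolding s0 using pot_zero[of 1 "scalar n z" V] by simp
      show "pot (s 0) (\<sigma> 0) (scalar n z) \<le> bd 0" unfolding bd_def s0 using pot_zero[of 1 "scalar n z" I] by simp
      show "(real n - 1) * aa (\<lambda>A B. sm P (ex (s 0) (\<sigma> 0) (scalar n z) A B) (cpl (scalar n z)))
        \<le> 2 * s 0 * aa (nvar (s 0) (\<sigma> 0) (scalar n z))"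
        unfolding s0 using z(2) n2 by (simp add: a_def mult_nonneg_nonpos)
    qed
  next
    case (Suc k)
    then obtain U where U: "U \<in> orth n" "pot (s k) (\<sigma> k) U \<le> bd k"
      "(real n - 1) * aa (\<lambda>A B. sm P (ex (s k) (\<sigma> k) U A B) (cpl U)) \<le> 2 * s k * aa (nvar (s k) (\<sigma> k) U)"
      by auto
    have km: "real k + 1 \<le> real m" using Suc.prems by simp
    have step: "real (Suc k) / real m = real k / real m + 1 / real m" by (simp add: add_divide_distrib)
    have s_mono: "s k \<le> s (Suc k)" unfolding s_def using c0 m0 by (intro mult_left_mono real_sqrt_le_mono divide_right_mono) auto
    have \<sigma>_mono: "\<sigma> (Suc k) \<le> \<sigma> k" unfolding \<sigma>_def step by (intro real_sqrt_le_mono) (use m0 in auto)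
    have s_sq: "s j * s j = c * c * (real j / real m)" for j
    proof -
      have "s j * s j = c * c * (sqrt (real j / real m) * sqrt (real j / real m))" by (simp only: s_def ac_simps)
      then show ?thesis by (simp only: real_sqrt_mult_self) simp
    qed
    have nn: "0 \<le> 1 - real (Suc k) / real m" "0 \<le> 1 - real k / real m" using km m0 by (simp_all add: divide_le_eq)
    have \<sigma>_sq: "\<sigma> k * \<sigma> k = 1 - real k / real m" "\<sigma> (Suc k) * \<sigma> (Suc k) = 1 - real (Suc k) / real m"
      using nn by (simp_all add: \<sigma>_def)
    have \<sigma>0: "0 \<le> \<sigma> (Suc k)" "\<sigma> k \<le> 1" using nn by (simp_all add: \<sigma>_def)
    have s0: "0 \<le> s k" using c0 by (simp add: s_def)
    have s_step: "s (Suc k) - s k \<le> c * h"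
    proof -
      have "sqrt (real (Suc k) / real m) \<le> sqrt (real k / real m) + h"
        unfolding step h_def by (intro sqrt_add_le_add_sqrt) auto
      then have "s (Suc k) \<le> c * (sqrt (real k / real m) + h)" unfolding s_def using c0 by (rule mult_left_mono)
      then show ?thesis by (simp add: s_def distrib_left)
    qed
    have \<sigma>_step: "\<sigma> k - \<sigma> (Suc k) \<le> h"
    proof -
      have "\<sigma> k = sqrt ((1 - real (Suc k) / real m) + 1 / real m)" by (simp add: \<sigma>_def add_divide_distrib)
      also have "\<dots> \<le> \<sigma> (Suc k) + h" unfolding \<sigma>_def h_def using nn by (intro sqrt_add_le_add_sqrt) auto
      finally show ?thesis by simp
    qed
    have speed: "2 * s k * (s (Suc k) - s k) \<le> (real n - 1) * (\<sigma> k * (\<sigma> k - \<sigma> (Suc k)))"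
    proof -
      have "2 * s k * (s (Suc k) - s k) \<le> s (Suc k) * s (Suc k) - s k * s k"
        using zero_le_square[of "s (Suc k) - s k"] by (simp add: algebra_simps)
      also have "\<dots> = c * c * (1 / real m)" unfolding s_sq step by (simp add: algebra_simps)
      also have "\<dots> = (real n - 1) * ((\<sigma> k * \<sigma> k - \<sigma> (Suc k) * \<sigma> (Suc k)) / 2)"
        unfolding c2 \<sigma>_sq step by simp
      also have "\<dots> \<le> (real n - 1) * (\<sigma> k * (\<sigma> k - \<sigma> (Suc k)))"
      proof (rule mult_left_mono)
        have "x * x - y * y \<le> 2 * (x * (x - y))" for x y :: real
          using zero_le_square[of "y - x"] by (simp add: algebra_simps)
        then show "(\<sigma> k * \<sigma> k - \<sigma> (Suc k) * \<sigma> (Suc k)) / 2 \<le> \<sigma> k * (\<sigma> k - \<sigma> (Suc k))"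
          by (simp only: divide_le_eq) (simp add: mult.commute)
      qed (use n2 in simp)
      finally show ?thesis .
    qed
    define M where "M = (s (Suc k) - s k) * R\<^sup>2 + (\<sigma> k - \<sigma> (Suc k)) * K"
    have M0: "0 \<le> M" using s_mono \<sigma>_mono K_nonneg by (simp add: M_def)
    have "M \<le> c * h * R\<^sup>2 + h * K" unfolding M_def using s_step \<sigma>_step K_nonneg by (intro add_mono mult_right_mono) auto
    also have "\<dots> = Q * h" by (simp add: Q_def algebra_simps)
    finally have MQ: "M \<le> Q * h" .
    obtain W where W: "W \<in> orth n" "\<And>V. V \<in> orth n \<Longrightarrow> pot (s (Suc k)) (\<sigma> (Suc k)) W \<le> pot (s (Suc k)) (\<sigma> (Suc k)) V"
      using min_exists by blast
    have "pot (s (Suc k)) (\<sigma> (Suc k)) W \<le> pot (s (Suc k)) (\<sigma> (Suc k)) U" by (rule W(2)[OF U(1)])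
    also have "\<dots> \<le> pot (s k) (\<sigma> k) U + (\<sigma> k - \<sigma> (Suc k)) * err + 5 * M\<^sup>2"
      by (rule descent_step[OF U(1,3) s0 s_mono \<sigma>0(1) \<sigma>_mono \<sigma>0(2) speed N M_def]) (use MQ hQ in linarith)
    also have "5 * M\<^sup>2 \<le> 5 * (Q * h) * M"
      using mult_right_mono[OF MQ M0] by (simp add: power2_eq_square)
    also have "pot (s k) (\<sigma> k) U \<le> bd k" by (rule U(2))
    also have "bd k + (\<sigma> k - \<sigma> (Suc k)) * err + 5 * (Q * h) * M = bd (Suc k)"
      by (simp add: bd_def M_def algebra_simps)
    finally have bound: "pot (s (Suc k)) (\<sigma> (Suc k)) W \<le> bd (Suc k)" by simp
    have "0 < s (Suc k)"
    proof -
      have "0 < c" using n2 by (simp add: c_def)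
      then show ?thesis using m0 by (simp add: s_def)
    qed
    then show ?case using W bound minimizer_derivative[OF W] by blast
  qed
  from this[of m] obtain U where U: "U \<in> orth n" "pot (s m) (\<sigma> m) U \<le> bd m" by auto
  have sm: "s m = c" "\<sigma> m = 0" using m0 by (simp_all add: s_def \<sigma>_def)
  show thesis
  proof (rule that[OF U(1)])
    fix pq assume pq: "pq \<in> P"
    have "c * cpl U pq \<le> lse P (\<lambda>pq. c * cpl U pq)" using lse_lower[OF P_finite pq, of "\<lambda>pq. c * cpl U pq"] .
    also have "\<dots> = pot (s m) (\<sigma> m) U" unfolding sm by (simp add: pot_def ex_def[abs_def] avg_const)
    also have "\<dots> \<le> bd m" by (rule U(2))
    also have "bd m = pot 0 1 I + err + 5 * (Q * Q * h)" unfolding bd_def sm by (simp add: Q_def algebra_simps)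
    also have "\<dots> \<le> pot 0 1 I + 2" using err1 hQ by linarith
    also have "pot 0 1 I = aa (\<lambda>A B. lse P (nse A B))" by (simp add: pot_def ex_def[abs_def])
    finally show "sqrt ((real n - 1) / 2) * cpl U pq \<le> aa (\<lambda>A B. lse P (nse A B)) + 2" by (simp add: c_def)
  qed
qed

end

section \<open>The position of a finite set of functionals\<close>

lemma zero_if_linear_le_quadratic:
  assumes "\<And>t. \<bar>t\<bar> \<le> t0 \<Longrightarrow> 0 \<le> t * x + C * t\<^sup>2" "0 < t0"
  shows "x = (0::real)"
proof -
  have le: "y \<le> 0" if y: "\<And>t. \<bar>t\<bar> \<le> t0 \<Longrightarrow> 0 \<le> - t * y + C * t\<^sup>2" for y
  proof (rule le_if_le_add_small[OF _ assms(2)])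
    fix t assume t: "0 < t" "t \<le> t0"
    have "t * y \<le> t * (0 + C * t)" using y[of t] t by (simp add: power2_eq_square algebra_simps)
    then show "y \<le> 0 + C * t" using t by (simp only: mult_le_cancel_left_pos)
  qed
  have "x \<le> 0"
  proof (rule le)
    fix t assume "\<bar>t\<bar> \<le> t0"
    then show "0 \<le> - t * x + C * t\<^sup>2" using assms(1)[of "-t"] by simp
  qed
  moreover have "-x \<le> 0"
  proof (rule le)
    fix t assume "\<bar>t\<bar> \<le> t0"
    then show "0 \<le> - t * - x + C * t\<^sup>2" using assms(1)[of t] by simp
  qed
  ultimately show ?thesis by simp
qed

lemma ln_add_one_ge_quadratic:
  assumes "\<bar>t\<bar> \<le> 1/2"
  shows "t - 2 * t\<^sup>2 \<le> ln (1 + t :: real)"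
proof -
  have t: "0 < 1 + t" "1/2 \<le> 1 + t" using assms by linarith+
  have "ln (1 / (1 + t)) \<le> 1 / (1 + t) - 1" using t by (intro ln_le_minus_one) auto
  then have "1 - 1 / (1 + t) \<le> ln (1 + t)" using t by (simp add: ln_div)
  moreover have "1 - 1 / (1 + t) = t - t\<^sup>2 / (1 + t)"
    using t by (simp add: field_simps power2_eq_square)
  moreover have "t\<^sup>2 / (1 + t) \<le> t\<^sup>2 / (1/2)" using t by (intro divide_left_mono) auto
  ultimately show ?thesis by simp
qed

lemma continuous_on_det_mat: "continuous_on S (\<lambda>s. det (mat n n s :: real mat))"
proof -
  have "det (mat n n s) = (\<Sum>p\<in>{p. p permutes {0..<n}}. signof p * (\<Prod>i = 0..<n. s (i, p i)))" for s :: "nat \<times> nat \<Rightarrow> real"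
    unfolding det_def'[OF mat_carrier]
    by (intro sum.cong refl arg_cong2[of _ _ _ _ "(*)"] prod.cong) (auto simp: permutes_in_image)
  then show ?thesis
    by (simp only:) (intro continuous_intros continuous_on_subset[OF continuous_on_product_coordinates], auto)
qed

lemma abs_det_mat_le:
  assumes "\<And>i j. i < n \<Longrightarrow> j < n \<Longrightarrow> \<bar>s (i, j)\<bar> \<le> \<mu>"
  shows "\<bar>det (mat n n s :: real mat)\<bar> \<le> fact n * \<mu> ^ n"
proof -
  have "\<bar>det (mat n n s)\<bar> \<le> (\<Sum>p\<in>{p. p permutes {0..<n}}. \<bar>signof p * (\<Prod>i = 0..<n. mat n n s $$ (i, p i))\<bar>)"
    unfolding det_def'[OF mat_carrier] by (rule sum_abs)
  also have "\<dots> \<le> (\<Sum>p\<in>{p. p permutes {0..<n}}. \<mu> ^ n)"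
  proof (rule sum_mono)
    fix p assume p: "p \<in> {p. p permutes {0..<n}}"
    have "\<bar>signof p * (\<Prod>i = 0..<n. mat n n s $$ (i, p i))\<bar> = (\<Prod>i = 0..<n. \<bar>mat n n s $$ (i, p i)\<bar>)"
      by (simp add: abs_mult abs_prod sign_def)
    also have "\<dots> \<le> (\<Prod>i = 0..<n. \<mu>)"
    proof (rule prod_mono)
      fix i assume i: "i \<in> {0..<n}"
      then have "p i < n" using p by (auto dest: permutes_in_image)
      then show "0 \<le> \<bar>mat n n s $$ (i, p i)\<bar> \<and> \<bar>mat n n s $$ (i, p i)\<bar> \<le> \<mu>" using i assms by simp
    qed
    finally show "\<bar>signof p * (\<Prod>i = 0..<n. mat n n s $$ (i, p i))\<bar> \<le> \<mu> ^ n" by simp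
  qed
  also have "\<dots> = fact n * \<mu> ^ n" by (simp add: card_permutations[of _ n])
  finally show ?thesis .
qed

definition rowadd :: "nat \<Rightarrow> nat \<Rightarrow> real \<Rightarrow> (nat \<times> nat \<Rightarrow> real) \<Rightarrow> nat \<times> nat \<Rightarrow> real"
  where "rowadd a b t s = (\<lambda>(r, i). if r = a then s (a, i) + t * s (b, i) else s (r, i))"

lemma det_rowadd:
  assumes "b < n"
  shows "det (mat n n (rowadd a b t s) :: real mat) = (if a = b then 1 + t else 1) * det (mat n n s)"
proof -
  consider "a = b" | "a \<noteq> b" "a < n" | "a \<ge> n" using assms by linarith
  then show ?thesis
  proof cases
    case 1
    then have "mat n n (rowadd a b t s) = multrow b (1 + t) (mat n n s)"
      by (intro eq_matI) (auto simp: rowadd_def algebra_simps)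
    then show ?thesis using 1 det_multrow[OF assms, of "mat n n s" "1 + t"] by simp
  next
    case 2
    then have "mat n n (rowadd a b t s) = addrow t a b (mat n n s)"
      using assms by (intro eq_matI) (auto simp: rowadd_def)
    then show ?thesis using 2 det_addrow[OF assms 2(1), of "mat n n s" t] by simp
  next
    case 3
    then have "mat n n (rowadd a b t s) = mat n n s" by (intro eq_matI) (auto simp: rowadd_def)
    then show ?thesis using 3 assms by simp
  qed
qed

lemma inverse_matrix_exists:
  assumes "det (mat n n s :: real mat) \<noteq> 0"
  obtains s' where "\<And>i j. i < n \<Longrightarrow> j < n \<Longrightarrow> (\<Sum>k<n. s (i, k) * s' (k, j)) = (if i = j then 1 else 0)"
    "\<And>i j. i < n \<Longrightarrow> j < n \<Longrightarrow> (\<Sum>k<n. s' (i, k) * s (k, j)) = (if i = j then 1 else 0)"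
proof -
  let ?A = "mat n n s"
  have "?A \<in> Units (ring_mat TYPE(real) n ())" by (rule det_non_zero_imp_unit) (use assms in auto)
  then obtain B where B: "B \<in> carrier_mat n n" "B * ?A = 1\<^sub>m n" "?A * B = 1\<^sub>m n"
    by (auto simp: Units_def ring_mat_def)
  have 1: "(\<Sum>k<n. s (i, k) * B $$ (k, j)) = (if i = j then 1 else 0)" if "i < n" "j < n" for i j
  proof -
    have "(?A * B) $$ (i, j) = (\<Sum>k<n. s (i, k) * B $$ (k, j))"
      using that B(1) by (simp add: scalar_prod_def atLeast0LessThan)
    then show ?thesis using that by (simp add: B(3))
  qed
  have 2: "(\<Sum>k<n. B $$ (i, k) * s (k, j)) = (if i = j then 1 else 0)" if "i < n" "j < n" for i j
  proof -
    have "(B * ?A) $$ (i, j) = (\<Sum>k<n. B $$ (i, k) * s (k, j))"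
      using that B(1) by (simp add: scalar_prod_def atLeast0LessThan)
    then show ?thesis using that by (simp add: B(2))
  qed
  show thesis by (rule that[of "\<lambda>x. B $$ x"]) (fact 1, fact 2)
qed

lemma orth_transpose_inverse:
  assumes "U \<in> orth n" "i < n" "j < n"
  shows "(\<Sum>k<n. U (i, k) * U (j, k)) = (if i = j then 1 else 0)"
proof -
  let ?A = "mat n n (\<lambda>(i, j). U (j, i)) :: real mat" and ?B = "mat n n U :: real mat"
  have AB: "?A * ?B = 1\<^sub>m n"
    using assms(1) by (intro eq_matI) (auto simp: orth_def scalar_prod_def atLeast0LessThan)
  have "?B * ?A = 1\<^sub>m n" by (rule mat_mult_left_right_inverse[OF _ _ AB]) auto
  then have "(?B * ?A) $$ (i, j) = (if i = j then 1 else 0)" using assms by simp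
  then show ?thesis using assms by (simp add: scalar_prod_def atLeast0LessThan)
qed

text \<open>Row \<open>n\<close> of the unknown \<open>s\<close> is the translation vector: it is multiplied by the constant
  \<open>1\<close>, the last coordinate of the extended random vector.\<close>

proposition position_exists:
  fixes X :: "'w \<Rightarrow> nat \<Rightarrow> real" and Y :: "(nat \<Rightarrow> real) set"
  assumes n: "1 \<le> n" and \<Omega>: "finite \<Omega>" "\<Omega> \<noteq> {}"
    and X0: "\<And>a. a < n \<Longrightarrow> (\<Sum>\<omega>\<in>\<Omega>. X \<omega> a) = 0"
    and X2: "\<And>a b. a < n \<Longrightarrow> b < n \<Longrightarrow> (\<Sum>\<omega>\<in>\<Omega>. X \<omega> a * X \<omega> b) = (if a = b then real (card \<Omega>) else 0)"
    and Y: "finite Y" "Y \<noteq> {}" and c: "0 < c"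
    and Yc: "\<And>z i. i < n \<Longrightarrow> \<exists>y\<in>Y. c * \<bar>z i\<bar> \<le> ip n y z"
    and lam: "0 < lam"
  obtains s s' v where
    "\<And>i j. i < n \<Longrightarrow> j < n \<Longrightarrow> (\<Sum>k<n. s (i, k) * s' (k, j)) = (if i = j then 1 else 0)"
    "\<And>i j. i < n \<Longrightarrow> j < n \<Longrightarrow> (\<Sum>k<n. s' (i, k) * s (k, j)) = (if i = j then 1 else 0)"
    "\<And>b. b < n \<Longrightarrow> (\<Sum>\<omega>\<in>\<Omega>. sm Y (\<lambda>y. ip n y v + ip n (mv n s y) (X \<omega>)) (\<lambda>y. mv n s y b)) = 0"
    "\<And>a b. a < n \<Longrightarrow> b < n \<Longrightarrow> (\<Sum>\<omega>\<in>\<Omega>. sm Y (\<lambda>y. ip n y v + ip n (mv n s y) (X \<omega>)) (\<lambda>y. mv n s y b) * X \<omega> a)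
      = (if a = b then real (card \<Omega>) * lam else 0)"
proof -
  define Z where "Z \<omega> a = (if a < n then X \<omega> a else 1)" for \<omega> a
  define e where "e s \<omega> y = (\<Sum>a\<le>n. mv n s y a * Z \<omega> a)" for s \<omega> y
  define q where "q s = (\<Sum>\<omega>\<in>\<Omega>. lse Y (e s \<omega>))" for s
  define w where "w = real (card \<Omega>)"
  define \<Phi> where "\<Phi> s = q s - w * lam * ln \<bar>det (mat n n s)\<bar>" for s
  have w0: "0 < w" using \<Omega> by (simp add: w_def card_gt_0_iff)
  have Z2: "(\<Sum>\<omega>\<in>\<Omega>. Z \<omega> a * Z \<omega> b) = (if a = b then w else 0)" if "a \<le> n" "b \<le> n" for a b
    using that X0 X2 by (cases "a < n"; cases "b < n") (auto simp: Z_def w_def)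
  define D where "D = {s :: nat \<times> nat \<Rightarrow> real. \<forall>a i. \<not> (a \<le> n \<and> i < n) \<longrightarrow> s (a, i) = 0}"
  define z where "z s \<omega> i = (\<Sum>a\<le>n. s (a, i) * Z \<omega> a)" for s :: "nat \<times> nat \<Rightarrow> real" and \<omega> and i :: nat
  have ez: "e s \<omega> y = ip n y (z s \<omega>)" for s \<omega> y
  proof -
    have "e s \<omega> y = (\<Sum>a\<le>n. \<Sum>i<n. y i * (s (a, i) * Z \<omega> a))"
      unfolding e_def mv_def sum_distrib_right by (simp add: ac_simps)
    also have "\<dots> = (\<Sum>i<n. \<Sum>a\<le>n. y i * (s (a, i) * Z \<omega> a))" by (rule sum.swap)
    finally show ?thesis by (simp add: ip_def z_def sum_distrib_left)
  qed
  have lse_ge: "c * \<bar>z s \<omega> i\<bar> \<le> lse Y (e s \<omega>)" if i: "i < n" for s \<omega> i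
  proof -
    obtain y where y: "y \<in> Y" "c * \<bar>z s \<omega> i\<bar> \<le> ip n y (z s \<omega>)" using Yc[OF i] by blast
    then show ?thesis using lse_lower[OF Y(1) y(1), of "e s \<omega>"] ez[of s \<omega> y] by linarith
  qed
  have lse0: "0 \<le> lse Y (e s \<omega>)" for s \<omega>
  proof -
    have "0 \<le> c * \<bar>z s \<omega> 0\<bar>" using c by simp
    also have "\<dots> \<le> lse Y (e s \<omega>)" using n by (intro lse_ge) simp
    finally show ?thesis .
  qed
  have q0: "0 \<le> q s" for s unfolding q_def by (intro sum_nonneg lse0)
  \<comment> \<open>By isotropy the squares of \<open>z\<close> sum to \<open>w\<close> times the
    squares of the entries \<open>s (a, i)\<close>, so a large entry forces a large log-sum-exp. The
    translation row is included, since the constant coordinate is orthogonal to the others by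
    \<open>X0\<close>.\<close>
  have coercive: "c * \<bar>s (a, i)\<bar> \<le> q s" if a: "a \<le> n" and i: "i < n" for s a i
  proof -
    have "(\<Sum>\<omega>\<in>\<Omega>. (z s \<omega> i)\<^sup>2) = (\<Sum>a\<le>n. \<Sum>b\<le>n. s (a, i) * s (b, i) * (\<Sum>\<omega>\<in>\<Omega>. Z \<omega> a * Z \<omega> b))"
    proof -
      have "(\<Sum>\<omega>\<in>\<Omega>. (z s \<omega> i)\<^sup>2) = (\<Sum>\<omega>\<in>\<Omega>. \<Sum>a\<le>n. \<Sum>b\<le>n. s (a, i) * s (b, i) * (Z \<omega> a * Z \<omega> b))"
        by (simp add: z_def power2_eq_square sum_product ac_simps)
      also have "\<dots> = (\<Sum>a\<le>n. \<Sum>\<omega>\<in>\<Omega>. \<Sum>b\<le>n. s (a, i) * s (b, i) * (Z \<omega> a * Z \<omega> b))" by (rule sum.swap)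
      also have "\<dots> = (\<Sum>a\<le>n. \<Sum>b\<le>n. \<Sum>\<omega>\<in>\<Omega>. s (a, i) * s (b, i) * (Z \<omega> a * Z \<omega> b))" by (intro sum.cong refl sum.swap)
      finally show ?thesis by (simp only: sum_distrib_left)
    qed
    also have "\<dots> = w * (\<Sum>a\<le>n. (s (a, i))\<^sup>2)"
      by (simp add: Z2 if_distrib power2_eq_square sum_distrib_left mult.commute cong: if_cong)
    finally have sq: "(\<Sum>\<omega>\<in>\<Omega>. (z s \<omega> i)\<^sup>2) = w * (\<Sum>a\<le>n. (s (a, i))\<^sup>2)" .
    have "\<bar>s (a, i)\<bar>\<^sup>2 \<le> (\<Sum>a\<le>n. (s (a, i))\<^sup>2)" using a by (simp only: power2_abs) (intro member_le_sum, auto)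
    also have "\<dots> \<le> w * (\<Sum>a\<le>n. (s (a, i))\<^sup>2)"
    proof -
      have "1 \<le> w" using w0 by (simp add: w_def)
      then show ?thesis using mult_right_mono[of 1 w "\<Sum>a\<le>n. (s (a, i))\<^sup>2"] by (simp add: sum_nonneg)
    qed
    also have "\<dots> = (\<Sum>\<omega>\<in>\<Omega>. \<bar>z s \<omega> i\<bar>\<^sup>2)" by (simp add: sq)
    also have "\<dots> \<le> (\<Sum>\<omega>\<in>\<Omega>. \<bar>z s \<omega> i\<bar>)\<^sup>2"
    proof -
      have "(\<Sum>\<omega>\<in>\<Omega>. \<bar>z s \<omega> i\<bar>\<^sup>2) \<le> (\<Sum>\<omega>\<in>\<Omega>. \<bar>z s \<omega> i\<bar> * (\<Sum>\<omega>'\<in>\<Omega>. \<bar>z s \<omega>' i\<bar>))"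
        unfolding power2_eq_square using \<Omega> by (intro sum_mono mult_left_mono member_le_sum) auto
      then show ?thesis by (simp add: power2_eq_square sum_distrib_right)
    qed
    finally have "\<bar>s (a, i)\<bar> \<le> (\<Sum>\<omega>\<in>\<Omega>. \<bar>z s \<omega> i\<bar>)" by (rule power2_le_imp_le) (simp add: sum_nonneg)
    then have "c * \<bar>s (a, i)\<bar> \<le> (\<Sum>\<omega>\<in>\<Omega>. c * \<bar>z s \<omega> i\<bar>)" using c by (simp add: sum_distrib_left[symmetric])
    also have "\<dots> \<le> q s" unfolding q_def by (intro sum_mono lse_ge i)
    finally show ?thesis .
  qed
  \<comment> \<open>The value for which \<open>ln \<mu> \<le> \<mu> / k + ln k\<close> makes the
    determinant term consume exactly half of \<open>q\<close>, up to the constant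
    \<open>B\<close>.\<close>
  define k where "k = 2 * w * lam * real n / c"
  define B where "B = w * lam * (ln (fact n) + real n * ln k)"
  have k0: "0 < k" using w0 lam n c by (simp add: k_def)
  have low: "q s / 2 - B \<le> \<Phi> s" if det: "det (mat n n s) \<noteq> 0" for s
  proof -
    define \<mu> where "\<mu> = q s / c"
    have \<mu>: "\<bar>s (i, j)\<bar> \<le> \<mu>" if "i < n" "j < n" for i j
      using coercive[of i j s] that c by (simp add: \<mu>_def pos_le_divide_eq mult.commute)
    have \<mu>0: "0 \<le> \<mu>" using q0 c by (simp add: \<mu>_def)
    have dl: "\<bar>det (mat n n s)\<bar> \<le> fact n * \<mu> ^ n" by (rule abs_det_mat_le) (rule \<mu>)
    have "0 < \<bar>det (mat n n s)\<bar>" using det by simp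
    then have "0 < \<mu>" using dl \<mu>0 n by (cases "\<mu> = 0") (auto simp: power_0_left)
    have "ln \<bar>det (mat n n s)\<bar> \<le> ln (fact n * \<mu> ^ n)" using dl det \<open>0 < \<mu>\<close> by (subst ln_le_cancel_iff) auto
    also have "\<dots> = ln (fact n) + real n * ln \<mu>" using \<open>0 < \<mu>\<close> by (simp add: ln_mult ln_realpow)
    also have "ln \<mu> \<le> \<mu> / k + ln k"
    proof -
      have "ln (\<mu> / k) \<le> \<mu> / k - 1" using \<open>0 < \<mu>\<close> k0 by (intro ln_le_minus_one) simp
      then show ?thesis using \<open>0 < \<mu>\<close> k0 by (simp add: ln_div)
    qed
    finally have "w * lam * ln \<bar>det (mat n n s)\<bar> \<le> w * lam * (ln (fact n) + real n * (\<mu> / k + ln k))"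
      using w0 lam by (simp add: mult_left_mono)
    also have "\<dots> = B + w * lam * real n * (\<mu> / k)" by (simp add: B_def algebra_simps)
    also have "w * lam * real n * (\<mu> / k) = q s / 2" using w0 lam n c by (simp add: k_def \<mu>_def)
    finally show ?thesis by (simp add: \<Phi>_def)
  qed
  define I where "I = (scalar n 1 :: nat \<times> nat \<Rightarrow> real)"
  have detI: "det (mat n n I) = 1"
  proof -
    have "mat n n I = 1\<^sub>m n" by (intro eq_matI) (auto simp: I_def scalar_def)
    then show ?thesis by simp
  qed
  define \<Phi>0 where "\<Phi>0 = \<Phi> I"
  define m0 where "m0 = 2 * (\<Phi>0 + B) / c"
  define \<delta> where "\<delta> = exp (- \<Phi>0 / (w * lam))"
  \<comment> \<open>Every admissible matrix that is no worse than the identity lies in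
    \<open>C\<close>: its entries are bounded by coercivity, and its determinant stays away from 0
    because \<open>q\<close> is nonnegative. The minimum over \<open>C\<close> is thus a global
    one.\<close>
  define C where "C = {s \<in> D. (\<forall>a\<in>{..n}. \<forall>i\<in>{..<n}. \<bar>s (a, i)\<bar> \<le> m0) \<and> \<delta> \<le> \<bar>det (mat n n s)\<bar>}"
  have inC: "s \<in> C" if s: "s \<in> D" "det (mat n n s) \<noteq> 0" "\<Phi> s \<le> \<Phi>0" for s
  proof -
    have "q s \<le> 2 * (\<Phi>0 + B)" using low[OF s(2)] s(3) by simp
    then have "c * \<bar>s (a, i)\<bar> \<le> 2 * (\<Phi>0 + B)" if "a \<le> n" "i < n" for a i using coercive[OF that, of s] by linarith
    then have 1: "\<bar>s (a, i)\<bar> \<le> m0" if "a \<le> n" "i < n" for a i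
      using that c by (simp add: m0_def pos_le_divide_eq mult.commute)
    have "- (w * lam * ln \<bar>det (mat n n s)\<bar>) \<le> \<Phi>0" using s(3) q0[of s] by (simp add: \<Phi>_def)
    then have "- \<Phi>0 \<le> ln \<bar>det (mat n n s)\<bar> * (w * lam)" by (simp add: mult.commute)
    then have "- \<Phi>0 / (w * lam) \<le> ln \<bar>det (mat n n s)\<bar>"
      using w0 lam by (subst pos_divide_le_eq) auto
    then have "\<delta> \<le> \<bar>det (mat n n s)\<bar>" unfolding \<delta>_def using s(2) by (simp add: ln_ge_iff)
    then show ?thesis using 1 s(1) by (simp add: C_def)
  qed
  have ID: "I \<in> D" using n by (auto simp: D_def I_def scalar_def)
  have IC: "I \<in> C" by (rule inC) (simp_all add: ID detI \<Phi>0_def)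
  have m00: "0 \<le> m0"
  proof -
    have "\<bar>I (0, 0)\<bar> \<le> m0" using IC n by (auto simp: C_def)
    then show ?thesis by linarith
  qed
  have closedD: "closed D" unfolding D_def
    by (intro closed_Collect_all closed_Collect_imp open_Collect_const closed_Collect_eq continuous_intros
        continuous_on_product_coordinates)
  have "C = D \<inter> (\<Inter>a\<in>{..n}. \<Inter>i\<in>{..<n}. {s. \<bar>s (a, i)\<bar> \<le> m0}) \<inter> {s. \<delta> \<le> \<bar>det (mat n n s)\<bar>}"
    unfolding C_def by blast
  moreover have "closed \<dots>"
    by (intro closed_Int closedD closed_INT ballI closed_Collect_le continuous_intros
        continuous_on_product_coordinates continuous_on_det_mat)
  ultimately have closedC: "closed C" by simp
  have bounded: "\<bar>s p\<bar> \<le> m0" if "s \<in> C" for s p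
  proof (cases p)
    case (Pair a i)
    then show ?thesis using that m00 by (cases "a \<le> n \<and> i < n") (auto simp: C_def D_def)
  qed
  have dpos: "det (mat n n s) \<noteq> 0" if "s \<in> C" for s
  proof -
    have "0 < \<delta>" by (simp add: \<delta>_def)
    then show ?thesis using that by (auto simp: C_def)
  qed
  have cont: "continuous_on C \<Phi>" unfolding \<Phi>_def[abs_def] q_def e_def mv_def
    using dpos by (intro continuous_intros Y continuous_on_ln continuous_on_det_mat
        continuous_on_subset[OF continuous_on_product_coordinates]) auto
  have Cne: "C \<noteq> {}" using IC by blast
  obtain s where s: "s \<in> C" "\<And>s'. s' \<in> C \<Longrightarrow> \<Phi> s \<le> \<Phi> s'"
    by (rule attains_min_bounded[OF closedC Cne _ cont]) (use bounded in blast)+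
  have sD: "s \<in> D" using s(1) by (simp add: C_def)
  have glob: "\<Phi> s \<le> \<Phi> s'" if "s' \<in> D" "det (mat n n s') \<noteq> 0" for s'
  proof (cases "\<Phi> s' \<le> \<Phi>0")
    case True
    then show ?thesis using s(2) inC that by blast
  next
    case False
    then show ?thesis using s(2)[OF IC] by (simp add: \<Phi>0_def)
  qed
  \<comment> \<open>Variation along \<open>rowadd a b\<close>: the left side is the derivative of
    \<open>q\<close>, while \<open>ln |det|\<close> has derivative 1 for \<open>a = b\<close> and 0
    otherwise. The case \<open>a = n\<close> is the centring condition.\<close>
  have stat: "(\<Sum>\<omega>\<in>\<Omega>. sm Y (e s \<omega>) (\<lambda>y. mv n s y b) * Z \<omega> a) = (if a = b then w * lam else 0)"
    if a: "a \<le> n" and b: "b < n" for a b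
  proof -
    define g where "g = (\<Sum>\<omega>\<in>\<Omega>. sm Y (e s \<omega>) (\<lambda>y. mv n s y b) * Z \<omega> a)"
    define M where "M = (\<Sum>\<omega>\<in>\<Omega>. \<Sum>y\<in>Y. \<bar>mv n s y b * Z \<omega> a\<bar>) + 1"
    have Mb: "\<bar>mv n s y b * Z \<omega> a\<bar> \<le> M" if "y \<in> Y" "\<omega> \<in> \<Omega>" for y \<omega>
    proof -
      have "\<bar>mv n s y b * Z \<omega> a\<bar> \<le> (\<Sum>y\<in>Y. \<bar>mv n s y b * Z \<omega> a\<bar>)" using that Y by (intro member_le_sum) auto
      also have "\<dots> \<le> (\<Sum>\<omega>\<in>\<Omega>. \<Sum>y\<in>Y. \<bar>mv n s y b * Z \<omega> a\<bar>)"
        using that \<Omega> by (intro member_le_sum[of \<omega> \<Omega> "\<lambda>\<omega>. \<Sum>y\<in>Y. \<bar>mv n s y b * Z \<omega> a\<bar>"]) (auto intro: sum_nonneg)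
      finally show ?thesis by (simp add: M_def)
    qed
    have M0: "1 \<le> M" unfolding M_def by (simp add: sum_nonneg)
    define E where "E = w * (5 * M\<^sup>2) + 2 * w * lam"
    have "g - (if a = b then w * lam else 0) = 0"
    proof (rule zero_if_linear_le_quadratic)
      show "0 < 1 / (2 * M)" using M0 by simp
      fix t :: real assume "\<bar>t\<bar> \<le> 1 / (2 * M)"
      then have tM: "\<bar>t\<bar> * M \<le> 1/2" using M0 by (simp add: pos_le_divide_eq ac_simps)
      then have t: "\<bar>t\<bar> \<le> 1/2" using M0 mult_left_mono[of 1 M "\<bar>t\<bar>"] by simp
      let ?s = "rowadd a b t s"
      have es: "e ?s \<omega> y = e s \<omega> y + t * (mv n s y b * Z \<omega> a)" for \<omega> y
      proof -
        have "mv n ?s y r = mv n s y r + (if r = a then t * mv n s y b else 0)" for r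
          by (simp add: mv_def rowadd_def algebra_simps sum.distrib sum_distrib_left)
        then have "mv n ?s y r * Z \<omega> r = mv n s y r * Z \<omega> r + (if r = a then t * (mv n s y b * Z \<omega> a) else 0)" for r
          by (cases "r = a") (simp_all only: distrib_right, simp_all)
        then show ?thesis using a by (simp only: e_def sum.distrib) simp
      qed
      have "q ?s \<le> (\<Sum>\<omega>\<in>\<Omega>. lse Y (e s \<omega>) + t * (sm Y (e s \<omega>) (\<lambda>y. mv n s y b) * Z \<omega> a) + 5 * M\<^sup>2 * t\<^sup>2)"
        unfolding q_def
      proof (rule sum_mono)
        fix \<omega> assume \<omega>: "\<omega> \<in> \<Omega>"
        let ?d = "\<lambda>y. t * (mv n s y b * Z \<omega> a)"
        have db: "\<bar>?d y\<bar> \<le> \<bar>t\<bar> * M" if "y \<in> Y" for y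
          using Mb[OF that \<omega>] by (simp add: abs_mult mult_left_mono)
        have "lse Y (e ?s \<omega>) = lse Y (\<lambda>y. e s \<omega> y + ?d y)" by (simp add: es[abs_def])
        also have "\<dots> \<le> lse Y (e s \<omega>) + sm Y (e s \<omega>) ?d + cv Y (e s \<omega>) ?d ?d / 2 + 8 * (\<bar>t\<bar> * M) ^ 3"
          by (rule lse_le_quadratic[OF Y db tM])
        also have "cv Y (e s \<omega>) ?d ?d \<le> 2 * (\<bar>t\<bar> * M) * (\<bar>t\<bar> * M)"
          using cv_abs_le[OF Y db db, where e = "e s \<omega>"] by (simp add: abs_le_iff)
        also have "8 * (\<bar>t\<bar> * M) ^ 3 \<le> 4 * (\<bar>t\<bar> * M)\<^sup>2"
        proof -
          have "8 * (\<bar>t\<bar> * M) ^ 3 = 8 * (\<bar>t\<bar> * M)\<^sup>2 * (\<bar>t\<bar> * M)" by (simp add: power2_eq_square power3_eq_cube)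
          also have "\<dots> \<le> 8 * (\<bar>t\<bar> * M)\<^sup>2 * (1/2)" using tM by (intro mult_left_mono) auto
          finally show ?thesis by simp
        qed
        also have "sm Y (e s \<omega>) ?d = t * (sm Y (e s \<omega>) (\<lambda>y. mv n s y b) * Z \<omega> a)"
          by (simp only: sm_cmult sm_cmult_right)
        finally show "lse Y (e ?s \<omega>) \<le> lse Y (e s \<omega>) + t * (sm Y (e s \<omega>) (\<lambda>y. mv n s y b) * Z \<omega> a) + 5 * M\<^sup>2 * t\<^sup>2"
          by (simp add: power2_eq_square algebra_simps flip: abs_mult)
      qed
      also have "\<dots> = q s + t * g + w * (5 * M\<^sup>2) * t\<^sup>2"
        by (simp add: q_def g_def sum.distrib sum_distrib_left w_def)
      finally have qs: "q ?s \<le> q s + t * g + w * (5 * M\<^sup>2) * t\<^sup>2" .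
      define h where "h = (if a = b then 1 + t else 1)"
      have h0: "0 < h" using t by (auto simp: h_def)
      have lnh: "(if a = b then t else 0) - 2 * t\<^sup>2 \<le> ln h"
        using ln_add_one_ge_quadratic[OF t] by (auto simp: h_def)
      have det: "det (mat n n ?s) = h * det (mat n n s)" using det_rowadd[OF b] by (simp add: h_def)
      have "\<Phi> s \<le> \<Phi> ?s"
      proof (rule glob)
        show "?s \<in> D" using sD a b by (auto simp: D_def rowadd_def)
        show "det (mat n n ?s) \<noteq> 0" using det h0 dpos[OF s(1)] by simp
      qed
      also have "\<Phi> ?s = q ?s - w * lam * ln h - w * lam * ln \<bar>det (mat n n s)\<bar>"
        using h0 dpos[OF s(1)] by (simp add: \<Phi>_def det abs_mult ln_mult algebra_simps)
      finally have "0 \<le> t * g + w * (5 * M\<^sup>2) * t\<^sup>2 - w * lam * ln h" using qs by (simp add: \<Phi>_def)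
      also have "\<dots> \<le> t * g + w * (5 * M\<^sup>2) * t\<^sup>2 - w * lam * ((if a = b then t else 0) - 2 * t\<^sup>2)"
        using lnh w0 lam by (intro diff_left_mono mult_left_mono) auto
      also have "\<dots> = t * (g - (if a = b then w * lam else 0)) + E * t\<^sup>2"
        by (simp add: E_def algebra_simps)
      finally show "0 \<le> t * (g - (if a = b then w * lam else 0)) + E * t\<^sup>2" .
    qed
    then show ?thesis by (simp add: g_def)
  qed
  define v where "v i = s (n, i)" for i
  have exv: "e s \<omega> y = ip n y v + ip n (mv n s y) (X \<omega>)" for \<omega> y
  proof -
    have "mv n s y n = ip n y v" by (simp add: mv_def ip_def v_def mult.commute)
    moreover have "(\<Sum>a<n. mv n s y a * Z \<omega> a) = ip n (mv n s y) (X \<omega>)"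
      unfolding ip_def by (intro sum.cong) (auto simp: Z_def)
    ultimately show ?thesis
      unfolding e_def lessThan_Suc_atMost[symmetric] by (simp add: Z_def)
  qed
  obtain s' where s': "\<And>i j. i < n \<Longrightarrow> j < n \<Longrightarrow> (\<Sum>k<n. s (i, k) * s' (k, j)) = (if i = j then 1 else 0)"
    "\<And>i j. i < n \<Longrightarrow> j < n \<Longrightarrow> (\<Sum>k<n. s' (i, k) * s (k, j)) = (if i = j then 1 else 0)"
    using inverse_matrix_exists[OF dpos[OF s(1)]] by blast
  show thesis
  proof (rule that[OF s'])
    fix b assume b: "b < n"
    show "(\<Sum>\<omega>\<in>\<Omega>. sm Y (\<lambda>y. ip n y v + ip n (mv n s y) (X \<omega>)) (\<lambda>y. mv n s y b)) = 0"
      using stat[OF order_refl b] b by (simp add: exv[abs_def] Z_def)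
    fix a assume a: "a < n"
    show "(\<Sum>\<omega>\<in>\<Omega>. sm Y (\<lambda>y. ip n y v + ip n (mv n s y) (X \<omega>)) (\<lambda>y. mv n s y b) * X \<omega> a)
      = (if a = b then real (card \<Omega>) * lam else 0)"
      using stat[of a b] a b by (simp add: exv[abs_def] Z_def w_def)
  qed auto
qed

section \<open>Linear maps, their duals, and the position of a polar net\<close>

definition Rn :: "nat \<Rightarrow> (nat \<Rightarrow> real) set"
  where "Rn n = {x. \<forall>i\<ge>n. x i = 0}"

definition mvz :: "nat \<Rightarrow> (nat \<times> nat \<Rightarrow> real) \<Rightarrow> (nat \<Rightarrow> real) \<Rightarrow> nat \<Rightarrow> real"
  where "mvz n M x = (\<lambda>i. if i < n then \<Sum>k<n. M (i, k) * x k else 0)"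

lemma mvz_in_Rn [simp]: "mvz n M x \<in> Rn n"
  by (simp add: mvz_def Rn_def)

lemma linear_mvz: "linear (mvz n M)"
  by (rule linearI) (auto simp: mvz_def scaleR_fun_def fun_eq_iff distrib_left sum.distrib sum_distrib_left ac_simps)

lemma mvz_inverse:
  assumes "\<And>i j. i < n \<Longrightarrow> j < n \<Longrightarrow> (\<Sum>k<n. A (i, k) * B (k, j)) = (if i = j then 1 else 0)" "x \<in> Rn n"
  shows "mvz n A (mvz n B x) = x"
proof
  fix i
  show "mvz n A (mvz n B x) i = x i"
  proof (cases "i < n")
    case True
    have "mvz n A (mvz n B x) i = (\<Sum>k<n. \<Sum>j<n. A (i, k) * B (k, j) * x j)"
      using True by (simp add: mvz_def sum_distrib_left mult.assoc)
    also have "\<dots> = (\<Sum>j<n. (\<Sum>k<n. A (i, k) * B (k, j)) * x j)"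
      by (subst sum.swap) (simp add: sum_distrib_right)
    also have "\<dots> = (\<Sum>j<n. if i = j then x j else 0)" using True assms(1) by (intro sum.cong) auto
    also have "\<dots> = x i" using True by simp
    finally show ?thesis .
  next
    case False
    then show ?thesis using assms(2) by (simp add: mvz_def Rn_def)
  qed
qed

lemma ip_mvz_left: "ip n (mvz n M x) y = (\<Sum>i<n. \<Sum>k<n. M (i, k) * (x k * y i))"
  by (simp add: ip_def mvz_def sum_distrib_right mult.assoc)

lemma ip_mvz_transpose: "ip n (mvz n M x) y = ip n x (mvz n (\<lambda>(i, j). M (j, i)) y)"
  unfolding ip_commute[of n x] ip_mvz_left by (subst sum.swap) (simp add: ac_simps)

lemma ip_mvz_dual:
  assumes "\<And>i j. i < n \<Longrightarrow> j < n \<Longrightarrow> (\<Sum>k<n. B (i, k) * A (k, j)) = (if i = j then 1 else 0)"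
  shows "ip n (mvz n A y) (mvz n (\<lambda>(i, j). B (j, i)) x) = ip n y x"
proof -
  let ?y = "\<lambda>i. if i < n then y i else 0"
  have "ip n (mvz n A y) (mvz n (\<lambda>(i, j). B (j, i)) x) = ip n (mvz n B (mvz n A y)) x"
    by (rule ip_mvz_transpose[symmetric])
  also have "\<dots> = ip n (mvz n B (mvz n A ?y)) x"
    by (rule arg_cong[of _ _ "\<lambda>z. ip n (mvz n B z) x"]) (auto simp: mvz_def fun_eq_iff intro!: sum.cong)
  also have "mvz n B (mvz n A ?y) = ?y" by (rule mvz_inverse[OF assms]) (auto simp: Rn_def)
  also have "ip n ?y x = ip n y x" by (simp add: ip_def)
  finally show ?thesis .
qed

lemma ip_cong: "(\<And>i. i < n \<Longrightarrow> x i = x' i) \<Longrightarrow> (\<And>i. i < n \<Longrightarrow> y i = y' i) \<Longrightarrow> ip n x y = ip n x' y'"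
  by (simp add: ip_def)

lemma sm_image:
  assumes "inj_on h Q"
  shows "sm (h ` Q) e \<phi> = sm Q (\<lambda>q. e (h q)) (\<lambda>q. \<phi> (h q))"
  by (simp add: sm_def sum.reindex[OF assms])

text \<open>\<open>T\<close> moves functionals and its inverse transpose \<open>D\<close> moves
  points, so that pairings are preserved; the matrices stay hidden from here on.\<close>

definition dual_pair :: "nat \<Rightarrow> ((nat \<Rightarrow> real) \<Rightarrow> nat \<Rightarrow> real) \<Rightarrow> ((nat \<Rightarrow> real) \<Rightarrow> nat \<Rightarrow> real) \<Rightarrow>
    ((nat \<Rightarrow> real) \<Rightarrow> nat \<Rightarrow> real) \<Rightarrow> ((nat \<Rightarrow> real) \<Rightarrow> nat \<Rightarrow> real) \<Rightarrow> bool"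
  where "dual_pair n T Ti D Di \<longleftrightarrow> linear T \<and> linear Ti \<and> linear D \<and> linear Di \<and>
    range T \<subseteq> Rn n \<and> range Ti \<subseteq> Rn n \<and> range D \<subseteq> Rn n \<and> range Di \<subseteq> Rn n \<and>
    (\<forall>x\<in>Rn n. T (Ti x) = x \<and> Ti (T x) = x \<and> D (Di x) = x \<and> Di (D x) = x) \<and>
    (\<forall>x y. ip n (T y) (D x) = ip n y x)"

text \<open>\<open>position_exists\<close> for the net multiplied by \<open>\<beta>\<close>;
  \<open>V\<close> is the smoothed support function divided by \<open>\<beta>\<close>. Its mean is
  at most 2: in the softmax mean of the exponent the translation part vanishes by the centring
  condition, the linear part is the trace \<open>n * (\<beta> / n)\<close>, and the entropy is at
  most \<open>\<beta>\<close>. The multiple \<open>\<beta> / n\<close> is chosen to make the trace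
  equal to \<open>\<beta>\<close>.\<close>

proposition gauge_position:
  fixes X :: "'w \<Rightarrow> nat \<Rightarrow> real" and Y :: "(nat \<Rightarrow> real) set" and \<beta> :: real
  assumes n: "1 \<le> n" and \<Omega>: "finite \<Omega>" "\<Omega> \<noteq> {}"
    and X0: "\<And>a. a < n \<Longrightarrow> (\<Sum>\<omega>\<in>\<Omega>. X \<omega> a) = 0"
    and X2: "\<And>a b. a < n \<Longrightarrow> b < n \<Longrightarrow> (\<Sum>\<omega>\<in>\<Omega>. X \<omega> a * X \<omega> b) = (if a = b then real (card \<Omega>) else 0)"
    and Y: "finite Y" "Y \<noteq> {}" "Y \<subseteq> Rn n" and c: "0 < c"
    and Yc: "\<And>z i. i < n \<Longrightarrow> \<exists>y\<in>Y. c * \<bar>z i\<bar> \<le> ip n y z"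
    and \<beta>: "1 \<le> \<beta>" "ln (real (card Y)) \<le> \<beta>"
  obtains T Ti D Di v V w where "dual_pair n T Ti D Di" "v \<in> Rn n"
    "\<And>\<omega>. \<omega> \<in> \<Omega> \<Longrightarrow> 0 \<le> V \<omega>" "(\<Sum>\<omega>\<in>\<Omega>. V \<omega>) \<le> 2 * real (card \<Omega>)"
    "\<And>\<omega> y. \<omega> \<in> \<Omega> \<Longrightarrow> y \<in> Y \<Longrightarrow> ip n (T y) (X \<omega>) + ip n y v \<le> V \<omega>"
    "\<And>b. b < n \<Longrightarrow> (\<Sum>\<omega>\<in>\<Omega>. sm ((\<lambda>y. T (\<beta> *\<^sub>R y)) ` Y) (\<lambda>\<eta>. w \<eta> + ip n \<eta> (X \<omega>)) (\<lambda>\<eta>. \<eta> b)) = 0"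
    "\<And>a b. a < n \<Longrightarrow> b < n \<Longrightarrow> (\<Sum>\<omega>\<in>\<Omega>. sm ((\<lambda>y. T (\<beta> *\<^sub>R y)) ` Y) (\<lambda>\<eta>. w \<eta> + ip n \<eta> (X \<omega>)) (\<lambda>\<eta>. \<eta> b) * X \<omega> a)
      = (if a = b then real (card \<Omega>) * (\<beta> / real n) else 0)"
proof -
  let ?Q = "(\<lambda>y. \<beta> *\<^sub>R y) ` Y"
  have \<beta>0: "0 < \<beta>" using \<beta> by simp
  have injs: "inj_on (\<lambda>y. \<beta> *\<^sub>R y) Y" using \<beta>0 by (auto simp: inj_on_def)
  have ipsc: "ip n (\<beta> *\<^sub>R y) z = \<beta> * ip n y z" for y z by (simp add: scaleR_fun_def ip_cmult_left)
  have Qc: "\<exists>y\<in>?Q. (\<beta> * c) * \<bar>z i\<bar> \<le> ip n y z" if i: "i < n" for z i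
  proof -
    obtain y where "y \<in> Y" "c * \<bar>z i\<bar> \<le> ip n y z" using Yc[OF i] by blast
    then show ?thesis using \<beta>0 by (intro bexI[of _ "\<beta> *\<^sub>R y"]) (auto simp: ipsc mult.assoc)
  qed
  have lam: "0 < \<beta> / real n" using \<beta>0 n by simp
  have Q: "finite ?Q" "?Q \<noteq> {}" using Y by auto
  have \<beta>c: "0 < \<beta> * c" using \<beta>0 c by simp
  obtain s s' u where s: "\<And>i j. i < n \<Longrightarrow> j < n \<Longrightarrow> (\<Sum>k<n. s (i, k) * s' (k, j)) = (if i = j then 1 else 0)"
    "\<And>i j. i < n \<Longrightarrow> j < n \<Longrightarrow> (\<Sum>k<n. s' (i, k) * s (k, j)) = (if i = j then 1 else 0)"
    and e0: "\<And>b. b < n \<Longrightarrow> (\<Sum>\<omega>\<in>\<Omega>. sm ?Q (\<lambda>y. ip n y u + ip n (mv n s y) (X \<omega>)) (\<lambda>y. mv n s y b)) = 0"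
    and e1: "\<And>a b. a < n \<Longrightarrow> b < n \<Longrightarrow> (\<Sum>\<omega>\<in>\<Omega>. sm ?Q (\<lambda>y. ip n y u + ip n (mv n s y) (X \<omega>)) (\<lambda>y. mv n s y b) * X \<omega> a)
      = (if a = b then real (card \<Omega>) * (\<beta> / real n) else 0)"
    by (rule position_exists[OF n \<Omega> X0 X2 Q \<beta>c Qc lam]) blast+
  define T where "T = mvz n s"
  define Ti where "Ti = mvz n s'"
  define D where "D = mvz n (\<lambda>(i, j). s' (j, i))"
  define Di where "Di = mvz n (\<lambda>(i, j). s (j, i))"
  define v where "v i = (if i < n then u i else 0)" for i
  have v: "v \<in> Rn n" by (simp add: v_def Rn_def)
  have uv: "ip n y u = ip n y v" for y by (simp add: ip_def v_def)
  have s1: "(\<Sum>k<n. s (k, i) * s' (j, k)) = (if i = j then 1 else 0)" if "i < n" "j < n" for i j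
    using s(2)[OF that(2,1)] by (simp add: mult.commute)
  have s2: "(\<Sum>k<n. s' (k, i) * s (j, k)) = (if i = j then 1 else 0)" if "i < n" "j < n" for i j
    using s(1)[OF that(2,1)] by (simp add: mult.commute)
  have dp: "dual_pair n T Ti D Di"
    unfolding dual_pair_def T_def Ti_def D_def Di_def
    using s s1 s2 by (auto intro!: linear_mvz mvz_inverse ip_mvz_dual)
  have mvT: "mv n s y b = T y b" if "b < n" for y b using that by (simp add: T_def mvz_def mv_def)
  have ipT: "ip n (mv n s y) z = ip n (T y) z" for y z by (intro ip_cong) (simp_all add: mvT)
  have TiT: "Ti (T y) = y" if "y \<in> Rn n" for y using dp that by (simp add: dual_pair_def)
  have QR: "?Q \<subseteq> Rn n" using Y(3) by (auto simp: Rn_def scaleR_fun_def)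
  have injT: "inj_on T ?Q" by (rule inj_on_inverseI[of _ Ti]) (use QR TiT in blast)
  define w where "w \<eta> = ip n (Ti \<eta>) v" for \<eta>
  have img: "(\<lambda>y. T (\<beta> *\<^sub>R y)) ` Y = T ` ?Q" by (simp add: image_image)
  have smT: "sm ((\<lambda>y. T (\<beta> *\<^sub>R y)) ` Y) (\<lambda>\<eta>. w \<eta> + ip n \<eta> (X \<omega>)) (\<lambda>\<eta>. \<eta> b)
     = sm ?Q (\<lambda>y. ip n y u + ip n (mv n s y) (X \<omega>)) (\<lambda>y. mv n s y b)" if "b < n" for \<omega> b
    unfolding img sm_image[OF injT] by (intro sm_cong) (use QR TiT that in \<open>auto simp: w_def uv ipT mvT\<close>)
  let ?e = "\<lambda>\<omega> y. ip n y u + ip n (mv n s y) (X \<omega>)"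
  define V where "V \<omega> = lse ?Q (?e \<omega>) / \<beta>" for \<omega>
  have w0: "0 < real (card \<Omega>)" using \<Omega> by (simp add: card_gt_0_iff)
  have Vup: "ip n (T y) (X \<omega>) + ip n y v \<le> V \<omega>" if "y \<in> Y" for y \<omega>
  proof -
    have "?e \<omega> (\<beta> *\<^sub>R y) \<le> lse ?Q (?e \<omega>)" using that by (intro lse_lower Q) auto
    moreover have "T (\<beta> *\<^sub>R y) = \<beta> *\<^sub>R T y" unfolding T_def by (rule linear_scale[OF linear_mvz])
    ultimately have "\<beta> * (ip n (T y) (X \<omega>) + ip n y v) \<le> lse ?Q (?e \<omega>)"
      by (simp add: ipT ipsc uv distrib_left)
    then show ?thesis using \<beta>0 by (simp add: V_def pos_le_divide_eq mult.commute)
  qed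
  have V0: "0 \<le> V \<omega>" for \<omega>
  proof -
    have "0 < n" using n by simp
    \<comment> \<open>Coercivity at the point that corresponds to \<open>X \<omega>\<close> plus the
      translation provides an element of the net with nonnegative value there.\<close>
    from Yc[OF this, of "Di (\<lambda>i. X \<omega> i + D v i)"]
    obtain y where y: "y \<in> Y" "c * \<bar>(Di (\<lambda>i. X \<omega> i + D v i)) 0\<bar> \<le> ip n y (Di (\<lambda>i. X \<omega> i + D v i))" by blast
    have "0 \<le> c * \<bar>(Di (\<lambda>i. X \<omega> i + D v i)) 0\<bar>" using c by simp
    also have "\<dots> \<le> ip n y (Di (\<lambda>i. X \<omega> i + D v i))" by (rule y)
    also have "\<dots> = ip n (T y) (\<lambda>i. X \<omega> i + D v i)"
      unfolding T_def Di_def by (rule ip_mvz_transpose[symmetric])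
    also have "\<dots> = ip n (T y) (X \<omega>) + ip n y v"
      using dp by (simp add: ip_add_right dual_pair_def)
    also have "\<dots> \<le> V \<omega>" by (rule Vup[OF y(1)])
    finally show ?thesis .
  qed
  have "(\<Sum>\<omega>\<in>\<Omega>. lse ?Q (?e \<omega>)) \<le> (\<Sum>\<omega>\<in>\<Omega>. sm ?Q (?e \<omega>) (?e \<omega>) + \<beta>)"
  proof (rule sum_mono)
    fix \<omega>
    have "lse ?Q (?e \<omega>) \<le> sm ?Q (?e \<omega>) (?e \<omega>) + ln (real (card ?Q))" by (rule lse_le_sm[OF Q])
    then show "lse ?Q (?e \<omega>) \<le> sm ?Q (?e \<omega>) (?e \<omega>) + \<beta>" using \<beta>(2) by (simp add: card_image[OF injs])
  qed
  also have "\<dots> = (\<Sum>\<omega>\<in>\<Omega>. sm ?Q (?e \<omega>) (\<lambda>y. ip n y u)) + (\<Sum>\<omega>\<in>\<Omega>. sm ?Q (?e \<omega>) (\<lambda>y. ip n (mv n s y) (X \<omega>))) + real (card \<Omega>) * \<beta>"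
    by (simp add: sm_add sum.distrib)
  also have "(\<Sum>\<omega>\<in>\<Omega>. sm ?Q (?e \<omega>) (\<lambda>y. ip n y u)) = (\<Sum>\<omega>\<in>\<Omega>. sm ?Q (?e \<omega>) (\<lambda>y. \<Sum>b<n. mv n s y b * D v b))"
  proof (intro sum.cong refl sm_cong)
    fix y
    have "ip n y u = ip n (T y) (D v)" using dp by (simp add: dual_pair_def uv)
    then show "ip n y u = (\<Sum>b<n. mv n s y b * D v b)" by (simp add: ip_def mvT)
  qed
  also have "\<dots> = (\<Sum>b<n. (\<Sum>\<omega>\<in>\<Omega>. sm ?Q (?e \<omega>) (\<lambda>y. mv n s y b)) * D v b)"
    unfolding sm_sum sm_cmult_right by (subst sum.swap) (simp add: sum_distrib_right)
  also have "\<dots> = 0" by (simp add: e0)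
  also have "(\<Sum>\<omega>\<in>\<Omega>. sm ?Q (?e \<omega>) (\<lambda>y. ip n (mv n s y) (X \<omega>))) = (\<Sum>b<n. \<Sum>\<omega>\<in>\<Omega>. sm ?Q (?e \<omega>) (\<lambda>y. mv n s y b) * X \<omega> b)"
    by (subst sum.swap) (simp add: ip_def[of n "mv n s _"] sm_sum sm_cmult_right)
  also have "\<dots> = (\<Sum>b<n. real (card \<Omega>) * (\<beta> / real n))" by (simp add: e1)
  also have "\<dots> = real (card \<Omega>) * \<beta>" using n by simp
  finally have "(\<Sum>\<omega>\<in>\<Omega>. lse ?Q (?e \<omega>)) \<le> 2 * real (card \<Omega>) * \<beta>" by (simp add: ac_simps)
  then have "(\<Sum>\<omega>\<in>\<Omega>. V \<omega>) \<le> 2 * real (card \<Omega>)"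
    unfolding V_def sum_divide_distrib[symmetric] using \<beta>0 by (simp add: pos_divide_le_eq)
  then show thesis
    using that[OF dp v V0 _ Vup, of w] smT e0 e1 by simp
qed

text \<open>\<open>g\<close> is a density of mean 1 on the sample, and stationarity makes its
  correlation with \<open>X\<close> in direction \<open>x\<close> equal to
  \<open>-|x|^2 / n\<close>. A distant \<open>x\<close> forces \<open>g\<close> to be far from
  uniform in the opposite direction; this is how radii are bounded without symmetry.\<close>

lemma dual_weights:
  fixes X :: "'w \<Rightarrow> nat \<Rightarrow> real" and x :: "nat \<Rightarrow> real"
  assumes n: "1 \<le> n" and \<Omega>: "finite \<Omega>" "\<Omega> \<noteq> {}" and Y: "finite Y" "Y \<noteq> {}" and \<beta>: "0 < \<beta>"
    and X0: "\<And>a. a < n \<Longrightarrow> (\<Sum>\<omega>\<in>\<Omega>. X \<omega> a) = 0"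
    and e0: "\<And>b. b < n \<Longrightarrow> (\<Sum>\<omega>\<in>\<Omega>. sm Y (\<lambda>\<eta>. w \<eta> + ip n \<eta> (X \<omega>)) (\<lambda>\<eta>. \<eta> b)) = 0"
    and e1: "\<And>a b. a < n \<Longrightarrow> b < n \<Longrightarrow> (\<Sum>\<omega>\<in>\<Omega>. sm Y (\<lambda>\<eta>. w \<eta> + ip n \<eta> (X \<omega>)) (\<lambda>\<eta>. \<eta> b) * X \<omega> a)
      = (if a = b then real (card \<Omega>) * (\<beta> / real n) else 0)"
    and x: "\<And>\<eta>. \<eta> \<in> Y \<Longrightarrow> ip n \<eta> x \<le> \<beta>"
  obtains g where "\<And>\<omega>. 0 \<le> g \<omega>" "(\<Sum>\<omega>\<in>\<Omega>. g \<omega>) = real (card \<Omega>)"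
    "(\<Sum>\<omega>\<in>\<Omega>. g \<omega> * ip n (X \<omega>) x) = - (real (card \<Omega>) * ip n x x / real n)"
    "\<And>G \<omega>. (\<And>\<eta>. \<eta> \<in> Y \<Longrightarrow> \<bar>ip n \<eta> x\<bar> \<le> \<beta> * G) \<Longrightarrow> g \<omega> \<le> 1 + G"
proof -
  let ?f = "\<lambda>\<omega>. sm Y (\<lambda>\<eta>. w \<eta> + ip n \<eta> (X \<omega>))"
  define g where "g \<omega> = 1 - ?f \<omega> (\<lambda>\<eta>. ip n \<eta> x) / \<beta>" for \<omega>
  have ipf: "?f \<omega> (\<lambda>\<eta>. ip n \<eta> x) = (\<Sum>b<n. ?f \<omega> (\<lambda>\<eta>. \<eta> b) * x b)" for \<omega>
    by (simp add: ip_def sm_sum sm_cmult_right)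
  have g0: "0 \<le> g \<omega>" for \<omega>
  proof -
    have "?f \<omega> (\<lambda>\<eta>. ip n \<eta> x) \<le> \<beta>" by (intro sm_le Y x)
    then show ?thesis using \<beta> by (simp add: g_def)
  qed
  have "(\<Sum>\<omega>\<in>\<Omega>. ?f \<omega> (\<lambda>\<eta>. ip n \<eta> x)) = (\<Sum>b<n. (\<Sum>\<omega>\<in>\<Omega>. ?f \<omega> (\<lambda>\<eta>. \<eta> b)) * x b)"
    unfolding ipf by (subst sum.swap) (simp add: sum_distrib_right)
  then have z: "(\<Sum>\<omega>\<in>\<Omega>. ?f \<omega> (\<lambda>\<eta>. ip n \<eta> x)) = 0" by (simp add: e0)
  have gs: "(\<Sum>\<omega>\<in>\<Omega>. g \<omega>) = real (card \<Omega>)"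
    by (simp add: g_def sum_subtractf z flip: sum_divide_distrib)
  have xs: "(\<Sum>\<omega>\<in>\<Omega>. ip n (X \<omega>) x) = 0"
    unfolding ip_def by (subst sum.swap) (simp add: X0 flip: sum_distrib_right)
  have "(\<Sum>\<omega>\<in>\<Omega>. ?f \<omega> (\<lambda>\<eta>. ip n \<eta> x) * ip n (X \<omega>) x)
    = (\<Sum>\<omega>\<in>\<Omega>. \<Sum>b<n. \<Sum>a<n. ?f \<omega> (\<lambda>\<eta>. \<eta> b) * X \<omega> a * (x b * x a))"
    unfolding ipf ip_def[of n "X _" x] sum_product by (simp only: ac_simps)
  also have "\<dots> = (\<Sum>b<n. \<Sum>\<omega>\<in>\<Omega>. \<Sum>a<n. ?f \<omega> (\<lambda>\<eta>. \<eta> b) * X \<omega> a * (x b * x a))" by (rule sum.swap)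
  also have "\<dots> = (\<Sum>b<n. \<Sum>a<n. \<Sum>\<omega>\<in>\<Omega>. ?f \<omega> (\<lambda>\<eta>. \<eta> b) * X \<omega> a * (x b * x a))" by (intro sum.cong refl sum.swap)
  also have "\<dots> = (\<Sum>b<n. \<Sum>a<n. (if a = b then real (card \<Omega>) * (\<beta> / real n) else 0) * (x b * x a))"
    unfolding sum_distrib_right[symmetric] by (intro sum.cong refl) (simp add: e1)
  also have "\<dots> = real (card \<Omega>) * (\<beta> / real n) * ip n x x"
  proof -
    have "(\<Sum>a<n. (if a = b then real (card \<Omega>) * (\<beta> / real n) else 0) * (x b * x a))
      = (\<Sum>a<n. if a = b then real (card \<Omega>) * (\<beta> / real n) * (x b * x b) else 0)" for b
      by (intro sum.cong) auto
    then show ?thesis by (simp add: ip_def sum_distrib_left)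
  qed
  finally have sec: "(\<Sum>\<omega>\<in>\<Omega>. ?f \<omega> (\<lambda>\<eta>. ip n \<eta> x) * ip n (X \<omega>) x) = real (card \<Omega>) * (\<beta> / real n) * ip n x x" .
  have "(\<Sum>\<omega>\<in>\<Omega>. g \<omega> * ip n (X \<omega>) x)
     = (\<Sum>\<omega>\<in>\<Omega>. ip n (X \<omega>) x) - (\<Sum>\<omega>\<in>\<Omega>. ?f \<omega> (\<lambda>\<eta>. ip n \<eta> x) * ip n (X \<omega>) x) / \<beta>"
    by (simp add: g_def left_diff_distrib sum_subtractf sum_divide_distrib)
  also have "\<dots> = - (real (card \<Omega>) * ip n x x / real n)" unfolding xs sec using \<beta> by simp
  finally have gx: "(\<Sum>\<omega>\<in>\<Omega>. g \<omega> * ip n (X \<omega>) x) = - (real (card \<Omega>) * ip n x x / real n)" .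
  have gG: "g \<omega> \<le> 1 + G" if G: "\<And>\<eta>. \<eta> \<in> Y \<Longrightarrow> \<bar>ip n \<eta> x\<bar> \<le> \<beta> * G" for G \<omega>
  proof -
    have "\<bar>?f \<omega> (\<lambda>\<eta>. ip n \<eta> x)\<bar> \<le> \<beta> * G" by (intro sm_abs_le Y G)
    then have "- (\<beta> * G) \<le> ?f \<omega> (\<lambda>\<eta>. ip n \<eta> x)" by linarith
    then have "- G \<le> ?f \<omega> (\<lambda>\<eta>. ip n \<eta> x) / \<beta>" using \<beta> by (simp add: pos_le_divide_eq mult.commute)
    then show ?thesis by (simp add: g_def)
  qed
  show thesis by (rule that[OF g0 gs gx gG])
qed

section \<open>Nets and the centre of a convex body\<close>

lemma finite_net:
  fixes n :: nat
  assumes \<epsilon>: "0 < (\<epsilon>::real)" and L: "\<And>x i. x \<in> S \<Longrightarrow> i < n \<Longrightarrow> \<bar>x i\<bar> \<le> L"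
  obtains F where "finite F" "F \<subseteq> S" "\<And>x. x \<in> S \<Longrightarrow> \<exists>y\<in>F. \<forall>i<n. \<bar>x i - y i\<bar> \<le> \<epsilon>"
proof -
  define cell where "cell x = (\<lambda>i\<in>{..<n}. \<lfloor>x i / \<epsilon>\<rfloor>)" for x :: "nat \<Rightarrow> real"
  define m where "m = \<lceil>L / \<epsilon>\<rceil> + 1"
  have "cell ` S \<subseteq> PiE {..<n} (\<lambda>_. {-m..m})"
  proof
    fix k assume "k \<in> cell ` S"
    then obtain x where x: "x \<in> S" "k = cell x" by blast
    have "\<lfloor>x i / \<epsilon>\<rfloor> \<in> {-m..m}" if "i < n" for i
    proof -
      have "\<bar>x i / \<epsilon>\<bar> \<le> L / \<epsilon>" using L[OF x(1) that] \<epsilon> by (simp add: abs_divide divide_right_mono)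
      then have "\<bar>x i / \<epsilon>\<bar> \<le> of_int \<lceil>L / \<epsilon>\<rceil>" using le_of_int_ceiling[of "L / \<epsilon>"] by linarith
      then have "- of_int \<lceil>L / \<epsilon>\<rceil> \<le> x i / \<epsilon>" "x i / \<epsilon> \<le> of_int \<lceil>L / \<epsilon>\<rceil>" by linarith+
      then have "- \<lceil>L / \<epsilon>\<rceil> \<le> \<lfloor>x i / \<epsilon>\<rfloor>" "\<lfloor>x i / \<epsilon>\<rfloor> \<le> \<lceil>L / \<epsilon>\<rceil>"
        by (simp_all add: le_floor_iff floor_le_iff)
      then show ?thesis by (simp add: m_def)
    qed
    then show "k \<in> PiE {..<n} (\<lambda>_. {-m..m})" using x(2) by (simp add: cell_def PiE_iff)
  qed
  moreover have "finite (PiE {..<n} (\<lambda>_. {-m..m}))" by (intro finite_PiE) auto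
  ultimately have fin: "finite (cell ` S)" by (rule finite_subset)
  define rep where "rep k = (SOME x. x \<in> S \<and> cell x = k)" for k
  have rep: "rep (cell x) \<in> S \<and> cell (rep (cell x)) = cell x" if "x \<in> S" for x
    unfolding rep_def by (rule someI[of "\<lambda>y. y \<in> S \<and> cell y = cell x" x]) (use that in simp)
  show thesis
  proof (rule that[of "rep ` cell ` S"])
    show "finite (rep ` cell ` S)" using fin by simp
    show "rep ` cell ` S \<subseteq> S" using rep by blast
    fix x assume x: "x \<in> S"
    show "\<exists>y\<in>rep ` cell ` S. \<forall>i<n. \<bar>x i - y i\<bar> \<le> \<epsilon>"
    proof (intro bexI[of _ "rep (cell x)"] allI impI)
      fix i assume i: "i < n"
      let ?y = "rep (cell x)"
      have "cell ?y i = cell x i" using rep[OF x] by simp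
      then have "\<lfloor>?y i / \<epsilon>\<rfloor> = \<lfloor>x i / \<epsilon>\<rfloor>" using i by (simp add: cell_def)
      then have "\<bar>x i / \<epsilon> - ?y i / \<epsilon>\<bar> \<le> 1" by linarith
      then have "\<bar>(x i - ?y i) / \<epsilon>\<bar> \<le> 1" by (simp add: diff_divide_distrib)
      then show "\<bar>x i - ?y i\<bar> \<le> \<epsilon>" using \<epsilon> by (simp add: abs_divide)
    qed (use x in auto)
  qed
qed

lemma continuous_on_ip: "continuous_on S (\<lambda>x. ip n \<phi> x)"
  unfolding ip_def by (intro continuous_intros continuous_on_subset[OF continuous_on_product_coordinates]) auto

text \<open>\<open>r\<close> and \<open>L\<close> are qualitative: they may be arbitrarily bad, as
  they influence the size of the nets and never a final constant.\<close>

locale body =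
  fixes n :: nat and B :: "(nat \<Rightarrow> real) set" and r L :: real
  assumes n1: "1 \<le> n" and sub: "B \<subseteq> Rn n" and cpt: "compact B"
    and cvx: "\<And>x y t. x \<in> B \<Longrightarrow> y \<in> B \<Longrightarrow> 0 \<le> t \<Longrightarrow> t \<le> 1 \<Longrightarrow> (\<lambda>i. t * x i + (1 - t) * y i) \<in> B"
    and r0: "0 < r" and box: "\<And>z. z \<in> Rn n \<Longrightarrow> (\<And>i. i < n \<Longrightarrow> \<bar>z i\<bar> \<le> r) \<Longrightarrow> z \<in> B"
    and bd: "\<And>x i. x \<in> B \<Longrightarrow> \<bar>x i\<bar> \<le> L"
begin

lemma zero_in: "(\<lambda>_. 0) \<in> B"
  using r0 by (intro box) (auto simp: Rn_def)

lemma L_nonneg: "0 \<le> L"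
  using bd[OF zero_in] by simp

lemma scale_in: "x \<in> B \<Longrightarrow> 0 \<le> t \<Longrightarrow> t \<le> 1 \<Longrightarrow> (\<lambda>i. t * x i) \<in> B"
  using cvx[OF _ zero_in, of x t] by simp

lemma linear_max:
  obtains z where "z \<in> B" "\<And>x. x \<in> B \<Longrightarrow> ip n \<phi> x \<le> ip n \<phi> z"
proof -
  have "\<exists>z\<in>B. \<forall>x\<in>B. ip n \<phi> x \<le> ip n \<phi> z"
    by (rule continuous_attains_sup[OF cpt _ continuous_on_ip]) (use zero_in in blast)
  then show thesis using that by blast
qed

text \<open>The normal at the nearest point separates. The box makes its maximum over
  \<open>B\<close> positive, which permits normalisation to 1.\<close>

lemma separation:
  assumes w: "w \<in> Rn n" "w \<notin> B"
  obtains \<phi> where "\<phi> \<in> Rn n" "\<And>x. x \<in> B \<Longrightarrow> ip n \<phi> x \<le> 1" "1 < ip n \<phi> w"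
proof -
  let ?d = "\<lambda>x. \<Sum>i<n. (w i - x i)\<^sup>2"
  have "continuous_on B ?d"
    by (intro continuous_intros continuous_on_subset[OF continuous_on_product_coordinates]) auto
  then obtain p where p: "p \<in> B" "\<And>x. x \<in> B \<Longrightarrow> ?d p \<le> ?d x"
    using continuous_attains_inf[OF cpt, of ?d] zero_in by blast
  define \<psi> where "\<psi> i = w i - p i" for i
  have pR: "p \<in> Rn n" using p(1) sub by blast
  have \<psi>R: "\<psi> \<in> Rn n" using w(1) pR by (simp add: \<psi>_def Rn_def)
  have pos: "0 < ip n \<psi> \<psi>"
  proof (rule ccontr)
    assume "\<not> 0 < ip n \<psi> \<psi>"
    then have "(\<Sum>i<n. \<psi> i * \<psi> i) = 0" using ip_self_nonneg[of n \<psi>] by (simp add: ip_def)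
    then have "\<forall>i<n. \<psi> i = 0" by (subst (asm) sum_nonneg_eq_0_iff) auto
    then have "w = p" using \<psi>R by (auto simp: \<psi>_def Rn_def fun_eq_iff) (metis eq_iff_diff_eq_0 not_le)
    then show False using w(2) p(1) by simp
  qed
  have sup: "ip n \<psi> x \<le> ip n \<psi> p" if x: "x \<in> B" for x
  proof -
    define h where "h i = x i - p i" for i
    have "ip n \<psi> h \<le> 0"
    proof (rule le_if_le_add_small[of 1 "ip n \<psi> h" 0 "ip n h h / 2"])
      fix t :: real assume t: "0 < t" "t \<le> 1"
      have "(\<lambda>i. t * x i + (1 - t) * p i) \<in> B" using t by (intro cvx x p) auto
      then have "?d p \<le> ?d (\<lambda>i. t * x i + (1 - t) * p i)" by (rule p(2))
      also have "\<dots> = (\<Sum>i<n. (1 * \<psi> i - t * h i)\<^sup>2)"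
        by (intro sum.cong refl arg_cong[of _ _ "\<lambda>z. z\<^sup>2"]) (simp add: \<psi>_def h_def algebra_simps)
      also have "\<dots> = ip n \<psi> \<psi> - 2 * t * ip n \<psi> h + t\<^sup>2 * ip n h h"
        using sum_scaled_diff_square[of 1 \<psi> t h n] by simp
      also have "?d p = ip n \<psi> \<psi>" by (simp add: ip_def \<psi>_def power2_eq_square)
      finally have "t * (2 * ip n \<psi> h) \<le> t * (t * ip n h h)" by (simp add: power2_eq_square)
      then have "2 * ip n \<psi> h \<le> t * ip n h h" using t by (simp only: mult_le_cancel_left_pos)
      then show "ip n \<psi> h \<le> 0 + ip n h h / 2 * t" by (simp add: mult.commute)
    qed simp
    then show ?thesis by (simp add: h_def[abs_def] ip_diff_right)
  qed
  define K where "K = (\<Sum>i<n. \<bar>\<psi> i\<bar>) + 1"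
  have K: "\<bar>\<psi> i\<bar> \<le> K" if "i < n" for i
    using that member_le_sum[of i "{..<n}" "\<lambda>i. \<bar>\<psi> i\<bar>"] by (simp add: K_def)
  have K_nonneg: "0 < K" unfolding K_def by (simp add: sum_nonneg add_nonneg_pos)
  have "(\<lambda>i. r / K * \<psi> i) \<in> B"
  proof (rule box)
    show "(\<lambda>i. r / K * \<psi> i) \<in> Rn n" using \<psi>R by (simp add: Rn_def)
    fix i assume "i < n"
    then have "r * \<bar>\<psi> i\<bar> \<le> r * K" using K r0 by (intro mult_left_mono) auto
    then show "\<bar>r / K * \<psi> i\<bar> \<le> r" using r0 K_nonneg by (simp add: abs_mult pos_divide_le_eq)
  qed
  then have "ip n \<psi> (\<lambda>i. r / K * \<psi> i) \<le> ip n \<psi> p" by (rule sup)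
  moreover have "0 < r / K * ip n \<psi> \<psi>" using r0 K_nonneg pos by simp
  ultimately have pp: "0 < ip n \<psi> p" unfolding ip_cmult_right by linarith
  have wp: "ip n \<psi> p < ip n \<psi> w"
  proof -
    have "ip n \<psi> w - ip n \<psi> p = ip n \<psi> \<psi>" by (simp add: ip_diff_right[symmetric] \<psi>_def[abs_def])
    then show ?thesis using pos by simp
  qed
  show thesis
  proof (rule that[of "\<lambda>i. 1 / ip n \<psi> p * \<psi> i"])
    show "(\<lambda>i. 1 / ip n \<psi> p * \<psi> i) \<in> Rn n" using \<psi>R by (simp add: Rn_def)
    show "ip n (\<lambda>i. 1 / ip n \<psi> p * \<psi> i) x \<le> 1" if "x \<in> B" for x
      unfolding ip_cmult_left using sup[OF that] pp by simp
    show "1 < ip n (\<lambda>i. 1 / ip n \<psi> p * \<psi> i) w"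
      unfolding ip_cmult_left using wp pp by simp
  qed
qed

text \<open>For \<open>Xs\<close>: a maximiser and its net point differ by half an element of
  \<open>B\<close>, so the net attains at least half of the maximum. For \<open>Ys\<close>: a net of
  the polar is joined with multiples of the coordinate functionals. These bound \<open>w\<close>
  beforehand, so passing from the net to the polar costs at most 1 and gives the value 3, below the
  4 that a separating functional would need.\<close>

proposition nets:
  obtains Xs Ys c where "finite Xs" "Xs \<subseteq> B" "(\<lambda>_. 0) \<in> Xs" "finite Ys" "Ys \<noteq> {}" "Ys \<subseteq> Rn n"
    "\<And>x y. x \<in> B \<Longrightarrow> y \<in> Ys \<Longrightarrow> ip n y x \<le> 1"
    "\<And>\<phi> z. z \<in> B \<Longrightarrow> \<exists>x\<in>Xs. ip n \<phi> z \<le> 2 * ip n \<phi> x"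
    "\<And>w. w \<in> Rn n \<Longrightarrow> (\<And>y. y \<in> Ys \<Longrightarrow> ip n y w \<le> 2) \<Longrightarrow> (\<lambda>i. 1/4 * w i) \<in> B"
    "0 < c" "\<And>z i. i < n \<Longrightarrow> \<exists>y\<in>Ys. c * \<bar>z i\<bar> \<le> ip n y z"
proof -
  obtain F where F: "finite F" "F \<subseteq> B" "\<And>x. x \<in> B \<Longrightarrow> \<exists>y\<in>F. \<forall>i<n. \<bar>x i - y i\<bar> \<le> r / 2"
    using finite_net[of "r/2" B n L] r0 bd by auto
  define Xs where "Xs = insert (\<lambda>_. 0) F"
  have X: "\<exists>x\<in>Xs. ip n \<phi> z \<le> 2 * ip n \<phi> x" if "z \<in> B" for \<phi> z
  proof -
    obtain u where u: "u \<in> B" "\<And>x. x \<in> B \<Longrightarrow> ip n \<phi> x \<le> ip n \<phi> u" using linear_max by blast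
    obtain x where x: "x \<in> F" "\<forall>i<n. \<bar>u i - x i\<bar> \<le> r / 2" using F(3)[OF u(1)] by blast
    have "(\<lambda>i. 2 * (u i - x i)) \<in> B"
    proof (rule box)
      have "u \<in> Rn n" "x \<in> Rn n" using u(1) x(1) F(2) sub by auto
      then show "(\<lambda>i. 2 * (u i - x i)) \<in> Rn n" by (simp add: Rn_def)
      fix i assume "i < n"
      then have "\<bar>u i - x i\<bar> \<le> r / 2" using x(2) by blast
      then show "\<bar>2 * (u i - x i)\<bar> \<le> r" unfolding abs_mult by simp
    qed
    from u(2)[OF this] have "2 * (ip n \<phi> u - ip n \<phi> x) \<le> ip n \<phi> u" unfolding ip_cmult_right ip_diff_right .
    then have "ip n \<phi> u \<le> 2 * ip n \<phi> x" by simp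
    then show ?thesis using u(2)[OF that] x(1) by (intro bexI[of _ x]) (auto simp: Xs_def)
  qed
  define pol where "pol = {y \<in> Rn n. \<forall>x\<in>B. ip n y x \<le> 1}"
  define \<epsilon> where "\<epsilon> = 1 / (2 * real n * (L + 1))"
  have \<epsilon>0: "0 < \<epsilon>" using n1 L_nonneg by (simp add: \<epsilon>_def)
  have unit: "ip n (\<lambda>j. if j = i then a else 0) z = a * z i" "ip n z (\<lambda>j. if j = i then a else 0) = a * z i"
    if "i < n" for i a z
    using that by (simp_all add: ip_def if_distrib if_distribR cong: if_cong)
  have pol_bd: "\<bar>y i\<bar> \<le> 1 / r" if y: "y \<in> pol" and i: "i < n" for y i
  proof -
    have e: "(\<lambda>j. if j = i then a else 0) \<in> B" if "\<bar>a\<bar> \<le> r" for a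
      using that i r0 by (intro box) (auto simp: Rn_def)
    have "r * y i \<le> 1" "- r * y i \<le> 1"
      using y e[of r] e[of "-r"] r0 unit(2)[OF i, of y r] unit(2)[OF i, of y "-r"] by (auto simp: pol_def)
    then have "r * \<bar>y i\<bar> \<le> 1" by (simp add: abs_if)
    then show ?thesis using r0 by (simp add: pos_le_divide_eq mult.commute)
  qed
  obtain G where G: "finite G" "G \<subseteq> pol" "\<And>y. y \<in> pol \<Longrightarrow> \<exists>z\<in>G. \<forall>i<n. \<bar>y i - z i\<bar> \<le> \<epsilon>"
    using finite_net[OF \<epsilon>0, of pol n "1/r"] pol_bd by auto
  define ax where "ax = (\<lambda>(i, a). (\<lambda>j. if j = i then a / (L + 1) else 0)) ` ({..<n} \<times> {1, -1})"
  define Ys where "Ys = G \<union> ax"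
  have ax: "(\<lambda>j. if j = i then a / (L + 1) else 0) \<in> Ys" if "i < n" "a = 1 \<or> a = -1" for i a
    using that unfolding Ys_def ax_def by (intro UnI2 image_eqI[of _ _ "(i, a)"]) auto
  have axpol: "ax \<subseteq> pol"
  proof
    fix y assume "y \<in> ax"
    then obtain i a where ia: "i < n" "a = 1 \<or> a = -1" "y = (\<lambda>j. if j = i then a / (L + 1) else 0)" by (auto simp: ax_def)
    have "ip n y x \<le> 1" if "x \<in> B" for x
    proof -
      have "a * x i \<le> L + 1" using bd[OF that, of i] ia(2) by (auto simp: abs_le_iff)
      then show ?thesis unfolding ia(3) unit(1)[OF ia(1)] using L_nonneg by (simp add: divide_le_eq)
    qed
    then show "y \<in> pol" using ia(1) by (auto simp: pol_def ia(3) Rn_def)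
  qed
  have Yspol: "Ys \<subseteq> pol" using G(2) axpol by (simp add: Ys_def)
  have coer: "\<exists>y\<in>Ys. 1 / (L + 1) * \<bar>z i\<bar> \<le> ip n y z" if i: "i < n" for z i
  proof -
    define a :: real where "a = (if 0 \<le> z i then 1 else -1)"
    have "a = 1 \<or> a = -1" by (simp add: a_def)
    from ax[OF i this] show ?thesis
      by (rule bexI[rotated]) (simp add: unit(1)[OF i], simp add: a_def)
  qed
  have N4: "(\<lambda>i. 1/4 * w i) \<in> B" if w: "w \<in> Rn n" and le: "\<And>y. y \<in> Ys \<Longrightarrow> ip n y w \<le> 2" for w
  proof (rule ccontr)
    assume "(\<lambda>i. 1/4 * w i) \<notin> B"
    moreover have "(\<lambda>i. 1/4 * w i) \<in> Rn n" using w by (simp add: Rn_def)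
    ultimately obtain \<phi> where \<phi>: "\<phi> \<in> Rn n" "\<And>x. x \<in> B \<Longrightarrow> ip n \<phi> x \<le> 1" "1 < ip n \<phi> (\<lambda>i. 1/4 * w i)"
      using separation by blast
    have "\<phi> \<in> pol" using \<phi> by (simp add: pol_def)
    then obtain y where y: "y \<in> G" "\<forall>i<n. \<bar>\<phi> i - y i\<bar> \<le> \<epsilon>" using G(3) by blast
    have wb: "\<bar>w i\<bar> \<le> 2 * (L + 1)" if i: "i < n" for i
    proof -
      obtain y where "y \<in> Ys" "1 / (L + 1) * \<bar>w i\<bar> \<le> ip n y w" using coer[OF i] by blast
      then have "1 / (L + 1) * \<bar>w i\<bar> \<le> 2" using le by fastforce
      then show ?thesis using L_nonneg by (simp add: divide_le_eq)
    qed
    have "ip n \<phi> w - ip n y w = (\<Sum>i<n. (\<phi> i - y i) * w i)" by (simp add: ip_def left_diff_distrib sum_subtractf)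
    also have "\<dots> \<le> (\<Sum>i<n. \<epsilon> * (2 * (L + 1)))"
    proof (rule sum_mono)
      fix i assume "i \<in> {..<n}"
      then have "\<bar>(\<phi> i - y i) * w i\<bar> \<le> \<epsilon> * (2 * (L + 1))"
        unfolding abs_mult using y(2) wb \<epsilon>0 by (intro mult_mono) auto
      then show "(\<phi> i - y i) * w i \<le> \<epsilon> * (2 * (L + 1))" by linarith
    qed
    also have "\<dots> = 1" using n1 L_nonneg by (simp add: \<epsilon>_def)
    finally have "ip n \<phi> w \<le> 3" using le[of y] y(1) by (simp add: Ys_def)
    then show False using \<phi>(3) by (simp only: ip_cmult_right)
  qed
  show thesis
  proof (rule that[of Xs Ys "1 / (L + 1)"])
    show "finite Xs" "Xs \<subseteq> B" "(\<lambda>_. 0) \<in> Xs" using F zero_in by (auto simp: Xs_def)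
    show "finite Ys" using G(1) by (simp add: Ys_def ax_def)
    show "Ys \<noteq> {}" using ax[of 0 1] n1 by auto
    show "Ys \<subseteq> Rn n" using Yspol by (auto simp: pol_def)
    show "ip n y x \<le> 1" if "x \<in> B" "y \<in> Ys" for x y using that Yspol by (auto simp: pol_def)
    show "0 < 1 / (L + 1)" using L_nonneg by simp
  qed (use X N4 coer in blast)+
qed

end

section \<open>Recentring a convex body\<close>

lemma le_if_mult_self_le:
  assumes "a * a \<le> a * b" "0 \<le> a" "0 \<le> b"
  shows "a \<le> (b::real)"
proof (cases "a = 0")
  case False
  then have "0 < a" using assms(2) by simp
  then show ?thesis using assms(1) by (simp only: mult_le_cancel_left_pos)
qed (use assms in simp)

lemma dual_pair_simps:
  assumes "dual_pair n T Ti D Di"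
  shows "T (c *\<^sub>R x) = c *\<^sub>R T x" "D (c *\<^sub>R x) = c *\<^sub>R D x" "D (x - y) = D x - D y" "D (x + y) = D x + D y"
    "ip n (T y) (D x) = ip n y x"
  using assms unfolding dual_pair_def by (auto simp: linear_scale linear_diff linear_add)

lemma ip_scaleR_left: "ip n (c *\<^sub>R x) z = c * ip n x z"
  by (simp add: scaleR_fun_def ip_cmult_left)

lemma ip_scaleR_right: "ip n z (c *\<^sub>R x) = c * ip n z x"
  by (simp add: scaleR_fun_def ip_cmult_right)

lemma nrm_scaleR: "nrm n (c *\<^sub>R x) = \<bar>c\<bar> * nrm n x"
  by (simp add: nrm_def ip_scaleR_left ip_scaleR_right real_sqrt_mult flip: mult.assoc)

text \<open>The cross-polytope has a bounded norm, so the position theorem for it controls both the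
  inradius about the new centre and the circumradius polynomially.\<close>

lemma (in body) center_exists:
  obtains c where "c \<in> B" "\<And>x. x \<in> B \<Longrightarrow> (\<lambda>i. c i - (x i - c i) / (96 * real n ^ 3)) \<in> B"
proof -
  obtain Xs Ys c0 where Ys: "finite Ys" "Ys \<noteq> {}" "Ys \<subseteq> Rn n"
    and dual: "\<And>x y. x \<in> B \<Longrightarrow> y \<in> Ys \<Longrightarrow> ip n y x \<le> 1"
    and quart: "\<And>w. w \<in> Rn n \<Longrightarrow> (\<And>y. y \<in> Ys \<Longrightarrow> ip n y w \<le> 2) \<Longrightarrow> (\<lambda>i. 1/4 * w i) \<in> B"
    and c0: "0 < c0" "\<And>z i. i < n \<Longrightarrow> \<exists>y\<in>Ys. c0 * \<bar>z i\<bar> \<le> ip n y z"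
    by (rule nets) blast
  define \<beta> where "\<beta> = max 1 (ln (real (card Ys)))"
  define q where "q = sqrt (real n)"
  have q0: "0 < q" and qq: "q * q = real n" using n1 by (simp_all add: q_def)
  \<comment> \<open>Signs and axes: the vertices \<open>\<plusminus> sqrt n\<close> times unit
    vectors, equally weighted, are centred and isotropic.\<close>
  define \<Omega> where "\<Omega> = {..<n} \<times> {1::real, -1}"
  define X where "X \<omega> i = (if i = fst \<omega> then snd \<omega> * q else 0)" for \<omega> :: "nat \<times> real" and i
  have "(0, 1) \<in> \<Omega>" using n1 by (simp add: \<Omega>_def)
  then have \<Omega>: "finite \<Omega>" "\<Omega> \<noteq> {}" by (auto simp: \<Omega>_def)
  have card: "real (card \<Omega>) = 2 * real n" by (simp add: \<Omega>_def card_cartesian_product)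
  have sum\<Omega>: "(\<Sum>\<omega>\<in>\<Omega>. h \<omega>) = (\<Sum>k<n. h (k, 1) + h (k, -1))" for h :: "nat \<times> real \<Rightarrow> real"
  proof -
    have "(\<Sum>\<omega>\<in>\<Omega>. h \<omega>) = (\<Sum>k<n. \<Sum>s\<in>{1, -1}. h (k, s))"
      by (simp only: \<Omega>_def sum.cartesian_product split_def prod.collapse)
    then show ?thesis by simp
  qed
  have X0: "(\<Sum>\<omega>\<in>\<Omega>. X \<omega> a) = 0" for a
    unfolding sum\<Omega> by (intro sum.neutral) (simp add: X_def)
  have X2: "(\<Sum>\<omega>\<in>\<Omega>. X \<omega> a * X \<omega> b) = (if a = b then real (card \<Omega>) else 0)" if "a < n" "b < n" for a b
  proof -
    have "X (k, s) a * X (k, s) b = (if k = a then (if a = b then s * s * real n else 0) else 0)" for k s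
      using qq by (auto simp: X_def)
    then show ?thesis using that by (simp add: sum\<Omega> card sum.distrib)
  qed
  have ipX: "ip n z (X (k, s)) = s * q * z k" if "k < n" for z k s
    using that by (simp add: ip_def X_def if_distrib cong: if_cong)
  have \<beta>: "1 \<le> \<beta>" "ln (real (card Ys)) \<le> \<beta>" by (simp_all add: \<beta>_def)
  obtain T Ti D Di v V w where dp: "dual_pair n T Ti D Di" and v: "v \<in> Rn n"
    and V0: "\<And>\<omega>. \<omega> \<in> \<Omega> \<Longrightarrow> 0 \<le> V \<omega>" and V2: "(\<Sum>\<omega>\<in>\<Omega>. V \<omega>) \<le> 2 * real (card \<Omega>)"
    and Vup: "\<And>\<omega> y. \<omega> \<in> \<Omega> \<Longrightarrow> y \<in> Ys \<Longrightarrow> ip n (T y) (X \<omega>) + ip n y v \<le> V \<omega>"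
    and e0: "\<And>b. b < n \<Longrightarrow> (\<Sum>\<omega>\<in>\<Omega>. sm ((\<lambda>y. T (\<beta> *\<^sub>R y)) ` Ys) (\<lambda>\<eta>. w \<eta> + ip n \<eta> (X \<omega>)) (\<lambda>\<eta>. \<eta> b)) = 0"
    and e1: "\<And>a b. a < n \<Longrightarrow> b < n \<Longrightarrow> (\<Sum>\<omega>\<in>\<Omega>. sm ((\<lambda>y. T (\<beta> *\<^sub>R y)) ` Ys) (\<lambda>\<eta>. w \<eta> + ip n \<eta> (X \<omega>)) (\<lambda>\<eta>. \<eta> b) * X \<omega> a)
      = (if a = b then real (card \<Omega>) * (\<beta> / real n) else 0)"
    by (rule gauge_position[OF n1 \<Omega> X0 X2 Ys c0 \<beta>]) blast+
  \<comment> \<open>The sample has only \<open>2 * n\<close> points, so a mean of at most 2 bounds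
    every single value of the nonnegative \<open>V\<close>. The sample of \<open>gau\<close> is too
    large for such a conclusion.\<close>
  have Vle: "V \<omega> \<le> 4 * real n" if "\<omega> \<in> \<Omega>" for \<omega>
    using member_le_sum[of \<omega> \<Omega> V] that V0 \<Omega> V2 card by fastforce
  have coord: "q * \<bar>T y k\<bar> + ip n y v \<le> 4 * real n" if y: "y \<in> Ys" and k: "k < n" for y k
  proof -
    define s :: real where "s = (if 0 \<le> T y k then 1 else -1)"
    have \<omega>: "(k, s) \<in> \<Omega>" using k by (simp add: \<Omega>_def s_def)
    have "ip n (T y) (X (k, s)) = q * \<bar>T y k\<bar>" using ipX[OF k] by (simp add: s_def)
    then show ?thesis using Vup[OF \<omega> y] Vle[OF \<omega>] by linarith
  qed
  have rad: "nrm n (D x) \<le> real n * q" if x: "x \<in> B" for x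
  proof -
    let ?\<nu> = "nrm n (D x)"
    have \<eta>: "ip n \<eta> (D x) \<le> \<beta>" if \<eta>Y: "\<eta> \<in> (\<lambda>y. T (\<beta> *\<^sub>R y)) ` Ys" for \<eta>
    proof -
      obtain y where y: "y \<in> Ys" "\<eta> = T (\<beta> *\<^sub>R y)" using \<eta>Y by blast
      have "ip n \<eta> (D x) = \<beta> * ip n y x" unfolding y(2) dual_pair_simps(5)[OF dp] ip_scaleR_left ..
      also have "\<dots> \<le> \<beta> * 1" using \<beta>(1) dual[OF x y(1)] by (intro mult_left_mono) auto
      finally show ?thesis by simp
    qed
    have fin: "finite ((\<lambda>y. T (\<beta> *\<^sub>R y)) ` Ys)" "(\<lambda>y. T (\<beta> *\<^sub>R y)) ` Ys \<noteq> {}" using Ys by auto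
    have \<beta>0: "0 < \<beta>" using \<beta>(1) by simp
    obtain g where g: "\<And>\<omega>. 0 \<le> g \<omega>" "(\<Sum>\<omega>\<in>\<Omega>. g \<omega>) = real (card \<Omega>)"
      "(\<Sum>\<omega>\<in>\<Omega>. g \<omega> * ip n (X \<omega>) (D x)) = - (real (card \<Omega>) * ip n (D x) (D x) / real n)"
      by (rule dual_weights[OF n1 \<Omega> fin \<beta>0 X0 e0 e1 \<eta>]) blast+
    have "real (card \<Omega>) * (?\<nu> * ?\<nu>) / real n = (\<Sum>\<omega>\<in>\<Omega>. g \<omega> * - ip n (X \<omega>) (D x))"
      using g(3) by (simp add: nrm_square sum_negf)
    also have "\<dots> \<le> (\<Sum>\<omega>\<in>\<Omega>. g \<omega> * (q * ?\<nu>))"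
    proof (intro sum_mono mult_left_mono g(1))
      fix \<omega> assume "\<omega> \<in> \<Omega>"
      then obtain k s where \<omega>: "\<omega> = (k, s)" "k < n" "\<bar>s\<bar> = 1" by (auto simp: \<Omega>_def)
      have "\<bar>ip n (X \<omega>) (D x)\<bar> = q * \<bar>D x k\<bar>"
        unfolding \<omega>(1) ip_commute[of n "X _"] ipX[OF \<omega>(2)] using q0 \<omega>(3) by (simp add: abs_mult)
      also have "\<dots> \<le> q * ?\<nu>" using q0 abs_coord_le_nrm[OF \<omega>(2)] by (intro mult_left_mono) auto
      finally show "- ip n (X \<omega>) (D x) \<le> q * ?\<nu>" by linarith
    qed
    also have "\<dots> = real (card \<Omega>) * (q * ?\<nu>)" unfolding sum_distrib_right[symmetric] g(2) ..
    finally have "2 * (?\<nu> * ?\<nu>) \<le> 2 * real n * (q * ?\<nu>)" using n1 by (simp add: card)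
    then have "?\<nu> * ?\<nu> \<le> ?\<nu> * (real n * q)" by (simp add: ac_simps)
    then show ?thesis by (rule le_if_mult_self_le) (use q0 in simp_all)
  qed
  \<comment> \<open>On the net \<open>v\<close> is at most \<open>4 * n\<close>. The factor brings
    this down to \<open>1/4\<close> and leaves room for the reflected point.\<close>
  define c where "c = (1 / (16 * real n)) *\<^sub>R v"
  have cy: "ip n y c \<le> 1/4" if "y \<in> Ys" for y
  proof -
    have "0 \<le> q * \<bar>T y 0\<bar>" using q0 by simp
    moreover have "q * \<bar>T y 0\<bar> + ip n y v \<le> 4 * real n" using n1 by (intro coord that) simp
    ultimately have "ip n y v \<le> 4 * real n" by linarith
    then show ?thesis using n1 by (simp add: c_def ip_scaleR_right divide_le_eq)
  qed
  have cR: "c \<in> Rn n" using v by (simp add: c_def Rn_def scaleR_fun_def)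
  have cB: "c \<in> B"
  proof -
    have "(\<lambda>i. 1/4 * (4 * c i)) \<in> B"
    proof (rule quart)
      show "(\<lambda>i. 4 * c i) \<in> Rn n" using cR by (simp add: Rn_def)
      show "ip n y (\<lambda>i. 4 * c i) \<le> 2" if "y \<in> Ys" for y using cy[OF that] by (simp add: ip_cmult_right)
    qed
    then show ?thesis by simp
  qed
  show thesis
  proof (rule that[OF cB])
    fix x assume x: "x \<in> B"
    have n0: "0 < real n" using n1 by simp
    \<comment> \<open>Each coordinate of \<open>T y\<close> is at most
      \<open>16 * n * (1 - ?t) / q\<close> and each one of \<open>D (x - c)\<close> at most
      \<open>2 * n * q\<close>; summed over \<open>n\<close> coordinates this is
      \<open>32 * n^3 * (1 - ?t)\<close>. The further factor 3 keeps the reflected point within a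
      third of the remaining distance.\<close>
    define \<Lambda> where "\<Lambda> = 96 * real n ^ 3"
    have \<Lambda>0: "0 < \<Lambda>" using n0 by (simp add: \<Lambda>_def)
    let ?w = "\<lambda>i. c i - (x i - c i) / \<Lambda>"
    have "(\<lambda>i. 1/4 * (4 * ?w i)) \<in> B"
    proof (rule quart)
      have "x \<in> Rn n" using x sub by blast
      then show "(\<lambda>i. 4 * ?w i) \<in> Rn n" using cR by (simp add: Rn_def)
      fix y assume y: "y \<in> Ys"
      let ?t = "ip n y c"
      have "- ip n y (x - c) = - ip n (T y) (D (x - c))" by (simp only: dual_pair_simps(5)[OF dp])
      also have "\<dots> \<le> (\<Sum>k<n. \<bar>T y k\<bar> * \<bar>D (x - c) k\<bar>)"
        unfolding ip_def sum_negf[symmetric] by (intro sum_mono) (metis abs_ge_minus_self abs_mult)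
      also have "\<dots> \<le> (\<Sum>k<n. 16 * real n * (1 - ?t) / q * (2 * (real n * q)))"
      proof (rule sum_mono)
        fix k assume "k \<in> {..<n}"
        then have k: "k < n" by simp
        have "q * \<bar>T y k\<bar> \<le> 4 * real n - 16 * real n * ?t"
          using coord[OF y k] n0 by (simp add: c_def ip_scaleR_right)
        also have "\<dots> \<le> 16 * real n * (1 - ?t)" using n0 by (simp add: algebra_simps)
        finally have 1: "\<bar>T y k\<bar> \<le> 16 * real n * (1 - ?t) / q" using q0 by (simp add: pos_le_divide_eq mult.commute)
        have "\<bar>D (x - c) k\<bar> \<le> \<bar>D x k\<bar> + \<bar>D c k\<bar>" by (simp add: dual_pair_simps[OF dp])
        also have "\<dots> \<le> real n * q + real n * q"
          using abs_coord_le_nrm[OF k, of "D x"] abs_coord_le_nrm[OF k, of "D c"] rad[OF x] rad[OF cB] by linarith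
        finally have 2: "\<bar>D (x - c) k\<bar> \<le> 2 * (real n * q)" by (simp only: mult_2)
        show "\<bar>T y k\<bar> * \<bar>D (x - c) k\<bar> \<le> 16 * real n * (1 - ?t) / q * (2 * (real n * q))"
          using 1 2 by (intro mult_mono) auto
      qed
      also have "\<dots> = 32 * real n ^ 3 * (1 - ?t)" using q0 by (simp add: power3_eq_cube)
      finally have "- ip n y (x - c) / \<Lambda> \<le> 32 * real n ^ 3 * (1 - ?t) / \<Lambda>" using \<Lambda>0 by (intro divide_right_mono) auto
      also have "\<dots> = (1 - ?t) / 3" using n0 by (simp add: \<Lambda>_def)
      finally have "?t - ip n y (x - c) / \<Lambda> \<le> 1/2" using cy[OF y] by (simp add: field_simps)
      moreover have "ip n y ?w = ?t - ip n y (x - c) / \<Lambda>"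
        by (simp add: ip_def right_diff_distrib sum_subtractf sum_divide_distrib diff_divide_distrib)
      ultimately have "4 * ip n y ?w \<le> 2" by simp
      then show "ip n y (\<lambda>i. 4 * ?w i) \<le> 2" by (simp only: ip_cmult_right)
    qed
    moreover have "1/4 * (4 * z) = z" for z :: real by simp
    ultimately show "(\<lambda>i. c i - (x i - c i) / (96 * real n ^ 3)) \<in> B" by (simp only: \<Lambda>_def)
  qed
qed

text \<open>A polynomial loss in the reflection suffices, since it enters the final bound only
  through the logarithm of the radii.\<close>

locale centred_body = body +
  assumes neg: "\<And>x. x \<in> B \<Longrightarrow> (\<lambda>i. - x i / (96 * real n ^ 3)) \<in> B"

lemma compact_translate:
  fixes B :: "(nat \<Rightarrow> real) set"
  assumes "compact B"
  shows "compact ((\<lambda>x i. x i - c i) ` B)"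
  by (intro compact_continuous_image assms continuous_on_coordinatewise_then_product continuous_intros
      continuous_on_subset[OF continuous_on_product_coordinates]) auto

lemma body_translate:
  assumes n1: "1 \<le> n" and sub: "B \<subseteq> Rn n" and cpt: "compact B"
    and cvx: "\<And>x y t. x \<in> B \<Longrightarrow> y \<in> B \<Longrightarrow> 0 \<le> t \<Longrightarrow> t \<le> 1 \<Longrightarrow> (\<lambda>i. t * x i + (1 - t) * y i) \<in> B"
    and c: "c \<in> Rn n" and r': "0 < r'" and L': "\<And>x i. x \<in> B \<Longrightarrow> \<bar>x i - c i\<bar> \<le> L'"
    and box': "\<And>z. z \<in> Rn n \<Longrightarrow> (\<And>i. i < n \<Longrightarrow> \<bar>z i - c i\<bar> \<le> r') \<Longrightarrow> z \<in> B"
  shows "body n ((\<lambda>x i. x i - c i) ` B) r' L'"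
proof
  show "1 \<le> n" by (rule n1)
  show "(\<lambda>x i. x i - c i) ` B \<subseteq> Rn n" using sub c by (auto simp: Rn_def)
  show "compact ((\<lambda>x i. x i - c i) ` B)" by (rule compact_translate[OF cpt])
  fix x y and t :: real
  assume xy: "x \<in> (\<lambda>x i. x i - c i) ` B" "y \<in> (\<lambda>x i. x i - c i) ` B" and t: "0 \<le> t" "t \<le> 1"
  then obtain x' y' where "x' \<in> B" "y' \<in> B" "x = (\<lambda>i. x' i - c i)" "y = (\<lambda>i. y' i - c i)" by blast
  then show "(\<lambda>i. t * x i + (1 - t) * y i) \<in> (\<lambda>x i. x i - c i) ` B"
    using cvx[of x' y' t] t by (intro image_eqI[of _ _ "\<lambda>i. t * x' i + (1 - t) * y' i"]) (auto simp: algebra_simps)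
next
  show "0 < r'" by (rule r')
  fix z assume z: "z \<in> Rn n" "\<And>i. i < n \<Longrightarrow> \<bar>z i\<bar> \<le> r'"
  have "(\<lambda>i. z i + c i) \<in> B" using z c by (intro box') (auto simp: Rn_def)
  then show "z \<in> (\<lambda>x i. x i - c i) ` B" by (intro image_eqI[of _ _ "\<lambda>i. z i + c i"]) auto
next
  fix x i assume "x \<in> (\<lambda>x i. x i - c i) ` B"
  then show "\<bar>x i\<bar> \<le> L'" using L' by auto
qed

lemma (in body) centred_translate:
  obtains c r' L' where "c \<in> Rn n" "centred_body n ((\<lambda>x i. x i - c i) ` B) r' L'"
proof -
  obtain c where c: "c \<in> B" "\<And>x. x \<in> B \<Longrightarrow> (\<lambda>i. c i - (x i - c i) / (96 * real n ^ 3)) \<in> B"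
    using center_exists by blast
  define \<Lambda> where "\<Lambda> = 96 * real n ^ 3"
  have \<Lambda>0: "0 < \<Lambda>" using n1 by (simp add: \<Lambda>_def)
  have cR: "c \<in> Rn n" using c(1) sub by blast
  \<comment> \<open>The point opposite to the origin as seen from \<open>c\<close>. As the origin
    has a box around it in \<open>B\<close>, the intermediate point \<open>c\<close> has one shrunk
    by \<open>\<Lambda> + 1\<close>.\<close>
  have refl: "(\<lambda>i. c i + c i / \<Lambda>) \<in> B" using c(2)[OF zero_in] by (simp add: \<Lambda>_def)
  define r' where "r' = r / (\<Lambda> + 1)"
  have "body n ((\<lambda>x i. x i - c i) ` B) r' (2 * L)"
  proof (rule body_translate[OF n1 sub cpt cvx cR])
    show "0 < r'" using r0 \<Lambda>0 by (simp add: r'_def)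
    show "\<bar>x i - c i\<bar> \<le> 2 * L" if "x \<in> B" for x i using bd[OF that, of i] bd[OF c(1), of i] by linarith
    fix z assume z: "z \<in> Rn n" "\<And>i. i < n \<Longrightarrow> \<bar>z i - c i\<bar> \<le> r'"
    let ?y = "\<lambda>i. (\<Lambda> + 1) * (z i - c i)"
    have yB: "?y \<in> B"
    proof (rule box)
      show "?y \<in> Rn n" using z(1) cR by (simp add: Rn_def)
      show "\<bar>?y i\<bar> \<le> r" if "i < n" for i
        using z(2)[OF that] \<Lambda>0 by (simp add: r'_def abs_mult pos_le_divide_eq mult.commute)
    qed
    define t where "t = \<Lambda> / (\<Lambda> + 1)"
    have t: "0 \<le> t" "t \<le> 1" using \<Lambda>0 by (simp_all add: t_def)
    have "(\<lambda>i. t * (c i + c i / \<Lambda>) + (1 - t) * ?y i) \<in> B" by (rule cvx[OF refl yB t])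
    moreover have "t * (c i + c i / \<Lambda>) + (1 - t) * ?y i = z i" for i
    proof -
      have "c i + c i / \<Lambda> = c i * ((\<Lambda> + 1) / \<Lambda>)" using \<Lambda>0 by (simp add: field_simps)
      then have 1: "t * (c i + c i / \<Lambda>) = c i" using \<Lambda>0 by (simp add: t_def)
      have "(1 - t) * (\<Lambda> + 1) = 1" using \<Lambda>0 by (simp add: t_def field_simps)
      then have 2: "(1 - t) * ?y i = z i - c i" by (simp only: mult.assoc[symmetric] mult_1)
      show ?thesis unfolding 1 2 by simp
    qed
    ultimately show "z \<in> B" by simp
  qed
  moreover have "(\<lambda>i. - x i / (96 * real n ^ 3)) \<in> (\<lambda>x i. x i - c i) ` B" if xx: "x \<in> (\<lambda>x i. x i - c i) ` B" for x
  proof -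
    obtain y where "y \<in> B" "x = (\<lambda>i. y i - c i)" using xx by blast
    then show ?thesis by (intro image_eqI[OF _ c(2)[of y]]) (auto simp: diff_divide_distrib)
  qed
  ultimately have "centred_body n ((\<lambda>x i. x i - c i) ` B) r' (2 * L)"
    by (simp add: centred_body_def centred_body_axioms_def)
  then show thesis by (rule that[OF cR])
qed

section \<open>Good positions of convex bodies\<close>

lemma nrm_diff_le: "nrm n (x - y) \<le> nrm n x + nrm n y"
proof -
  have "ip n (x - y) (x - y) = ip n x x - 2 * ip n x y + ip n y y"
    by (simp add: ip_def algebra_simps sum.distrib sum_subtractf sum_distrib_left)
  also have "\<dots> \<le> nrm n x * nrm n x + 2 * (nrm n x * nrm n y) + nrm n y * nrm n y"
    using ip_cauchy_schwarz[of n x y] by (simp add: nrm_square abs_le_iff)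
  also have "\<dots> = (nrm n x + nrm n y)\<^sup>2" by (simp add: power2_eq_square algebra_simps)
  finally have "sqrt (ip n (x - y) (x - y)) \<le> sqrt ((nrm n x + nrm n y)\<^sup>2)" by (rule real_sqrt_le_mono)
  then show ?thesis by (simp add: nrm_def[of n "x - y"])
qed

lemma avg_eps_grid:
  assumes "a < n" "b < n" "k < N" "l < N"
  shows "avg (grid n N) (\<lambda>A. eps (a, k) A * eps (b, l) A) = (if a = b \<and> k = l then 1 else 0)"
  using assms by (subst avg_eps_mult) (auto simp: grid_def)

lemma gau_isotropic:
  assumes N: "1 \<le> N"
  shows "a < n \<Longrightarrow> (\<Sum>A\<in>Pow (grid n N). gau N A a) = 0"
    and "a < n \<Longrightarrow> b < n \<Longrightarrow> (\<Sum>A\<in>Pow (grid n N). gau N A a * gau N A b) = (if a = b then real (card (Pow (grid n N))) else 0)"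
proof -
  have c: "real (card (Pow (grid n N))) = 2 ^ card (grid n N)" by (simp add: card_Pow)
  have r: "sqrt (real N) * sqrt (real N) = real N" by simp
  show "(\<Sum>A\<in>Pow (grid n N). gau N A a) = 0" if a: "a < n"
  proof -
    have "avg (grid n N) (\<lambda>A. gau N A a) = avg (grid n N) (\<lambda>A. ip n (\<lambda>i. if i = a then 1 else 0) (gau N A))"
    proof (intro avg_cong)
      fix A
      have "ip n (\<lambda>i. if i = a then 1 else 0) (gau N A) = (\<Sum>i<n. if i = a then gau N A i else 0)"
        unfolding ip_def by (intro sum.cong) auto
      then show "gau N A a = ip n (\<lambda>i. if i = a then 1 else 0) (gau N A)" using a by simp
    qed
    also have "\<dots> = 0" by (rule avg_ip_gau)
    finally show ?thesis by (simp add: avg_def)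
  qed
  assume a: "a < n" and b: "b < n"
  have "avg (grid n N) (\<lambda>A. gau N A a * gau N A b)
      = avg (grid n N) (\<lambda>A. \<Sum>k<N. \<Sum>l<N. (1 / real N) * (eps (a, k) A * eps (b, l) A))"
    by (intro avg_cong) (simp add: gau_def sum_product sum_divide_distrib)
  also have "\<dots> = (\<Sum>k<N. \<Sum>l<N. (1 / real N) * (if a = b \<and> k = l then 1 else 0))"
    unfolding avg_sum avg_cmult using a b by (intro sum.cong refl) (simp add: avg_eps_grid)
  also have "\<dots> = (if a = b then 1 else 0)" using N by (cases "a = b") (simp_all add: if_distrib cong: if_cong)
  finally show "(\<Sum>A\<in>Pow (grid n N). gau N A a * gau N A b) = (if a = b then real (card (Pow (grid n N))) else 0)"
    unfolding c by (simp add: avg_def divide_eq_eq split: if_splits)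
qed

text \<open>\<open>Xh\<close> and \<open>Yh\<close> are nets of \<open>K\<close> and its polar up to constants, \<open>HX\<close> and \<open>HY\<close> majorise the support
  functions of the nets at the random vector; \<open>M\<close> must not depend on \<open>N\<close>.\<close>

definition good_data :: "nat \<Rightarrow> nat \<Rightarrow> nat \<Rightarrow> real \<Rightarrow> (nat \<Rightarrow> real) set \<Rightarrow> (nat \<Rightarrow> real) set \<Rightarrow> (nat \<Rightarrow> real) set
    \<Rightarrow> ((nat \<times> nat) set \<Rightarrow> real) \<Rightarrow> ((nat \<times> nat) set \<Rightarrow> real) \<Rightarrow> bool"
  where "good_data n N M W K Xh Yh HX HY \<longleftrightarrow>
    finite Xh \<and> Xh \<noteq> {} \<and> finite Yh \<and> Yh \<noteq> {} \<and> card Xh \<le> M \<and> card Yh \<le> M \<and>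
    (\<forall>x\<in>Xh. nrm n x \<le> 96 * W) \<and> (\<forall>y\<in>Yh. nrm n y \<le> 4) \<and>
    (\<forall>A\<subseteq>grid n N. 0 \<le> HX A \<and> 0 \<le> HY A \<and> (\<forall>x\<in>Xh. ip n x (gau N A) \<le> HX A) \<and> (\<forall>y\<in>Yh. ip n y (gau N A) \<le> HY A)) \<and>
    avg (grid n N) HX \<le> 16 * W \<and> avg (grid n N) HY \<le> 3 \<and>
    (\<forall>\<phi>. \<forall>w\<in>K. \<exists>x\<in>Xh. ip n \<phi> w \<le> 3 * ip n \<phi> x) \<and>
    (\<forall>w\<in>Rn n. \<forall>t>0. (\<forall>y\<in>Yh. ip n y w \<le> t) \<longrightarrow> (\<exists>k\<in>K. w = (3 * t) *\<^sub>R k))"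

lemma good_dataD:
  assumes "good_data n N M W K X Y HX HY"
  shows "finite X" "X \<noteq> {}" "finite Y" "Y \<noteq> {}" "card X \<le> M" "card Y \<le> M"
    "x \<in> X \<Longrightarrow> nrm n x \<le> 96 * W" "y \<in> Y \<Longrightarrow> nrm n y \<le> 4"
    "A \<subseteq> grid n N \<Longrightarrow> 0 \<le> HX A" "A \<subseteq> grid n N \<Longrightarrow> 0 \<le> HY A"
    "A \<subseteq> grid n N \<Longrightarrow> x \<in> X \<Longrightarrow> ip n x (gau N A) \<le> HX A" "A \<subseteq> grid n N \<Longrightarrow> y \<in> Y \<Longrightarrow> ip n y (gau N A) \<le> HY A"
    "avg (grid n N) HX \<le> 16 * W" "avg (grid n N) HY \<le> 3"
    "w \<in> K \<Longrightarrow> \<exists>x\<in>X. ip n \<phi> w \<le> 3 * ip n \<phi> x"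
    "w \<in> Rn n \<Longrightarrow> 0 < t \<Longrightarrow> (\<And>y. y \<in> Y \<Longrightarrow> ip n y w \<le> t) \<Longrightarrow> \<exists>k\<in>K. w = (3 * t) *\<^sub>R k"
  using assms unfolding good_data_def by simp_all

definition good_position :: "nat \<Rightarrow> nat \<Rightarrow> nat \<Rightarrow> real \<Rightarrow> (nat \<Rightarrow> real) set \<Rightarrow> bool"
  where "good_position n N M W K \<longleftrightarrow> (\<exists>X Y HX HY. good_data n N M W K X Y HX HY)"

text \<open>Map and translation may vary with \<open>N\<close>, as the random vector does. Only the
  sizes of the nets have to be known when \<open>N\<close> is chosen.\<close>

definition positionable :: "nat \<Rightarrow> nat \<Rightarrow> nat \<Rightarrow> real \<Rightarrow> (nat \<Rightarrow> real) set \<Rightarrow> bool"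
  where "positionable n N M W K \<longleftrightarrow>
    (\<exists>S Si x. linear S \<and> linear Si \<and> range S \<subseteq> Rn n \<and> range Si \<subseteq> Rn n \<and>
      (\<forall>z\<in>Rn n. S (Si z) = z \<and> Si (S z) = z) \<and> x \<in> Rn n \<and> good_position n N M W (S ` (\<lambda>z. x + z) ` K))"

lemma positionable_translate:
  assumes "positionable n N M W ((\<lambda>x i. x i - c i) ` K)" and c: "c \<in> Rn n"
  shows "positionable n N M W K"
proof -
  obtain S Si u where S: "linear S" "linear Si" "range S \<subseteq> Rn n" "range Si \<subseteq> Rn n"
    "\<forall>z\<in>Rn n. S (Si z) = z \<and> Si (S z) = z" "u \<in> Rn n" "good_position n N M W (S ` (\<lambda>z. u + z) ` (\<lambda>x i. x i - c i) ` K)"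
    using assms(1) unfolding positionable_def by (elim exE conjE)
  have "u + (\<lambda>i. z i - c i) = (u - c) + z" for z by (simp add: fun_eq_iff)
  then have "S ` (\<lambda>z. u + z) ` (\<lambda>x i. x i - c i) ` K = S ` (\<lambda>z. (u - c) + z) ` K" by (simp only: image_image)
  moreover have "u - c \<in> Rn n" using S(6) c by (simp add: Rn_def)
  ultimately show ?thesis unfolding positionable_def using S by (intro exI[of _ S] exI[of _ Si] exI[of _ "u - c"]) simp
qed

context centred_body
begin

definition \<Lambda> :: real where "\<Lambda> = 96 * real n ^ 3"
text \<open>A bound for the norm of \<open>T y\<close> on the polar net:
  \<open>16/9 * (4 + 8 * \<Lambda>)\<close>, with \<open>16/9\<close> rounded up to 2.\<close>

definition Fb :: real where "Fb = 8 + 16 * \<Lambda>"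
definition Rb :: real where "Rb = 4 * (real n)\<^sup>2 * Fb + 1"

lemma \<Lambda>_pos: "0 < \<Lambda>"
  using n1 by (simp add: \<Lambda>_def)

lemma Fb_ge: "8 \<le> Fb"
  using \<Lambda>_pos by (simp add: Fb_def)

lemma Rb_ge: "Fb \<le> Rb" "1 \<le> Rb"
proof -
  have "1 \<le> (real n)\<^sup>2" using n1 by simp
  then have "1 * Fb \<le> (4 * (real n)\<^sup>2) * Fb" using Fb_ge by (intro mult_right_mono) auto
  then show "Fb \<le> Rb" by (simp add: Rb_def)
  then show "1 \<le> Rb" using Fb_ge by simp
qed

text \<open>The origin of the truncation degree: \<open>n * Rb^2\<close> is at most
  \<open>6177^2 * n^11\<close>, where \<open>n \<le> 2^l\<close> and
  \<open>6177^2 \<le> 2^26\<close>, and \<open>37 = 26 + 11\<close>.\<close>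

lemma dimension_count:
  assumes l: "1 \<le> l" "n \<le> 2 ^ l"
  shows "real n * Rb\<^sup>2 / 2 ^ (37 * l) \<le> 1"
proof -
  define p where "p = (2::real) ^ l"
  have p2: "2 \<le> p" unfolding p_def using power_increasing[of 1 l "2::real"] l(1) by simp
  have np: "real n \<le> p" using l(2) unfolding p_def by (metis of_nat_le_iff of_nat_numeral of_nat_power)
  have n0: "1 \<le> real n" using n1 by simp
  have "Fb \<le> 1544 * real n ^ 3" using one_le_power[OF n0, of 3] by (simp add: Fb_def \<Lambda>_def)
  then have "4 * (real n)\<^sup>2 * Fb \<le> 4 * (real n)\<^sup>2 * (1544 * real n ^ 3)" by (intro mult_left_mono) auto
  also have "\<dots> = 6176 * real n ^ 5" by (simp add: eval_nat_numeral)
  finally have "4 * (real n)\<^sup>2 * Fb + 1 \<le> 6177 * real n ^ 5" using one_le_power[OF n0, of 5] by linarith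
  then have "Rb \<le> 6177 * real n ^ 5" by (simp only: Rb_def)
  then have "Rb\<^sup>2 \<le> (6177 * real n ^ 5)\<^sup>2" using Rb_ge by (intro power_mono) auto
  then have "real n * Rb\<^sup>2 \<le> real n * (6177 * real n ^ 5)\<^sup>2" by (intro mult_left_mono) auto
  also have "\<dots> = 6177\<^sup>2 * real n ^ 11" by (simp add: power_mult_distrib eval_nat_numeral)
  also have "\<dots> \<le> 2 ^ 26 * p ^ 11" using np by (intro mult_mono power_mono) auto
  also have "\<dots> \<le> p ^ 26 * p ^ 11" using p2 by (intro mult_right_mono power_mono) auto
  also have "\<dots> = 2 ^ (37 * l)" by (simp add: p_def flip: power_add power_mult)
  finally show ?thesis by (simp add: divide_le_eq)
qed

text \<open>Radii are estimated twice. Crude polynomial bounds, \<open>TF\<close> and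
  \<open>radius\<close>, make the width estimate possible; the width then yields the bounds
  \<open>Xrad\<close> and \<open>Brad\<close> that are used afterwards. The constant is
  \<open>21905 = 16 * 37^2 + 1\<close>, the last unit being the entropy of the net.\<close>

proposition good_position_exists:
  assumes l: "1 \<le> l" "n \<le> 2 ^ l"
  shows "\<exists>M N0. \<forall>N\<ge>N0. positionable n N M (21905 * (real l)\<^sup>2 * real n) B"
proof -
  define W where "W = 21905 * (real l)\<^sup>2 * real n"
  obtain Xs Ys c0 where Xs: "finite Xs" "Xs \<subseteq> B" "(\<lambda>_. 0) \<in> Xs"
    and Ys: "finite Ys" "Ys \<noteq> {}" "Ys \<subseteq> Rn n"
    and dual: "\<And>x y. x \<in> B \<Longrightarrow> y \<in> Ys \<Longrightarrow> ip n y x \<le> 1"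
    and supp: "\<And>\<phi> z. z \<in> B \<Longrightarrow> \<exists>x\<in>Xs. ip n \<phi> z \<le> 2 * ip n \<phi> x"
    and quart: "\<And>w. w \<in> Rn n \<Longrightarrow> (\<And>y. y \<in> Ys \<Longrightarrow> ip n y w \<le> 2) \<Longrightarrow> (\<lambda>i. 1/4 * w i) \<in> B"
    and c0: "0 < c0" "\<And>z i. i < n \<Longrightarrow> \<exists>y\<in>Ys. c0 * \<bar>z i\<bar> \<le> ip n y z"
    by (rule nets) blast
  have quart': "(1/4) *\<^sub>R w \<in> B" if "w \<in> Rn n" "\<And>y. y \<in> Ys \<Longrightarrow> ip n y w \<le> 2" for w
    using quart[OF that] by (simp add: scaleR_fun_def)
  have n0: "0 < real n" using n1 by simp
  have Xne: "Xs \<noteq> {}" using Xs(3) by blast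
  have XsR: "Xs \<subseteq> Rn n" using Xs(2) sub by blast
  define \<beta> where "\<beta> = max 1 (max (ln (real (card Ys))) (ln (real (card Xs))))"
  have \<beta>: "1 \<le> \<beta>" "ln (real (card Ys)) \<le> \<beta>" "ln (real (card Xs)) \<le> \<beta>" by (simp_all add: \<beta>_def)
  have \<beta>0: "0 < \<beta>" using \<beta>(1) by simp
  define R where "R = \<beta> * Rb"
  have R1: "1 \<le> R" unfolding R_def using mult_mono[of 1 \<beta> 1 Rb] \<beta>(1) Rb_ge(2) by simp
  obtain N0 :: nat where N0: "16 * R\<^sup>2 + (4352 * (real n)\<^sup>2 * R ^ 6)\<^sup>2 < real N0" using reals_Archimedean2 by blast
  define M where "M = card Xs + card Ys"
  show ?thesis
  proof (rule exI[of _ M], rule exI[of _ N0], intro allI impI)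
    fix N assume NN: "N0 \<le> N"
    let ?J = "grid n N"
    let ?\<Omega> = "Pow ?J"
    have big: "16 * R\<^sup>2 + (4352 * (real n)\<^sup>2 * R ^ 6)\<^sup>2 \<le> real N" using N0 NN by (simp add: order.strict_implies_order order_less_le_trans)
    have N16: "16 * R\<^sup>2 \<le> real N" using big zero_le_power2[of "4352 * (real n)\<^sup>2 * R ^ 6"] by linarith
    have "(4352 * (real n)\<^sup>2 * R ^ 6)\<^sup>2 \<le> real N" using big zero_le_power2[of R] by linarith
    then have "sqrt ((4352 * (real n)\<^sup>2 * R ^ 6)\<^sup>2) \<le> sqrt (real N)" by (rule real_sqrt_le_mono)
    then have Nsq: "4352 * (real n)\<^sup>2 * R ^ 6 \<le> sqrt (real N)" by (simp only: real_sqrt_abs)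
    have N1: "1 \<le> N"
    proof -
      have "1 \<le> R\<^sup>2" using R1 by (rule one_le_power)
      then show ?thesis using N16 by simp
    qed
    have \<Omega>: "finite ?\<Omega>" "?\<Omega> \<noteq> {}" by auto
    have card\<Omega>: "real (card ?\<Omega>) = 2 ^ card ?J" by (simp add: card_Pow)
    have avgsum: "(\<Sum>A\<in>?\<Omega>. h A) = real (card ?\<Omega>) * avg ?J h" for h unfolding card\<Omega> by (simp add: avg_def)
    have w0: "0 < real (card ?\<Omega>)" unfolding card\<Omega> by simp
    obtain T Ti D Di v V w where dp: "dual_pair n T Ti D Di" and v: "v \<in> Rn n"
      and V0: "\<And>A. A \<in> ?\<Omega> \<Longrightarrow> 0 \<le> V A" and V2: "(\<Sum>A\<in>?\<Omega>. V A) \<le> 2 * real (card ?\<Omega>)"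
      and Vup: "\<And>A y. A \<in> ?\<Omega> \<Longrightarrow> y \<in> Ys \<Longrightarrow> ip n (T y) (gau N A) + ip n y v \<le> V A"
      and e0: "\<And>b. b < n \<Longrightarrow> (\<Sum>A\<in>?\<Omega>. sm ((\<lambda>y. T (\<beta> *\<^sub>R y)) ` Ys) (\<lambda>\<eta>. w \<eta> + ip n \<eta> (gau N A)) (\<lambda>\<eta>. \<eta> b)) = 0"
      and e1: "\<And>a b. a < n \<Longrightarrow> b < n \<Longrightarrow> (\<Sum>A\<in>?\<Omega>. sm ((\<lambda>y. T (\<beta> *\<^sub>R y)) ` Ys) (\<lambda>\<eta>. w \<eta> + ip n \<eta> (gau N A)) (\<lambda>\<eta>. \<eta> b) * gau N A a)
        = (if a = b then real (card ?\<Omega>) * (\<beta> / real n) else 0)"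
      by (rule gauge_position[OF n1 \<Omega> gau_isotropic[OF N1] Ys c0 \<beta>(1,2)]) blast+
    note dps = dual_pair_simps[OF dp]
    have DR: "D x \<in> Rn n" "T x \<in> Rn n" "Di x \<in> Rn n" "Ti x \<in> Rn n" for x using dp by (auto simp: dual_pair_def)
    have DDi: "D (Di x) = x" "Di (D x) = x" "T (Ti x) = x" "Ti (T x) = x" if "x \<in> Rn n" for x
      using dp that by (auto simp: dual_pair_def)
    have V2': "avg ?J V \<le> 2" using V2 w0 unfolding avgsum by (simp add: mult_le_cancel_left)
    have adj: "\<exists>\<psi>. \<forall>z. ip n g (D z) = ip n \<psi> z" for g
    proof -
      let ?g = "\<lambda>i. if i < n then g i else 0"
      have "?g \<in> Rn n" by (simp add: Rn_def)
      then have "T (Ti ?g) = ?g" by (rule DDi)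
      then have "ip n g (D z) = ip n (Ti ?g) z" for z
        using dps(5)[of "Ti ?g" z] by (simp add: ip_def)
      then show ?thesis by blast
    qed
    define Y1 where "Y1 = (\<lambda>y. T (\<beta> *\<^sub>R y)) ` Ys"
    define X1 where "X1 = (\<lambda>x. D (\<beta> *\<^sub>R x)) ` Xs"
    have Y1: "finite Y1" "Y1 \<noteq> {}" using Ys by (auto simp: Y1_def)
    have X1: "finite X1" "X1 \<noteq> {}" using Xs(1) Xne by (auto simp: X1_def)
    define s where "s y = ip n y v" for y
    have s_le: "s y \<le> 2" if y: "y \<in> Ys" for y
    proof -
      have "s y = avg ?J (\<lambda>A. ip n (T y) (gau N A) + s y)"
        by (simp add: avg_add avg_ip_gau avg_const)
      also have "\<dots> \<le> avg ?J V" using Vup[OF _ y] by (intro avg_mono) (auto simp: s_def)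
      finally show ?thesis using V2' by simp
    qed
    have v4: "(1/4) *\<^sub>R v \<in> B" using v s_le by (intro quart') (auto simp: s_def)
    \<comment> \<open>Here the choice of the centre is used: the shrunk reflection of
      \<open>v / 4\<close> lies in the body.\<close>
    have s_ge: "- s y \<le> 4 * \<Lambda>" if y: "y \<in> Ys" for y
    proof -
      have "(\<lambda>i. - ((1/4) *\<^sub>R v) i / \<Lambda>) \<in> B" using neg[OF v4] by (simp add: \<Lambda>_def)
      then have "ip n y (\<lambda>i. - ((1/4) *\<^sub>R v) i / \<Lambda>) \<le> 1" using dual y by blast
      moreover have "(\<lambda>i. - ((1/4) *\<^sub>R v) i / \<Lambda>) = (- 1 / (4 * \<Lambda>)) *\<^sub>R v" by (simp add: scaleR_fun_def fun_eq_iff)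
      ultimately have "- 1 / (4 * \<Lambda>) * s y \<le> 1" by (simp only: ip_scaleR_right s_def)
      then show ?thesis using \<Lambda>_pos by (simp add: field_simps)
    qed
    \<comment> \<open>Khinchine's inequality, with \<open>|a|\<close> written as twice the positive
      part minus \<open>a\<close>; the pairing \<open>a\<close> has mean zero.\<close>
    have Ty: "9/16 * nrm n (T y) \<le> 4 + 2 * max 0 (- s y)" if y: "y \<in> Ys" for y
    proof -
      let ?a = "\<lambda>A. ip n (T y) (gau N A)"
      have "9/16 * nrm n (T y) \<le> avg ?J (\<lambda>A. \<bar>?a A\<bar>)"
        using avg_abs_ip_gau[OF N1, of n "T y"] by (simp add: nrm_def)
      also have "\<dots> \<le> avg ?J (\<lambda>A. 2 * V A + 2 * max 0 (- s y) - ?a A)"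
      proof (rule avg_mono)
        fix A assume "A \<subseteq> ?J"
        then have "?a A + s y \<le> V A" "0 \<le> V A" using Vup[OF _ y, of A] V0[of A] by (auto simp: s_def)
        then show "\<bar>?a A\<bar> \<le> 2 * V A + 2 * max 0 (- s y) - ?a A" by linarith
      qed
      also have "\<dots> = 2 * avg ?J V + 2 * max 0 (- s y)"
        by (simp add: avg_add avg_diff avg_cmult avg_const avg_ip_gau)
      finally show ?thesis using V2' by linarith
    qed
    have TF: "nrm n (T y) \<le> Fb" if y: "y \<in> Ys" for y
      using Ty[OF y] s_ge[OF y] \<Lambda>_pos by (simp add: Fb_def max_def split: if_splits)
    have radius: "nrm n (D x) \<le> Rb" if x: "x \<in> B" for x
    proof -
      define \<nu> where "\<nu> = nrm n (D x)"
      have ip\<eta>: "ip n (T (\<beta> *\<^sub>R y)) (D x) = \<beta> * ip n y x" for y by (simp only: dps(5) ip_scaleR_left)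
      have \<eta>: "ip n \<eta> (D x) \<le> \<beta>" if \<eta>Y: "\<eta> \<in> Y1" for \<eta>
      proof -
        obtain y where y: "y \<in> Ys" "\<eta> = T (\<beta> *\<^sub>R y)" using \<eta>Y by (auto simp: Y1_def)
        have "\<beta> * ip n y x \<le> \<beta> * 1" using \<beta>0 dual[OF x y(1)] by (intro mult_left_mono) auto
        then show ?thesis unfolding y(2) ip\<eta> by simp
      qed
      have \<eta>': "\<bar>ip n \<eta> (D x)\<bar> \<le> \<beta> * (Fb * \<nu>)" if \<eta>Y: "\<eta> \<in> Y1" for \<eta>
      proof -
        obtain y where y: "y \<in> Ys" "\<eta> = T (\<beta> *\<^sub>R y)" using \<eta>Y by (auto simp: Y1_def)
        have "\<bar>ip n (T y) (D x)\<bar> \<le> nrm n (T y) * \<nu>" unfolding \<nu>_def by (rule ip_cauchy_schwarz)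
        also have "\<dots> \<le> Fb * \<nu>" using TF[OF y(1)] by (intro mult_right_mono) (simp_all add: \<nu>_def)
        finally have "\<beta> * \<bar>ip n (T y) (D x)\<bar> \<le> \<beta> * (Fb * \<nu>)" using \<beta>0 by (intro mult_left_mono) auto
        then show ?thesis unfolding y(2) ip\<eta> using \<beta>0 by (simp add: dps(5) abs_mult)
      qed
      obtain g where g: "\<And>A. 0 \<le> g A" "(\<Sum>A\<in>?\<Omega>. g A) = real (card ?\<Omega>)"
        "(\<Sum>A\<in>?\<Omega>. g A * ip n (gau N A) (D x)) = - (real (card ?\<Omega>) * ip n (D x) (D x) / real n)"
        "\<And>G A. (\<And>\<eta>. \<eta> \<in> Y1 \<Longrightarrow> \<bar>ip n \<eta> (D x)\<bar> \<le> \<beta> * G) \<Longrightarrow> g A \<le> 1 + G"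
        by (rule dual_weights[OF n1 \<Omega> Y1 \<beta>0 gau_isotropic(1)[OF N1] e0[folded Y1_def] e1[folded Y1_def] \<eta>]) blast+
      have gF: "g A \<le> 1 + Fb * \<nu>" for A by (rule g(4)) (rule \<eta>')
      have \<nu>0: "0 \<le> \<nu>" by (simp add: \<nu>_def)
      show ?thesis
      proof (cases "\<nu> = 0")
        case True
        then show ?thesis using Rb_ge by (simp add: \<nu>_def)
      next
        case False
        then have \<nu>p: "0 < \<nu>" using \<nu>0 by simp
        \<comment> \<open>The pairing is split at the level \<open>\<tau> * \<nu>\<close>, and its
          excess is bounded by the square divided by this level. With this \<open>\<tau>\<close> the
          part of the bound that contains \<open>Fb * \<nu>\<close> is half of the left side and can
          be absorbed.\<close>
        define \<tau> where "\<tau> = 2 * real n * Fb"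
        have \<tau>0: "0 < \<tau>" using n0 Fb_ge by (simp add: \<tau>_def)
        let ?a = "\<lambda>A. ip n (gau N A) (D x)"
        have ga: "avg ?J g = 1" using g(2) w0 unfolding avgsum by (simp only: mult_cancel_left2) linarith
        have gx: "avg ?J (\<lambda>A. g A * ?a A) = - (\<nu> * \<nu> / real n)"
        proof -
          have "real (card ?\<Omega>) * avg ?J (\<lambda>A. g A * ?a A) = real (card ?\<Omega>) * - (\<nu> * \<nu> / real n)"
            using g(3) unfolding avgsum by (simp add: \<nu>_def nrm_square)
          then show ?thesis by (rule mult_left_cancel[THEN iffD1, OF less_imp_neq[OF w0, symmetric]])
        qed
        have a2: "avg ?J (\<lambda>A. (?a A)\<^sup>2) = \<nu> * \<nu>"
          using avg_ip_gau_square[OF N1, of n "D x"] by (simp add: ip_commute \<nu>_def nrm_square)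
        have "\<nu> * \<nu> / real n = avg ?J (\<lambda>A. (-1) * (g A * ?a A))" unfolding avg_cmult gx by simp
        also have "\<dots> \<le> avg ?J (\<lambda>A. (\<tau> * \<nu>) * g A + ((1 + Fb * \<nu>) / (\<tau> * \<nu>)) * (?a A)\<^sup>2)"
        proof (rule avg_mono)
          fix A
          have p: "0 < \<tau> * \<nu>" using \<tau>0 \<nu>p by simp
          have "- ?a A \<le> \<tau> * \<nu> + (?a A)\<^sup>2 / (\<tau> * \<nu>)"
          proof -
            have "0 \<le> (?a A)\<^sup>2 + (\<tau> * \<nu> + ?a A)\<^sup>2" by simp
            then have "- ?a A * (\<tau> * \<nu>) \<le> (\<tau> * \<nu>) * (\<tau> * \<nu>) + (?a A)\<^sup>2"
              using zero_le_power2[of "\<tau> * \<nu>"] by (simp add: power2_eq_square algebra_simps)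
            then have "- ?a A \<le> ((\<tau> * \<nu>) * (\<tau> * \<nu>) + (?a A)\<^sup>2) / (\<tau> * \<nu>)" using p by (subst pos_le_divide_eq) auto
            moreover have "(c * c + b) / c = c + b / c" if "0 < c" for b c :: real using that by (simp add: add_divide_distrib)
            ultimately show ?thesis using p by simp
          qed
          then have "g A * - ?a A \<le> g A * (\<tau> * \<nu> + (?a A)\<^sup>2 / (\<tau> * \<nu>))" using g(1) by (rule mult_left_mono)
          also have "\<dots> = (\<tau> * \<nu>) * g A + g A * ((?a A)\<^sup>2 / (\<tau> * \<nu>))" by (simp add: algebra_simps)
          also have "g A * ((?a A)\<^sup>2 / (\<tau> * \<nu>)) \<le> (1 + Fb * \<nu>) * ((?a A)\<^sup>2 / (\<tau> * \<nu>))"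
            using p by (intro mult_right_mono gF) auto
          finally show "-1 * (g A * ?a A) \<le> (\<tau> * \<nu>) * g A + ((1 + Fb * \<nu>) / (\<tau> * \<nu>)) * (?a A)\<^sup>2" by simp
        qed
        also have "\<dots> = (\<tau> * \<nu>) + ((1 + Fb * \<nu>) / (\<tau> * \<nu>)) * (\<nu> * \<nu>)"
          by (simp only: avg_add avg_cmult ga a2 mult_1_right)
        also have "\<dots> = \<nu> * (\<tau> + (1 + Fb * \<nu>) / \<tau>)" using \<nu>p \<tau>0 by (simp add: field_simps)
        finally have "\<nu> * (\<nu> / real n) \<le> \<nu> * (\<tau> + (1 + Fb * \<nu>) / \<tau>)" by simp
        then have "\<nu> / real n \<le> \<tau> + (1 + Fb * \<nu>) / \<tau>" using \<nu>p by (simp only: mult_le_cancel_left_pos)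
        also have "\<dots> = 2 * real n * Fb + 1 / (2 * real n * Fb) + \<nu> / real n / 2"
          using n0 Fb_ge by (simp add: \<tau>_def add_divide_distrib)
        finally have "\<nu> / real n / 2 \<le> 2 * real n * Fb + 1 / (2 * real n * Fb)" by (simp add: field_simps)
        then have "(2 * real n) * (\<nu> / real n / 2) \<le> (2 * real n) * (2 * real n * Fb + 1 / (2 * real n * Fb))"
          using n0 by (intro mult_left_mono) auto
        also have "\<dots> = 4 * (real n)\<^sup>2 * Fb + 1 / Fb" using n0 Fb_ge by (simp add: power2_eq_square distrib_left)
        also have "1 / Fb \<le> 1" using Fb_ge by simp
        finally show ?thesis using n0 by (simp add: Rb_def \<nu>_def)
      qed
    qed
    have width: "avg ?J (\<lambda>A. lse X1 (\<lambda>x. ip n x (gau N A))) \<le> \<beta> * W"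
    proof -
      let ?m = "37 * l"
      have "\<beta> / real n * avg ?J (\<lambda>A. lse X1 (\<lambda>x. ip n x (gau N A)))
        \<le> 16 * (real ?m)\<^sup>2 * \<beta>\<^sup>2 + \<beta> / real n * ln (real (card X1))"
      proof (rule width_bound[where w = w and Ys = Y1 and R = R])
        show "finite X1" "X1 \<noteq> {}" "finite Y1" "Y1 \<noteq> {}" "1 \<le> R" "16 * R\<^sup>2 \<le> real N" "1 \<le> n"
          by (fact X1 Y1 R1 N16 n1)+
        show "ip n x y \<le> \<beta>\<^sup>2" if xx: "x \<in> X1" and yy: "y \<in> Y1" for x y
        proof -
          obtain x' y' where x': "x' \<in> Xs" "x = D (\<beta> *\<^sub>R x')" and y': "y' \<in> Ys" "y = T (\<beta> *\<^sub>R y')"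
            using xx yy by (auto simp: X1_def Y1_def)
          have "ip n x y = \<beta> * \<beta> * ip n y' x'"
            unfolding x'(2) y'(2) ip_commute[of n "D _"] dps(5) by (simp add: ip_scaleR_left ip_scaleR_right)
          also have "\<dots> \<le> \<beta> * \<beta> * 1" using dual[of x' y'] x'(1) y'(1) Xs(2) \<beta>0 by (intro mult_left_mono) auto
          finally show ?thesis by (simp add: power2_eq_square)
        qed
        show "\<bar>x a\<bar> \<le> R" if xx: "x \<in> X1" and a: "a < n" for x a
        proof -
          obtain x' where x': "x' \<in> Xs" "x = D (\<beta> *\<^sub>R x')" using xx by (auto simp: X1_def)
          have "\<bar>x a\<bar> \<le> nrm n x" by (rule abs_coord_le_nrm[OF a])
          also have "\<dots> = \<beta> * nrm n (D x')" unfolding x'(2) dps(2) nrm_scaleR using \<beta>0 by simp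
          also have "\<dots> \<le> \<beta> * Rb" using \<beta>0 radius x'(1) Xs(2) by (intro mult_left_mono) auto
          finally show ?thesis by (simp add: R_def)
        qed
        show "\<bar>y a\<bar> \<le> R" if yy: "y \<in> Y1" and a: "a < n" for y a
        proof -
          obtain y' where y': "y' \<in> Ys" "y = T (\<beta> *\<^sub>R y')" using yy by (auto simp: Y1_def)
          have "\<bar>y a\<bar> \<le> nrm n y" by (rule abs_coord_le_nrm[OF a])
          also have "\<dots> = \<beta> * nrm n (T y')" unfolding y'(2) dps(1) nrm_scaleR using \<beta>0 by simp
          also have "\<dots> \<le> \<beta> * Rb" using \<beta>0 TF[OF y'(1)] Rb_ge(1) by (intro mult_left_mono) auto
          finally show ?thesis by (simp add: R_def)
        qed
        have "1 * sqrt (real N) \<le> \<beta>\<^sup>2 * sqrt (real N)" using \<beta>(1) by (intro mult_right_mono) (auto simp: one_le_power)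
        then show "4352 * (real n)\<^sup>2 * R ^ 6 \<le> \<beta>\<^sup>2 * sqrt (real N)" using Nsq by linarith
        show "avg ?J (\<lambda>A. sm Y1 (\<lambda>y. w y + ip n y (gau N A)) (\<lambda>y. y a)) = 0" if "a < n" for a
          using e0[OF that] by (simp add: avg_def Y1_def)
        show "avg ?J (\<lambda>A. sm Y1 (\<lambda>y. w y + ip n y (gau N A)) (\<lambda>y. y a) * gau N A b) = (if a = b then \<beta> / real n else 0)"
          if "a < n" "b < n" for a b
          using e1[OF that(2,1)] by (simp add: avg_def Y1_def card_Pow)
        show "1 \<le> ?m" using l by simp
        have "real n * R\<^sup>2 / 2 ^ ?m = \<beta>\<^sup>2 * (real n * Rb\<^sup>2 / 2 ^ ?m)" by (simp add: R_def power_mult_distrib)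
        also have "\<dots> \<le> \<beta>\<^sup>2 * 1" by (intro mult_left_mono dimension_count l) auto
        finally show "real n * R\<^sup>2 / 2 ^ ?m \<le> \<beta>\<^sup>2" by simp
        show "0 \<le> \<beta> / real n" using \<beta>0 by simp
      qed
      also have "\<beta> / real n * ln (real (card X1)) \<le> \<beta> / real n * \<beta>"
      proof (rule mult_left_mono)
        have c: "0 < card X1" "card X1 \<le> card Xs" using X1 Xs(1) by (auto simp: card_gt_0_iff X1_def card_image_le)
        then have "ln (real (card X1)) \<le> ln (real (card Xs))" by simp
        then show "ln (real (card X1)) \<le> \<beta>" using \<beta>(3) by simp
      qed (use \<beta>0 in simp)
      finally have "\<beta> / real n * avg ?J (\<lambda>A. lse X1 (\<lambda>x. ip n x (gau N A))) \<le> \<beta> / real n * (\<beta> * (16 * (real ?m)\<^sup>2 * real n + 1))"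
        using n0 by (simp add: power2_eq_square field_simps)
      then have "avg ?J (\<lambda>A. lse X1 (\<lambda>x. ip n x (gau N A))) \<le> \<beta> * (16 * (real ?m)\<^sup>2 * real n + 1)"
        using \<beta>0 n0 by (simp only: mult_le_cancel_left_pos divide_pos_pos)
      also have "\<dots> \<le> \<beta> * W"
      proof (rule mult_left_mono)
        have "1 * 1 \<le> (real l)\<^sup>2 * real n" using l n1 by (intro mult_mono) auto
        then show "16 * (real ?m)\<^sup>2 * real n + 1 \<le> W" by (simp add: W_def power_mult_distrib ac_simps)
      qed (use \<beta>0 in simp)
      finally show ?thesis .
    qed
    define q where "q A = lse X1 (\<lambda>x. ip n x (gau N A)) / \<beta>" for A
    have qavg: "avg ?J q \<le> W"
    proof -
      have "avg ?J q = (1 / \<beta>) * avg ?J (\<lambda>A. lse X1 (\<lambda>x. ip n x (gau N A)))"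
        by (simp add: q_def[abs_def] flip: avg_cmult)
      also have "\<dots> \<le> (1 / \<beta>) * (\<beta> * W)" using \<beta>0 width by (intro mult_left_mono) auto
      finally show ?thesis using \<beta>0 by simp
    qed
    have qge: "ip n (D x) (gau N A) \<le> q A" if x: "x \<in> Xs" for x A
    proof -
      have "ip n (D (\<beta> *\<^sub>R x)) (gau N A) \<le> lse X1 (\<lambda>x. ip n x (gau N A))"
        using x by (intro lse_lower[OF X1(1)]) (simp add: X1_def)
      then have "\<beta> * ip n (D x) (gau N A) \<le> lse X1 (\<lambda>x. ip n x (gau N A))" by (simp only: dps(2) ip_scaleR_left)
      then show ?thesis using \<beta>0 by (simp add: q_def pos_le_divide_eq mult.commute)
    qed
    have D0: "D (\<lambda>_. 0) = (\<lambda>_. 0)"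
      using dps(2)[of 0 "\<lambda>_. 0"] by (simp add: scaleR_fun_def)
    have q0: "0 \<le> q A" for A using qge[OF Xs(3), of A] by (simp add: D0 ip_def)
    have Xrad: "nrm n (D x) \<le> 4 * W" if x: "x \<in> Xs" for x
    proof -
      let ?a = "\<lambda>A. ip n (D x) (gau N A)"
      have "9/16 * nrm n (D x) \<le> avg ?J (\<lambda>A. \<bar>?a A\<bar>)"
        using avg_abs_ip_gau[OF N1, of n "D x"] by (simp add: nrm_def)
      also have "\<dots> \<le> avg ?J (\<lambda>A. 2 * q A - ?a A)"
      proof (rule avg_mono)
        fix A
        show "\<bar>?a A\<bar> \<le> 2 * q A - ?a A" using qge[OF x, of A] q0[of A] by linarith
      qed
      also have "\<dots> = 2 * avg ?J q" by (simp add: avg_diff avg_cmult avg_ip_gau)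
      finally have "9/16 * nrm n (D x) \<le> 2 * W" using qavg by linarith
      then show ?thesis using nrm_nonneg[of n "D x"] by linarith
    qed
    have Brad: "nrm n (D z) \<le> 8 * W" if z: "z \<in> B" for z
    proof -
      obtain \<psi> where \<psi>: "\<And>u. ip n (D z) (D u) = ip n \<psi> u" using adj by blast
      obtain x where x: "x \<in> Xs" "ip n \<psi> z \<le> 2 * ip n \<psi> x" using supp[OF z] by blast
      have "nrm n (D z) * nrm n (D z) \<le> 2 * ip n (D z) (D x)" using x(2) by (simp add: nrm_square \<psi>)
      also have "ip n (D z) (D x) \<le> nrm n (D z) * nrm n (D x)" using ip_cauchy_schwarz[of n "D z" "D x"] by linarith
      also have "\<dots> \<le> nrm n (D z) * (4 * W)" using Xrad[OF x(1)] by (intro mult_left_mono) auto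
      finally have le: "nrm n (D z) * nrm n (D z) \<le> nrm n (D z) * (8 * W)" by simp
      have "0 \<le> W" using Xrad[OF Xs(3)] nrm_nonneg[of n "D (\<lambda>_. 0)"] by linarith
      then show ?thesis using le by (intro le_if_mult_self_le[OF le]) simp_all
    qed
    have vrad: "nrm n (D v) \<le> 32 * W"
      using Brad[OF v4] by (simp add: dps(2) nrm_scaleR)
    \<comment> \<open>The body is recentred at \<open>v / 16\<close> and dilated by 16. A functional
      \<open>y \<le> 1\<close> then becomes \<open>T y \<le> 16 - s y\<close>, so \<open>Yh\<close>
      is the polar net of the new body. Where \<open>T y\<close> is large, \<open>s y\<close> is
      very negative and the denominator compensates: the norms in \<open>Yh\<close> are bounded by
      an absolute constant.\<close>
    define S where "S x = 16 *\<^sub>R D x" for x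
    define Si where "Si x = (1/16) *\<^sub>R Di x" for x
    define u where "u = (- 1/16) *\<^sub>R v"
    have Su: "S (x + u) = 16 *\<^sub>R D x - D v" for x
      by (simp add: S_def u_def dps scaleR_add_right scaleR_diff_right)
    define Xh where "Xh = (\<lambda>x. 16 *\<^sub>R D x - D v) ` Xs"
    define Yh where "Yh = (\<lambda>y. (1 / (16 - s y)) *\<^sub>R T y) ` Ys"
    define HX where "HX A = 16 * q A - ip n (D v) (gau N A)" for A
    define HY where "HY A = 1 + V A" for A
    have Rn_closed: "x + y \<in> Rn n" "x - y \<in> Rn n" "a *\<^sub>R x \<in> Rn n" if "x \<in> Rn n" "y \<in> Rn n" for x y :: "nat \<Rightarrow> real" and a :: real
      using that by (auto simp: Rn_def scaleR_fun_def)
    have good: "good_position n N M W ((\<lambda>x. S (x + u)) ` B)"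
      unfolding good_position_def good_data_def
    proof (rule exI[of _ Xh], rule exI[of _ Yh], rule exI[of _ HX], rule exI[of _ HY], intro conjI ballI allI impI)
      show "finite Xh" "Xh \<noteq> {}" "finite Yh" "Yh \<noteq> {}" using Xs Xne Ys by (auto simp: Xh_def Yh_def)
      show "card Xh \<le> M" unfolding Xh_def M_def using card_image_le[OF Xs(1)] by (rule order_trans) simp
      show "card Yh \<le> M" unfolding Yh_def M_def using card_image_le[OF Ys(1)] by (rule order_trans) simp
      show "nrm n x \<le> 96 * W" if xx: "x \<in> Xh" for x
      proof -
        obtain x' where x': "x' \<in> Xs" "x = 16 *\<^sub>R D x' - D v" using xx by (auto simp: Xh_def)
        have "nrm n x \<le> nrm n (16 *\<^sub>R D x') + nrm n (D v)" unfolding x'(2) by (rule nrm_diff_le)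
        then show ?thesis using Xrad[OF x'(1)] vrad by (simp add: nrm_scaleR)
      qed
      show "nrm n y \<le> 4" if yy: "y \<in> Yh" for y
      proof -
        obtain y' where y': "y' \<in> Ys" "y = (1 / (16 - s y')) *\<^sub>R T y'" using yy by (auto simp: Yh_def)
        have "nrm n (T y') \<le> 4 * (16 - s y')" using Ty[OF y'(1)] s_le[OF y'(1)] by (simp add: max_def split: if_splits)
        then show ?thesis unfolding y'(2) nrm_scaleR using s_le[OF y'(1)] by (simp add: divide_le_eq)
      qed
      fix A assume A: "A \<subseteq> ?J"
      show "0 \<le> HY A" using V0[of A] A by (simp add: HY_def)
      show "0 \<le> HX A"
      proof -
        obtain \<psi> where \<psi>: "\<And>u. ip n (gau N A) (D u) = ip n \<psi> u" using adj by blast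
        obtain x where x: "x \<in> Xs" "ip n \<psi> ((1/4) *\<^sub>R v) \<le> 2 * ip n \<psi> x" using supp[OF v4] by blast
        have "ip n (D v) (gau N A) = 4 * ip n \<psi> ((1/4) *\<^sub>R v)" by (simp add: ip_scaleR_right ip_commute[of n "D v"] \<psi>)
        also have "\<dots> \<le> 8 * ip n (D x) (gau N A)" using x(2) by (simp add: ip_commute[of n "D x"] \<psi>)
        also have "\<dots> \<le> 8 * q A" using qge[OF x(1)] by simp
        finally show ?thesis using q0[of A] by (simp add: HX_def)
      qed
      show "ip n x (gau N A) \<le> HX A" if xx: "x \<in> Xh" for x
      proof -
        obtain x' where x': "x' \<in> Xs" "x = 16 *\<^sub>R D x' - D v" using xx by (auto simp: Xh_def)
        have "ip n x (gau N A) = 16 * ip n (D x') (gau N A) - ip n (D v) (gau N A)"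
          unfolding x'(2) by (simp add: ip_def scaleR_fun_def left_diff_distrib sum_subtractf sum_distrib_left mult.assoc)
        then show ?thesis using qge[OF x'(1), of A] by (simp add: HX_def)
      qed
      show "ip n y (gau N A) \<le> HY A" if yy: "y \<in> Yh" for y
      proof -
        obtain y' where y': "y' \<in> Ys" "y = (1 / (16 - s y')) *\<^sub>R T y'" using yy by (auto simp: Yh_def)
        define z where "z = 16 - s y'"
        have z: "14 \<le> z" using s_le[OF y'(1)] by (simp add: z_def)
        have V0A: "0 \<le> V A" using V0[of A] A by simp
        have "ip n (T y') (gau N A) \<le> V A - s y'" using Vup[of A y'] A y'(1) by (simp add: s_def)
        also have "\<dots> \<le> V A + z" by (simp add: z_def)
        also have "\<dots> \<le> V A * z + z" using mult_left_mono[of 1 z "V A"] V0A z by simp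
        finally have "ip n (T y') (gau N A) \<le> (1 + V A) * z" by (simp add: algebra_simps)
        then show ?thesis unfolding y'(2) ip_scaleR_left HY_def z_def[symmetric] using z by (simp add: divide_le_eq)
      qed
    next
      have "avg ?J HX = 16 * avg ?J q" unfolding HX_def[abs_def] by (simp add: avg_diff avg_cmult avg_ip_gau)
      then show "avg ?J HX \<le> 16 * W" using qavg by simp
      show "avg ?J HY \<le> 3" unfolding HY_def[abs_def] using V2' by (simp add: avg_add avg_const)
    next
      fix \<phi> k assume "k \<in> (\<lambda>x. S (x + u)) ` B"
      then obtain b where b: "b \<in> B" "k = 16 *\<^sub>R D b - D v" by (auto simp: Su)
      obtain \<psi> where \<psi>: "\<And>u. ip n \<phi> (D u) = ip n \<psi> u" using adj by blast
      have ex: "ip n \<phi> (16 *\<^sub>R D x - D v) = 16 * ip n \<psi> x - ip n \<psi> v" for x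
      proof -
        have "ip n \<phi> (16 *\<^sub>R D x - D v) = 16 * ip n \<phi> (D x) - ip n \<phi> (D v)"
          by (simp add: ip_def scaleR_fun_def right_diff_distrib sum_subtractf sum_distrib_left ac_simps)
        then show ?thesis by (simp add: \<psi>)
      qed
      obtain x1 where x1: "x1 \<in> Xs" "ip n \<psi> b \<le> 2 * ip n \<psi> x1" using supp[OF b(1)] by blast
      obtain x2 where x2: "x2 \<in> Xs" "ip n \<psi> ((1/4) *\<^sub>R v) \<le> 2 * ip n \<psi> x2" using supp[OF v4] by blast
      \<comment> \<open>The better of the two net points serves both the point \<open>b\<close> and
        the translation \<open>v\<close>: the claim reduces to
        \<open>ip n \<psi> v \<le> 8 * ip n \<psi> x\<close>.\<close>
      define x where "x = (if ip n \<psi> x1 \<le> ip n \<psi> x2 then x2 else x1)"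
      have x: "x \<in> Xs" "ip n \<psi> x1 \<le> ip n \<psi> x" "ip n \<psi> x2 \<le> ip n \<psi> x" using x1(1) x2(1) by (auto simp: x_def)
      have "ip n \<psi> v \<le> 8 * ip n \<psi> x" using x2(2) x(3) by (simp add: ip_scaleR_right)
      then have "ip n \<phi> k \<le> 3 * ip n \<phi> (16 *\<^sub>R D x - D v)" unfolding b(2) ex using x1(2) x(2) by simp
      then show "\<exists>x\<in>Xh. ip n \<phi> k \<le> 3 * ip n \<phi> x" using x(1) by (auto simp: Xh_def)
    next
      fix w' and t :: real assume w': "w' \<in> Rn n" and t: "0 < t" and le: "\<forall>y\<in>Yh. ip n y w' \<le> t"
      define z where "z = Di w'"
      have zR: "z \<in> Rn n" by (simp add: z_def DR)
      define b where "b = (1/4) *\<^sub>R ((1 / (8 * t)) *\<^sub>R (z + t *\<^sub>R v))"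
      have bB: "b \<in> B" unfolding b_def
      proof (rule quart')
        show "(1 / (8 * t)) *\<^sub>R (z + t *\<^sub>R v) \<in> Rn n" using zR v by (intro Rn_closed) auto
        fix y assume y: "y \<in> Ys"
        have "ip n ((1 / (16 - s y)) *\<^sub>R T y) w' \<le> t" using le y by (auto simp: Yh_def)
        then have "ip n (T y) w' \<le> t * (16 - s y)"
          using s_le[OF y] by (simp add: ip_scaleR_left divide_le_eq)
        moreover have "ip n (T y) w' = ip n y z" using dps(5)[of y z] DDi(1)[OF w'] by (simp add: z_def)
        ultimately have "ip n y (z + t *\<^sub>R v) \<le> 16 * t"
          by (simp add: ip_scaleR_right s_def plus_fun_def ip_add_right algebra_simps)
        then show "ip n y ((1 / (8 * t)) *\<^sub>R (z + t *\<^sub>R v)) \<le> 2" using t by (simp add: ip_scaleR_right divide_le_eq)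
      qed
      \<comment> \<open>The convex combination of \<open>b\<close> and \<open>v / 8\<close> that
        restores the right multiple of the translation: \<open>32 * t\<close> times \<open>b\<close>
        minus \<open>t\<close> times \<open>v\<close> equals \<open>48 * t\<close> times
        \<open>k0\<close> minus \<open>3 * t\<close> times \<open>v\<close>.\<close>
      define k0 where "k0 = (\<lambda>i. 2/3 * b i + (1 - 2/3) * (1/2 * ((1/4) *\<^sub>R v) i))"
      have k0B: "k0 \<in> B" unfolding k0_def by (intro cvx bB scale_in v4) auto
      have k0: "z = (48 * t) *\<^sub>R k0 - (3 * t) *\<^sub>R v"
        using t by (simp add: fun_eq_iff k0_def b_def scaleR_fun_def field_simps)
      have "w' = D z" using DDi(1)[OF w'] by (simp add: z_def)
      also have "\<dots> = (48 * t) *\<^sub>R D k0 - (3 * t) *\<^sub>R D v" unfolding k0 by (simp only: dps)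
      also have "\<dots> = (3 * t) *\<^sub>R S (k0 + u)" unfolding Su by (simp add: scaleR_diff_right)
      finally show "\<exists>k\<in>(\<lambda>x. S (x + u)) ` B. w' = (3 * t) *\<^sub>R k" using k0B by blast
    qed
    have lin: "linear D" "linear Di" using dp by (simp_all add: dual_pair_def)
    have "linear S" "linear Si" unfolding S_def[abs_def] Si_def[abs_def]
      by (intro linear_compose_scale_right lin)+
    moreover have "range S \<subseteq> Rn n" "range Si \<subseteq> Rn n" unfolding S_def Si_def using Rn_closed(3) DR by blast+
    moreover have "\<forall>x\<in>Rn n. S (Si x) = x \<and> Si (S x) = x"
      using DDi lin by (simp add: S_def Si_def linear_scale)
    moreover have "u \<in> Rn n" unfolding u_def using v Rn_closed(3) by blast
    moreover have "S ` (\<lambda>z. u + z) ` B = (\<lambda>x. S (x + u)) ` B" by (simp add: image_image add.commute)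
    ultimately show "positionable n N M (21905 * (real l)\<^sup>2 * real n) B"
      unfolding positionable_def W_def[symmetric] using good
      by (intro exI[of _ S] exI[of _ Si] exI[of _ u]) simp
  qed
qed

end

section \<open>The Banach--Mazur distance\<close>

text \<open>Pairs from \<open>X1\<close> and \<open>Y2\<close> test the inclusion for
  \<open>U\<close>, pairs from \<open>Y1\<close> and \<open>X2\<close> the one for its transpose.
  One application of \<open>chevet_orthogonal\<close> to their union provides a common
  \<open>U\<close>. The factor \<open>\<gamma>\<close> on first components makes the entropy of the
  union negligible.\<close>

proposition orthogonal_sandwich:
  assumes n: "2 \<le> n" and N: "1 \<le> N" and W: "1 \<le> W"
    and g1: "good_position n N M\<^sub>1 W K\<^sub>1" and g2: "good_position n N M\<^sub>2 W K\<^sub>2"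
    and \<gamma>: "2 \<le> \<gamma>" "ln (real (2 * (M\<^sub>1 * M\<^sub>2))) \<le> \<gamma>"
    and R: "R = 96 * W * \<gamma>" "4 * R\<^sup>2 \<le> sqrt (real N)" "128 * real n * R ^ 6 \<le> sqrt (real N)"
    and b: "b = 12708 * W / sqrt (real n)"
  shows "\<exists>U\<in>orth n. (\<forall>k\<in>K\<^sub>1. \<exists>k'\<in>K\<^sub>2. mvz n U k = b *\<^sub>R k') \<and>
    (\<forall>k\<in>K\<^sub>2. \<exists>k'\<in>K\<^sub>1. mvz n (\<lambda>(i, j). U (j, i)) k = b *\<^sub>R k')"
proof -
  let ?J = "grid n N"
  obtain X1 Y1 HX1 HY1 where D1: "good_data n N M\<^sub>1 W K\<^sub>1 X1 Y1 HX1 HY1"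
    using g1 unfolding good_position_def by blast
  obtain X2 Y2 HX2 HY2 where D2: "good_data n N M\<^sub>2 W K\<^sub>2 X2 Y2 HX2 HY2"
    using g2 unfolding good_position_def by blast
  note X1 = good_dataD(1-8)[OF D1] and H1 = good_dataD(9-14)[OF D1] and K1 = good_dataD(15,16)[OF D1]
  note X2 = good_dataD(1-8)[OF D2] and H2 = good_dataD(9-14)[OF D2] and K2 = good_dataD(15,16)[OF D2]
  define P1 where "P1 = (\<lambda>(x, y). (\<gamma> *\<^sub>R x, y)) ` (X1 \<times> Y2)"
  define P2 where "P2 = (\<lambda>(y, x). (\<gamma> *\<^sub>R y, x)) ` (Y1 \<times> X2)"
  define P where "P = P1 \<union> P2"
  have fin: "finite P1" "finite P2" using X1 X2 by (simp_all add: P1_def P2_def)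
  have P1ne: "P1 \<noteq> {}" using X1 X2 by (simp add: P1_def)
  have cardP: "card P \<le> 2 * (M\<^sub>1 * M\<^sub>2)"
  proof -
    have 1: "card P1 \<le> card (X1 \<times> Y2)" "card P2 \<le> card (Y1 \<times> X2)"
      unfolding P1_def P2_def by (intro card_image_le finite_cartesian_product X1 X2)+
    have "card (X1 \<times> Y2) \<le> M\<^sub>1 * M\<^sub>2" "card (Y1 \<times> X2) \<le> M\<^sub>1 * M\<^sub>2"
      unfolding card_cartesian_product using X1 X2 by (simp_all add: mult_le_mono)
    then show ?thesis using 1 card_Un_le[of P1 P2] unfolding P_def by linarith
  qed
  have \<gamma>W: "96 * W \<le> R" "4 * \<gamma> \<le> R"
    using mult_mono[of 1 \<gamma> "96 * W" "96 * W"] mult_mono[of 4 "96 * W" \<gamma> \<gamma>] \<gamma>(1) W by (simp_all add: R(1) mult.commute)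
  have cases_P: thesis' if pq: "(p, q) \<in> P"
    and c1: "\<And>x. x \<in> X1 \<Longrightarrow> q \<in> Y2 \<Longrightarrow> p = \<gamma> *\<^sub>R x \<Longrightarrow> thesis'"
    and c2: "\<And>y. y \<in> Y1 \<Longrightarrow> q \<in> X2 \<Longrightarrow> p = \<gamma> *\<^sub>R y \<Longrightarrow> thesis'" for p q thesis'
    using pq c1 c2 unfolding P_def P1_def P2_def by auto
  have nrm\<gamma>: "nrm n (\<gamma> *\<^sub>R x) = \<gamma> * nrm n x" for x using \<gamma>(1) by (simp add: nrm_scaleR)
  interpret pair_process n N P R
  proof
    show "finite P" "P \<noteq> {}" using fin P1ne by (simp_all add: P_def)
    show "2 \<le> n" "1 \<le> N" by (fact n N)+
    fix p q assume pq: "(p, q) \<in> P"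
    have m: "\<gamma> * t \<le> \<gamma> * u" if "t \<le> u" for t u using that \<gamma>(1) by (intro mult_left_mono) auto
    from pq show "nrm n p \<le> R"
    proof (rule cases_P)
      fix x assume "x \<in> X1" "p = \<gamma> *\<^sub>R x"
      then show ?thesis using m[OF X1(7)[of x]] by (simp add: nrm\<gamma> R(1) ac_simps)
    next
      fix y assume "y \<in> Y1" "p = \<gamma> *\<^sub>R y"
      then show ?thesis using m[OF X1(8)[of y]] \<gamma>W(2) by (simp add: nrm\<gamma>)
    qed
    have "4 \<le> R" using \<gamma>W(1) W by linarith
    from pq show "nrm n q \<le> R"
      by (rule cases_P) (use X2(7,8)[of q] \<gamma>W(1) \<open>4 \<le> R\<close> in linarith)+
  qed
  \<comment> \<open>Every kind of pair contributes two of the four nonnegative terms, so their sum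
    serves for all. With the mean bounds 3 and \<open>16 * W\<close> it averages to
    \<open>704 * \<gamma> * W\<close>; two more units cover the entropy and the additive 2.\<close>
  define G where "G A B = \<gamma> * (96 * W * HY2 A + 4 * HX1 B + 4 * HX2 A + 96 * W * HY1 B)" for A B
  have nseG: "nse A B pq \<le> G A B" if pq: "pq \<in> P" and A: "A \<subseteq> ?J" and B: "B \<subseteq> ?J" for A B pq
  proof -
    have prod: "nrm n x * t \<le> c * h" if "nrm n x \<le> c" "t \<le> h" "0 \<le> h" for x t c h
    proof -
      have "nrm n x * t \<le> nrm n x * h" using that by (intro mult_left_mono) auto
      also have "\<dots> \<le> c * h" using that by (intro mult_right_mono) auto
      finally show ?thesis .
    qed
    obtain p q where pq': "pq = (p, q)" by (cases pq)
    have pos: "0 \<le> 96 * W * HY2 A" "0 \<le> 4 * HX1 B" "0 \<le> 4 * HX2 A" "0 \<le> 96 * W * HY1 B"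
      using H1(1,2)[OF B] H2(1,2)[OF A] W by simp_all
    have "(p, q) \<in> P" using pq pq' by simp
    then have "\<exists>h. nse A B pq = \<gamma> * h \<and> h \<le> 96 * W * HY2 A + 4 * HX1 B + 4 * HX2 A + 96 * W * HY1 B"
    proof (rule cases_P)
      fix x assume x: "x \<in> X1" "q \<in> Y2" "p = \<gamma> *\<^sub>R x"
      have "nse A B pq = \<gamma> * (nrm n x * ip n q (gau N A) + nrm n q * ip n x (gau N B))"
        by (simp add: nse_def pq' x(3) nrm\<gamma> ip_scaleR_left algebra_simps)
      moreover have "nrm n x * ip n q (gau N A) \<le> 96 * W * HY2 A"
        by (rule prod[OF X1(7)[OF x(1)] H2(4)[OF A x(2)] H2(2)[OF A]])
      moreover have "nrm n q * ip n x (gau N B) \<le> 4 * HX1 B"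
        by (rule prod[OF X2(8)[OF x(2)] H1(3)[OF B x(1)] H1(1)[OF B]])
      ultimately show ?thesis using pos by (intro exI conjI) (assumption, linarith)
    next
      fix y assume y: "y \<in> Y1" "q \<in> X2" "p = \<gamma> *\<^sub>R y"
      have "nse A B pq = \<gamma> * (nrm n y * ip n q (gau N A) + nrm n q * ip n y (gau N B))"
        by (simp add: nse_def pq' y(3) nrm\<gamma> ip_scaleR_left algebra_simps)
      moreover have "nrm n y * ip n q (gau N A) \<le> 4 * HX2 A"
        by (rule prod[OF X1(8)[OF y(1)] H2(3)[OF A y(2)] H2(1)[OF A]])
      moreover have "nrm n q * ip n y (gau N B) \<le> 96 * W * HY1 B"
        by (rule prod[OF X2(7)[OF y(2)] H1(4)[OF B y(1)] H1(2)[OF B]])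
      ultimately show ?thesis using pos by (intro exI conjI) (assumption, linarith)
    qed
    then show ?thesis using \<gamma>(1) by (auto simp: G_def intro!: mult_left_mono)
  qed
  have "aa (\<lambda>A B. lse P (nse A B)) \<le> aa (\<lambda>A B. G A B + \<gamma>)"
  proof (intro avg_mono)
    fix A B assume AB: "A \<subseteq> ?J" "B \<subseteq> ?J"
    have "lse P (nse A B) \<le> G A B + ln (real (card P))" by (rule lse_upper[OF P_finite P_nonempty nseG[OF _ AB]])
    moreover have "ln (real (card P)) \<le> ln (real (2 * (M\<^sub>1 * M\<^sub>2)))"
      using cardP P_nonempty P_finite card_gt_0_iff[of P] by (intro ln_mono) (auto simp del: of_nat_mult)
    ultimately show "lse P (nse A B) \<le> G A B + \<gamma>" using \<gamma>(2) by linarith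
  qed
  also have "\<dots> = \<gamma> * (96 * W * avg ?J HY2 + 4 * avg ?J HX1 + 4 * avg ?J HX2 + 96 * W * avg ?J HY1) + \<gamma>"
    by (simp add: G_def avg_add avg_cmult avg_const)
  also have "\<dots> \<le> \<gamma> * (96 * W * 3 + 4 * (16 * W) + 4 * (16 * W) + 96 * W * 3) + \<gamma>"
    using \<gamma>(1) W H1(5,6) H2(5,6) by (intro add_mono mult_left_mono) auto
  finally have lse_le: "aa (\<lambda>A B. lse P (nse A B)) + 2 \<le> \<gamma> * (706 * W)"
  proof -
    assume le: "aa (\<lambda>A B. lse P (nse A B)) \<le> \<gamma> * (96 * W * 3 + 4 * (16 * W) + 4 * (16 * W) + 96 * W * 3) + \<gamma>"
    have "\<gamma> * 1 \<le> \<gamma> * W" using W \<gamma>(1) by (intro mult_left_mono) auto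
    moreover have "\<gamma> * (96 * W * 3 + 4 * (16 * W) + 4 * (16 * W) + 96 * W * 3) = 704 * (\<gamma> * W)" "\<gamma> * (706 * W) = 706 * (\<gamma> * W)"
      by simp_all
    ultimately show ?thesis using le \<gamma>(1) by linarith
  qed
  obtain U where U: "U \<in> orth n" "\<And>pq. pq \<in> P \<Longrightarrow> sqrt ((real n - 1) / 2) * cpl U pq \<le> aa (\<lambda>A B. lse P (nse A B)) + 2"
    using chevet_orthogonal[OF R(2,3)] by blast
  \<comment> \<open>\<open>1412 = 2 * 706\<close>, since \<open>sqrt ((n - 1) / 2)\<close> is at
    least \<open>sqrt n / 2\<close>. The factor 9 between \<open>a\<close> and \<open>b\<close>
    consists of one 3 from the net of the body and one 3 from the net of the polar.\<close>
  define a where "a = 1412 * W / sqrt (real n)"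
  have sn: "0 < sqrt (real n)" using n by simp
  have a0: "0 < a" using sn W by (simp add: a_def)
  have ba: "b = 3 * (3 * a)" by (simp add: a_def b)
  have mvz_mv: "ip n (mvz n U x) y = ip n (mv n U x) y" for x y by (rule ip_cong) (simp_all add: mvz_def mv_def)
  have le_a: "ip n (mvz n U x) y \<le> a" if "(\<gamma> *\<^sub>R x, y) \<in> P" for x y
  proof (cases "0 \<le> ip n (mvz n U x) y")
    case True
    have "cpl U (\<gamma> *\<^sub>R x, y) = \<gamma> * ip n (mvz n U x) y"
      unfolding mvz_mv by (simp add: cpl_def ip_def mv_def scaleR_fun_def sum_distrib_left sum_distrib_right ac_simps)
    then have "\<gamma> * (sqrt ((real n - 1) / 2) * ip n (mvz n U x) y) \<le> \<gamma> * (706 * W)"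
      using U(2)[OF that] lse_le by (simp add: ac_simps)
    then have 1: "sqrt ((real n - 1) / 2) * ip n (mvz n U x) y \<le> 706 * W"
      using \<gamma>(1) by simp
    have "real n / 4 \<le> (real n - 1) / 2" using n by simp
    then have "sqrt (real n / 4) \<le> sqrt ((real n - 1) / 2)" by (rule real_sqrt_le_mono)
    then have "sqrt (real n) / 2 * ip n (mvz n U x) y \<le> sqrt ((real n - 1) / 2) * ip n (mvz n U x) y"
      using True by (intro mult_right_mono) (simp_all add: real_sqrt_divide)
    with 1 have "ip n (mvz n U x) y * sqrt (real n) \<le> 1412 * W" by (simp add: mult.commute)
    then show ?thesis unfolding a_def using sn by (simp add: pos_le_divide_eq)
  next
    case False
    then show ?thesis using a0 by simp
  qed
  let ?Ut = "\<lambda>(i, j). U (j, i)"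
  have tr: "ip n (mvz n ?Ut y) w = ip n (mvz n U w) y" for y w
    unfolding ip_mvz_transpose[of n U w] by (rule ip_commute)
  show ?thesis
  proof (intro bexI[OF _ U(1)] conjI ballI)
    fix k assume k: "k \<in> K\<^sub>1"
    show "\<exists>k'\<in>K\<^sub>2. mvz n U k = b *\<^sub>R k'" unfolding ba
    proof (rule K2(2))
      show "mvz n U k \<in> Rn n" "0 < 3 * a" using a0 by simp_all
      fix y assume y: "y \<in> Y2"
      obtain x where x: "x \<in> X1" "ip n (mvz n ?Ut y) k \<le> 3 * ip n (mvz n ?Ut y) x" using K1(1)[OF k] by blast
      have "(\<gamma> *\<^sub>R x, y) \<in> P" using x(1) y by (auto simp: P_def P1_def)
      then have "ip n (mvz n U x) y \<le> a" by (rule le_a)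
      then show "ip n y (mvz n U k) \<le> 3 * a" using x(2) unfolding tr ip_commute[of n y] by linarith
    qed
  next
    fix k assume k: "k \<in> K\<^sub>2"
    show "\<exists>k'\<in>K\<^sub>1. mvz n ?Ut k = b *\<^sub>R k'" unfolding ba
    proof (rule K1(2))
      show "mvz n ?Ut k \<in> Rn n" "0 < 3 * a" using a0 by simp_all
      fix y assume y: "y \<in> Y1"
      obtain x where x: "x \<in> X2" "ip n (mvz n U y) k \<le> 3 * ip n (mvz n U y) x" using K2(1)[OF k] by blast
      have "(\<gamma> *\<^sub>R y, x) \<in> P" using x(1) y by (auto simp: P_def P2_def)
      then have "ip n (mvz n U y) x \<le> a" by (rule le_a)
      then show "ip n y (mvz n ?Ut k) \<le> 3 * a" using x(2) unfolding ip_commute[of n y] tr by linarith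
    qed
  qed
qed

section \<open>From convex bodies and the distance to coordinates and back\<close>

lemma topspace_Rn: "topspace (Euclidean_space n) = Rn n"
  by (simp add: topspace_Euclidean_space Rn_def)

text \<open>A basic open set of the product topology around an interior point gives one radius per
  coordinate. Coordinates from \<open>n\<close> on vanish throughout \<open>Rn\<close>, so the
  minimum over the first \<open>n\<close> radii yields a box.\<close>

lemma convex_body_translate:
  assumes cb: "convex_body n K" and n: "1 \<le> n"
  obtains c r L where "c \<in> Rn n" "body n ((\<lambda>x i. x i - c i) ` K) r L"
proof -
  have KR: "K \<subseteq> Rn n" and Kc: "compact K"
    using cb by (auto simp: convex_body_def Euclidean_space_def compactin_subtopology euclidean_product_topology Rn_def)
  obtain p U where U: "openin (Euclidean_space n) U" "p \<in> U" "U \<subseteq> K"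
    using cb by (auto simp: convex_body_def interior_of_def)
  obtain V where V: "openin (powertop_real UNIV) V" "U = V \<inter> Rn n"
    using U(1) by (auto simp: Euclidean_space_def openin_subtopology Rn_def)
  have "p \<in> V" using U(2) V(2) by blast
  then have "\<exists>X. p \<in> Pi\<^sub>E UNIV X \<and> (\<forall>i. open (X i)) \<and> Pi\<^sub>E UNIV X \<subseteq> V"
    using product_topology_open_contains_basis[OF V(1), of p] by simp blast
  then obtain X where X: "p \<in> Pi\<^sub>E UNIV X" "\<And>i. open (X i)" "Pi\<^sub>E UNIV X \<subseteq> V" by blast
  have pR: "p \<in> Rn n" using U(2) V(2) by blast
  have "\<exists>e>0. \<forall>t. \<bar>t - p i\<bar> \<le> e \<longrightarrow> t \<in> X i" for i
  proof -
    have "p i \<in> X i" using X(1) by auto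
    then obtain e where "0 < e" "cball (p i) e \<subseteq> X i" using X(2)[of i] open_contains_cball by blast
    then show ?thesis by (intro exI[of _ e]) (auto simp: dist_real_def abs_minus_commute subset_iff)
  qed
  then obtain e where e: "\<And>i. 0 < e i" "\<And>i t. \<bar>t - p i\<bar> \<le> e i \<Longrightarrow> t \<in> X i" by metis
  define r where "r = Min (insert 1 (e ` {..<n}))"
  have r0: "0 < r" using e(1) by (simp add: r_def)
  have re: "r \<le> e i" if "i < n" for i using that by (simp add: r_def)
  have "\<exists>b. \<forall>x\<in>K. \<bar>x i\<bar> \<le> b" for i
  proof -
    have "compact ((\<lambda>x. x i) ` K)"
      by (intro compact_continuous_image Kc continuous_on_subset[OF continuous_on_product_coordinates]) simp
    then have "bounded ((\<lambda>x. x i) ` K)" by (rule compact_imp_bounded)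
    then show ?thesis by (auto simp: bounded_iff)
  qed
  then obtain b where b: "\<And>i x. x \<in> K \<Longrightarrow> \<bar>x i\<bar> \<le> b i" by metis
  define L where "L = Max (insert 0 (b ` {..<n}))"
  have L_nonneg: "0 \<le> L" by (simp add: L_def)
  have bd: "\<bar>x i\<bar> \<le> L" if x: "x \<in> K" for x i
  proof (cases "i < n")
    case True
    then have "b i \<le> L" by (simp add: L_def)
    then show ?thesis using b[OF x, of i] by linarith
  next
    case False
    have "x \<in> Rn n" using x KR by blast
    then show ?thesis using False L_nonneg by (simp add: Rn_def)
  qed
  have pK: "p \<in> K" using U by blast
  have "body n ((\<lambda>x i. x i - p i) ` K) r (2 * L)"
  proof (rule body_translate[OF n KR Kc _ pR r0])
    fix x y and t :: real assume "x \<in> K" "y \<in> K" "0 \<le> t" "t \<le> 1"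
    then have "t *\<^sub>R x + (1 - t) *\<^sub>R y \<in> K"
      using cb by (intro convexD[of K]) (auto simp: convex_body_def)
    moreover have "t *\<^sub>R x + (1 - t) *\<^sub>R y = (\<lambda>i. t * x i + (1 - t) * y i)"
      by (simp add: scaleR_fun_def fun_eq_iff)
    ultimately show "(\<lambda>i. t * x i + (1 - t) * y i) \<in> K" by simp
  next
    fix x i assume "x \<in> K"
    then show "\<bar>x i - p i\<bar> \<le> 2 * L" using bd[of x i] bd[OF pK, of i] by linarith
  next
    fix z assume z: "z \<in> Rn n" "\<And>i. i < n \<Longrightarrow> \<bar>z i - p i\<bar> \<le> r"
    have "z i \<in> X i" for i
    proof (cases "i < n")
      case True
      then show ?thesis using z(2) re by (intro e(2)) force
    next
      case False
      then have "z i = p i" using z(1) pR by (simp add: Rn_def)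
      then show ?thesis using e(1)[of i] by (intro e(2)) simp
    qed
    then have "z \<in> V" using X(3) by auto
    then show "z \<in> K" using z(1) V(2) U(3) by blast
  qed
  then show thesis by (rule that[OF pR])
qed

lemma convex_body_position:
  assumes "convex_body n K" and n: "1 \<le> n" and l: "1 \<le> l" "n \<le> 2 ^ l"
  shows "\<exists>M N0. \<forall>N\<ge>N0. positionable n N M (21905 * (real l)\<^sup>2 * real n) K"
proof -
  obtain p r L where p: "p \<in> Rn n" "body n ((\<lambda>x i. x i - p i) ` K) r L"
    by (rule convex_body_translate[OF assms(1) n])
  obtain c r' L' where c: "c \<in> Rn n" "centred_body n ((\<lambda>x i. x i - c i) ` (\<lambda>x i. x i - p i) ` K) r' L'"
    by (rule body.centred_translate[OF p(2)])
  show ?thesis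
    using centred_body.good_position_exists[OF c(2) l]
    by (blast intro: positionable_translate[OF positionable_translate[OF _ c(1)] p(1)])
qed

text \<open>The witness is \<open>b\<close> times \<open>S\<close>: the inclusion for the inverse
  gives the lower half of the sandwich, and the inclusion for \<open>S\<close> picks up a second
  factor \<open>b\<close> in the upper half.\<close>

lemma banach_mazur_distance_le:
  assumes T: "linear S" "linear S'" "range S \<subseteq> Rn n" "range S' \<subseteq> Rn n"
    "\<And>z. z \<in> Rn n \<Longrightarrow> S (S' z) = z" "\<And>z. z \<in> Rn n \<Longrightarrow> S' (S z) = z"
    and x: "x \<in> Rn n" and y: "y \<in> Rn n" and K: "K\<^sub>2 \<subseteq> Rn n" and b: "1 \<le> b"
    and up: "\<And>z. z \<in> K\<^sub>1 \<Longrightarrow> \<exists>w\<in>K\<^sub>2. S (x + z) = b *\<^sub>R (y + w)"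
    and lo: "\<And>w. w \<in> K\<^sub>2 \<Longrightarrow> \<exists>z\<in>K\<^sub>1. S' (y + w) = b *\<^sub>R (x + z)"
  shows "banach_mazur_distance n K\<^sub>1 K\<^sub>2 \<le> ereal (b\<^sup>2)"
proof -
  define T where "T z = b *\<^sub>R S z" for z
  define T' where "T' z = (1/b) *\<^sub>R S' z" for z
  have sc: "c *\<^sub>R z \<in> Rn n" if "z \<in> Rn n" for c and z :: "nat \<Rightarrow> real" using that by (simp add: Rn_def scaleR_fun_def)
  have "linear T" unfolding T_def by (intro linear_compose_scale_right T)
  moreover have "bij_betw T (Rn n) (Rn n)"
  proof (rule bij_betw_byWitness[of _ T'])
    show "\<forall>z\<in>Rn n. T' (T z) = z" "\<forall>z\<in>Rn n. T (T' z) = z"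
      using b T(5,6) by (simp_all add: T_def T'_def linear_scale[OF T(1)] linear_scale[OF T(2)])
    show "T ` Rn n \<subseteq> Rn n" "T' ` Rn n \<subseteq> Rn n" using T(3,4) sc by (auto simp: T_def T'_def)
  qed
  ultimately have inv: "invertible_linear_on n T" by (simp add: invertible_linear_on_def topspace_Rn)
  have 1: "(\<lambda>z. y + z) ` K\<^sub>2 \<subseteq> T ` (\<lambda>z. x + z) ` K\<^sub>1"
  proof (rule image_subsetI)
    fix w assume w: "w \<in> K\<^sub>2"
    obtain z where z: "z \<in> K\<^sub>1" "S' (y + w) = b *\<^sub>R (x + z)" using lo[OF w] by blast
    have "y + w \<in> Rn n" using y w K by (auto simp: Rn_def)
    then have "y + w = S (S' (y + w))" by (simp add: T(5))
    also have "\<dots> = T (x + z)" unfolding z(2) T_def by (rule linear_scale[OF T(1)])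
    finally show "y + w \<in> T ` (\<lambda>z. x + z) ` K\<^sub>1" using z(1) by blast
  qed
  have 2: "T ` (\<lambda>z. x + z) ` K\<^sub>1 \<subseteq> (\<lambda>z. b\<^sup>2 *\<^sub>R z) ` (\<lambda>z. y + z) ` K\<^sub>2"
    unfolding image_image
  proof (rule image_subsetI)
    fix z assume "z \<in> K\<^sub>1"
    then obtain w where "w \<in> K\<^sub>2" "S (x + z) = b *\<^sub>R (y + w)" using up by blast
    then show "T (x + z) \<in> (\<lambda>z. b\<^sup>2 *\<^sub>R (y + z)) ` K\<^sub>2"
      by (intro image_eqI[of _ _ w]) (simp_all add: T_def power2_eq_square)
  qed
  have "1 \<le> b\<^sup>2" using b by (rule one_le_power)
  then have "b\<^sup>2 \<in> {l::real. 1 \<le> l \<and>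
        (\<exists>T. \<exists>x \<in> topspace (Euclidean_space n). \<exists>y \<in> topspace (Euclidean_space n).
          invertible_linear_on n T \<and>
          (\<lambda>z. y + z) ` K\<^sub>2 \<subseteq> T ` (\<lambda>z. x + z) ` K\<^sub>1 \<and>
          T ` (\<lambda>z. x + z) ` K\<^sub>1 \<subseteq> (\<lambda>z. l *\<^sub>R z) ` (\<lambda>z. y + z) ` K\<^sub>2)}"
    using inv 1 2 x y unfolding topspace_Rn by blast
  then show ?thesis unfolding banach_mazur_distance_def by (rule INF_lower)
qed

text \<open>With \<open>2^k < n\<close> the next power is at most \<open>n^2\<close>; the factor 3
  is 2 divided by the bound \<open>2/3\<close> for \<open>ln 2\<close>.\<close>

lemma dyadic_exponent:
  assumes "2 \<le> n"
  obtains l where "1 \<le> l" "n \<le> 2 ^ l" "real l \<le> 3 * ln (real n)"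
proof -
  obtain k where k: "2 ^ k < n" "n \<le> 2 ^ (k + 1)" using ex_power_ivl2[of 2 n] assms by auto
  have "real (2 ^ (k + 1)) \<le> real (n * n)" using k(1) assms
    unfolding of_nat_le_iff by (simp add: mult_le_mono order.strict_implies_order)
  then have "ln (real (2 ^ (k + 1))) \<le> ln (real (n * n))" using assms by (intro ln_mono) auto
  also have "ln (real (n * n)) = 2 * ln (real n)" using assms by (simp add: ln_mult)
  also have "ln (real (2 ^ (k + 1))) = real (k + 1) * ln 2" unfolding of_nat_power by (subst ln_realpow) auto
  finally have "real (k + 1) * ln 2 \<le> 2 * ln (real n)" .
  moreover have "real (k + 1) * (2/3) \<le> real (k + 1) * ln 2" using ln2_ge_two_thirds by (intro mult_left_mono) auto
  moreover have "t \<le> 3 * u" if "t * c \<le> 2 * u" "t * (2/3) \<le> t * c" for t c u :: real using that by linarith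
  ultimately have "real (k + 1) \<le> 3 * ln (real n)" by blast
  then show thesis using k(2) by (intro that[of "k + 1"]) auto
qed

theorem theorem1p1:
  shows "\<exists>C \<alpha> :: real. 0 < C \<and> 0 < \<alpha> \<and>
    (\<forall>n \<ge> 2. \<forall>K\<^sub>1 K\<^sub>2. convex_body n K\<^sub>1 \<longrightarrow> convex_body n K\<^sub>2 \<longrightarrow>
      banach_mazur_distance n K\<^sub>1 K\<^sub>2 \<le> ereal (C * real n * ln (real n) powr \<alpha>))"
proof (rule exI[of _ "81 * (12708 * 21905)\<^sup>2"], rule exI[of _ 4], intro conjI allI impI)
  show "(0::real) < 81 * (12708 * 21905)\<^sup>2" "(0::real) < 4" by simp_all
  fix n :: nat and K\<^sub>1 K\<^sub>2 assume n: "2 \<le> n" and K: "convex_body n K\<^sub>1" "convex_body n K\<^sub>2"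
  have n1: "1 \<le> n" using n by simp
  obtain l where l: "1 \<le> l" "n \<le> 2 ^ l" "real l \<le> 3 * ln (real n)" by (rule dyadic_exponent[OF n])
  define W where "W = 21905 * (real l)\<^sup>2 * real n"
  obtain M1 N1 where MN1: "\<forall>N\<ge>N1. positionable n N M1 W K\<^sub>1"
    using convex_body_position[OF K(1) n1 l(1,2), folded W_def] by (elim exE)
  obtain M2 N2 where MN2: "\<forall>N\<ge>N2. positionable n N M2 W K\<^sub>2"
    using convex_body_position[OF K(2) n1 l(1,2), folded W_def] by (elim exE)
  have Wn: "real n \<le> W"
  proof -
    have "1 * 1 \<le> 21905 * (real l)\<^sup>2" using l(1) by (intro mult_mono) auto
    then show ?thesis using mult_right_mono[of 1 "21905 * (real l)\<^sup>2" "real n"] by (simp add: W_def)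
  qed
  have W1: "1 \<le> W" using Wn n by simp
  define \<gamma> where "\<gamma> = max 2 (ln (real (2 * (M1 * M2))))"
  define R where "R = 96 * W * \<gamma>"
  \<comment> \<open>\<open>N\<close> can be chosen only now: \<open>R\<close> involves the net sizes
    \<open>M1\<close> and \<open>M2\<close>, which are the same for all large
    \<open>N\<close>.\<close>
  obtain N3 :: nat where N3: "(4 * R\<^sup>2)\<^sup>2 + (128 * real n * R ^ 6)\<^sup>2 < real N3" using reals_Archimedean2 by blast
  define N where "N = N1 + N2 + N3 + 1"
  have big: "(4 * R\<^sup>2)\<^sup>2 \<le> real N" "(128 * real n * R ^ 6)\<^sup>2 \<le> real N"
    using N3 zero_le_power2[of "4 * R\<^sup>2"] zero_le_power2[of "128 * real n * R ^ 6"] unfolding N_def of_nat_add by linarith+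
  have sq: "4 * R\<^sup>2 \<le> sqrt (real N)" "128 * real n * R ^ 6 \<le> sqrt (real N)"
    using big by (auto intro: real_le_rsqrt)
  have N: "N1 \<le> N" "N2 \<le> N" "1 \<le> N" by (simp_all add: N_def)
  obtain S1 T1 x where S1: "linear S1" "linear T1" "range S1 \<subseteq> Rn n" "range T1 \<subseteq> Rn n"
    "\<forall>z\<in>Rn n. S1 (T1 z) = z \<and> T1 (S1 z) = z" "x \<in> Rn n"
    "good_position n N M1 W (S1 ` (\<lambda>z. x + z) ` K\<^sub>1)"
    using MN1[rule_format, OF N(1)] unfolding positionable_def by (elim exE conjE)
  obtain S2 T2 y where S2: "linear S2" "linear T2" "range S2 \<subseteq> Rn n" "range T2 \<subseteq> Rn n"
    "\<forall>z\<in>Rn n. S2 (T2 z) = z \<and> T2 (S2 z) = z" "y \<in> Rn n"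
    "good_position n N M2 W (S2 ` (\<lambda>z. y + z) ` K\<^sub>2)"
    using MN2[rule_format, OF N(2)] unfolding positionable_def by (elim exE conjE)
  define b where "b = 12708 * W / sqrt (real n)"
  have \<gamma>: "2 \<le> \<gamma>" "ln (real (2 * (M1 * M2))) \<le> \<gamma>" by (simp_all add: \<gamma>_def)
  have "\<exists>U\<in>orth n. (\<forall>k\<in>S1 ` (\<lambda>z. x + z) ` K\<^sub>1. \<exists>k'\<in>S2 ` (\<lambda>z. y + z) ` K\<^sub>2. mvz n U k = b *\<^sub>R k') \<and>
    (\<forall>k\<in>S2 ` (\<lambda>z. y + z) ` K\<^sub>2. \<exists>k'\<in>S1 ` (\<lambda>z. x + z) ` K\<^sub>1. mvz n (\<lambda>(i, j). U (j, i)) k = b *\<^sub>R k')"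
    by (rule orthogonal_sandwich[OF n N(3) W1 S1(7) S2(7) \<gamma> R_def sq b_def])
  then obtain U where U: "U \<in> orth n"
    "\<forall>k\<in>S1 ` (\<lambda>z. x + z) ` K\<^sub>1. \<exists>k'\<in>S2 ` (\<lambda>z. y + z) ` K\<^sub>2. mvz n U k = b *\<^sub>R k'"
    "\<forall>k\<in>S2 ` (\<lambda>z. y + z) ` K\<^sub>2. \<exists>k'\<in>S1 ` (\<lambda>z. x + z) ` K\<^sub>1. mvz n (\<lambda>(i, j). U (j, i)) k = b *\<^sub>R k'"
    by (elim bexE conjE)
  let ?Ut = "\<lambda>(i, j). U (j, i)"
  have inv: "mvz n U (mvz n ?Ut z) = z" "mvz n ?Ut (mvz n U z) = z" if "z \<in> Rn n" for z
  proof -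
    show "mvz n U (mvz n ?Ut z) = z"
      by (rule mvz_inverse[OF _ that]) (simp add: orth_transpose_inverse[OF U(1)])
    show "mvz n ?Ut (mvz n U z) = z"
      by (rule mvz_inverse[OF _ that]) (use U(1) in \<open>simp add: orth_def\<close>)
  qed
  have sn: "0 < sqrt (real n)" using n by simp
  have add_Rn: "x + z \<in> Rn n" if "x \<in> Rn n" "z \<in> Rn n" for x z :: "nat \<Rightarrow> real" using that by (simp add: Rn_def)
  have KR: "K\<^sub>1 \<subseteq> Rn n" "K\<^sub>2 \<subseteq> Rn n"
    using K by (auto simp: convex_body_def compactin_def topspace_Rn)
  have rng: "S1 z \<in> Rn n" "T1 z \<in> Rn n" "S2 z \<in> Rn n" "T2 z \<in> Rn n" for z using S1(3,4) S2(3,4) by auto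
  have "banach_mazur_distance n K\<^sub>1 K\<^sub>2 \<le> ereal (b\<^sup>2)"
  proof (rule banach_mazur_distance_le[where S = "\<lambda>z. T2 (mvz n U (S1 z))" and S' = "\<lambda>z. T1 (mvz n ?Ut (S2 z))"])
    show "linear (\<lambda>z. T2 (mvz n U (S1 z)))" "linear (\<lambda>z. T1 (mvz n ?Ut (S2 z)))"
      using linear_compose[OF linear_compose[OF S1(1) linear_mvz] S2(2), of n U]
        linear_compose[OF linear_compose[OF S2(1) linear_mvz] S1(2), of n ?Ut] by (simp_all add: comp_def)
    show "range (\<lambda>z. T2 (mvz n U (S1 z))) \<subseteq> Rn n" "range (\<lambda>z. T1 (mvz n ?Ut (S2 z))) \<subseteq> Rn n" using rng by auto
    show "T2 (mvz n U (S1 (T1 (mvz n ?Ut (S2 z))))) = z" "T1 (mvz n ?Ut (S2 (T2 (mvz n U (S1 z))))) = z"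
      if "z \<in> Rn n" for z using that S1(5) S2(5) by (simp_all add: inv rng)
    show "x \<in> Rn n" "y \<in> Rn n" "K\<^sub>2 \<subseteq> Rn n" by (fact S1(6) S2(6) KR(2))+
    have "sqrt (real n) \<le> sqrt (real n) * sqrt (real n)"
      using mult_left_mono[of 1 "sqrt (real n)" "sqrt (real n)"] n by simp
    then have "sqrt (real n) \<le> W" using Wn by simp
    then show "1 \<le> b" unfolding b_def using sn W1 by (simp add: pos_le_divide_eq)
  next
    fix z assume z: "z \<in> K\<^sub>1"
    obtain w where w: "w \<in> K\<^sub>2" "mvz n U (S1 (x + z)) = b *\<^sub>R S2 (y + w)" using U(2)[rule_format, OF imageI[OF imageI[OF z]]] by (elim bexE imageE) simp
    have "y + w \<in> Rn n" using w(1) KR S2(6) add_Rn by blast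
    then have "T2 (mvz n U (S1 (x + z))) = b *\<^sub>R (y + w)" unfolding w(2) linear_scale[OF S2(2)] using S2(5) by simp
    then show "\<exists>w\<in>K\<^sub>2. T2 (mvz n U (S1 (x + z))) = b *\<^sub>R (y + w)" using w(1) by blast
  next
    fix w assume w: "w \<in> K\<^sub>2"
    obtain z where z: "z \<in> K\<^sub>1" "mvz n ?Ut (S2 (y + w)) = b *\<^sub>R S1 (x + z)" using U(3)[rule_format, OF imageI[OF imageI[OF w]]] by (elim bexE imageE) simp
    have "x + z \<in> Rn n" using z(1) KR S1(6) add_Rn by blast
    then have "T1 (mvz n ?Ut (S2 (y + w))) = b *\<^sub>R (x + z)" unfolding z(2) linear_scale[OF S1(2)] using S1(5) by simp
    then show "\<exists>z\<in>K\<^sub>1. T1 (mvz n ?Ut (S2 (y + w))) = b *\<^sub>R (x + z)" using z(1) by blast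
  qed
  also have "b\<^sup>2 \<le> 81 * (12708 * 21905)\<^sup>2 * real n * ln (real n) powr 4"
  proof -
    \<comment> \<open>\<open>W\<close> is linear in \<open>n\<close>, so \<open>W^2 / n\<close>
      leaves one factor \<open>n\<close> and the fourth power of \<open>l\<close>; the 81 is
      \<open>3^4\<close>.\<close>
    have "b\<^sup>2 = (12708 * 21905)\<^sup>2 * real n * real l ^ 4"
      using n by (simp add: b_def W_def power_divide power_mult_distrib power2_eq_square power4_eq_xxxx)
    also have "\<dots> \<le> (12708 * 21905)\<^sup>2 * real n * (3 * ln (real n)) ^ 4"
      using l(3) by (intro mult_left_mono power_mono) auto
    also have "\<dots> = 81 * (12708 * 21905)\<^sup>2 * real n * ln (real n) ^ 4" by (simp add: power_mult_distrib)
    also have "ln (real n) ^ 4 = ln (real n) powr 4" using n by (simp add: powr_numeral)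
    finally show ?thesis .
  qed
  finally show "banach_mazur_distance n K\<^sub>1 K\<^sub>2 \<le> ereal (81 * (12708 * 21905)\<^sup>2 * real n * ln (real n) powr 4)" by simp
qed

end
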